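(* Let ZFP be the first-order theory described in the context, and let $(\cdot)^*$ be the translation of ZFP formulas into ZF formulas described in the context. For every axiom $\varphi$ of ZFP, the translated formula $\varphi^*$ is a theorem of ZF (Zermelo–Fraenkel set theory). (Consequently, ZFP is consistent if ZF is.)
   Context: Logic: first-order logic with equality whose only predicate symbols are the binary symbols $\in$, $\pi_1$, $\pi_2$, $=$. Terms are variables or definite descriptions $(\iota x:\varphi)$; $(\iota x:\varphi)$ denotes the unique $x$ satisfying $\varphi$ if there is exactly one, and otherwise denotes a value $\bot$ outside the domain such that any atomic formula (including equality) with $\bot$ as an argument is false. Usual abbreviations ($\wedge,\vee,\leftrightarrow,\exists,\exists!,\notin$, $\forall b\in X:\varphi$ for $\forall b:(b\in X\to\varphi)$, $\exists b\in X:\varphi$ for $\exists b:(b\in X\wedge\varphi)$) are used. ZFP abbreviations: $\mathsf{Pair}(Q):=\exists b:\, b\,\pi_1\, Q$; $\mathsf{Set}(X):=\neg\mathsf{Pair}(X)$; $\forall_{\mathsf{Set}}x:\varphi := \forall x:(\mathsf{Set}(x)\to\varphi)$, $\exists_{\mathsf{Set}}x:\varphi:=\exists x:(\mathsf{Set}(x)\wedge\varphi)$, $\forall_{\mathsf{Pair}}p:\varphi:=\forall p:(\mathsf{Pair}(p)\to\varphi)$, $\iota_{\mathsf{Set}}x:\varphi := \iota x:(\mathsf{Set}(x)\wedge\varphi)$; $X\subseteq Y := \mathsf{Set}(X)\wedge\mathsf{Set}(Y)\wedge\forall c\in X: c\in Y$; $\emptyset := (\iota_{\mathsf{Set}}x:\forall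 a: a\notin x)$. Axioms of ZFP: all instances, for every formula $\varphi$ with free variables among $a,b,c_1,c_2$, of: (S1) $\forall_{\mathsf{Set}}x,y:(\forall a: a\in x\leftrightarrow a\in y)\to x=y$; (S2) $\forall_{\mathsf{Set}}x:\exists y:\forall a:(a\in y\leftrightarrow \exists z\in x: a\in z)$; (S3) $\forall_{\mathsf{Set}}x:\exists y:\forall z:(z\in y\leftrightarrow z\subseteq x)$; (S4) $\exists y: (\exists_{\mathsf{Set}} z:(z\in y\wedge \forall b: b\notin z))\wedge(\forall x\in y:\exists s\in y:\forall c:(c\in s\leftrightarrow(c\in x\vee c=x)))$; (S5) $\forall c_1,c_2,x:(\forall a\in x:\exists! b:\varphi)\to(\exists_{\mathsf{Set}}y:\forall b:(b\in y\leftrightarrow\exists a\in x:\varphi))$; (S6) $\forall_{\mathsf{Set}}x: x=\emptyset\vee(\exists a\in x:\neg\exists b\in x:(b\,\pi_1\,a\vee b\,\pi_2\,a\vee b\in a))$; (P1) $\forall_{\mathsf{Pair}}p:\forall a: a\notin p$; (P2) $\forall a,b:\exists p:(a\,\pi_1\,p\wedge b\,\pi_2\,p)$; (P3) $\forall p:((\exists a: a\,\pi_1\,p)\leftrightarrow(\exists b: b\,\pi_2\,p))$; (P4) $\forall_{\mathsf{Pair}}p:(\exists! a: a\,\pi_1\,p)\wedge(\exists! b: b\,\pi_2\,p)$; (P5) $\forall_{\mathsf{Pair}}p,q:(\forall a:((a\,\pi_1\,p\leftrightarrow a\,\pi_1\,q)\wedge(a\,\pi_2\,p\leftrightarrow a\,\pi_2\,q)))\to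 p=q$. (Abbreviations are expanded before translating.) Model in ZF: $\langle a,b\rangle:=\{\{a\},\{a,b\}\}$ (Kuratowski pair), $A\times B$ the set of Kuratowski pairs $\langle c,d\rangle$ with $c\in A,d\in B$, $0=\emptyset$, $1=\{0\}$. For ordinals define by transfinite recursion $W_0=\emptyset$, $W_{\beta+1}=(\{0\}\times\mathcal P(W_\beta))\cup(\{1\}\times(W_\beta\times W_\beta))$, $W_\lambda=\bigcup_{\beta<\lambda}W_\beta$ for limit $\lambda$. $\mathcal H(X)$ is the ZF formula "$X\in W_\alpha$ for some ordinal $\alpha$". Define $a\,\widehat\in\, x := \exists y:(x=\langle 0,y\rangle\wedge a\in y)$; $a\,\widehat\pi_1\,p:=\exists u,v:(p=\langle 1,\langle u,v\rangle\rangle\wedge a=u)$; $a\,\widehat\pi_2\,p:=\exists u,v:(p=\langle 1,\langle u,v\rangle\rangle\wedge a=v)$. Translation: $(X\in Y)^*:=X^*\,\widehat\in\,Y^*$; $(X\,\pi_1\,Y)^*:=X^*\,\widehat\pi_1\,Y^*$; $(X\,\pi_2\,Y)^*:=X^*\,\widehat\pi_2\,Y^*$; $(X=Y)^*:=X^*=Y^*$; $x^*:=x$ for variables; $(\varphi\to\psi)^*:=\varphi^*\to\psi^*$; $(\neg\varphi)^*:=\neg\varphi^*$; $(\forall x:\varphi)^*:=\forall x:(\mathcal H(x)\to\varphi^* )$; $(\iota x:\varphi)^*:=\iota x:(\mathcal H(x)\wedge\varphi^* )$. *)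

theory Defs
  imports Main
begin

section \<open>First-order logic with definite descriptions\<close>

text \<open>
  Syntax over an arbitrary type \<open>'p\<close> of binary predicate symbols, in de Bruijn style:
  \<^term>\<open>V 0\<close> refers to the innermost enclosing binder, and both \<open>Forall\<close> and \<open>Desc\<close> bind.
  \<open>Desc \<phi>\<close> is the definite description ``the \<open>x\<close> such that \<open>\<phi>\<close>''.
\<close>

datatype 'p tm = V nat | Desc "'p fm" ("\<^bold>\<iota> _" [35] 35)
  and 'p fm =
    Pred 'p "'p tm" "'p tm"
  | Eq "'p tm" "'p tm" (infix "\<^bold>=" 55)
  | Neg "'p fm" ("\<^bold>\<not> _" [53] 53)
  | Imp "'p fm" "'p fm" (infixr "\<^bold>\<longrightarrow>" 40)
  | Forall "'p fm" ("\<^bold>\<forall> _" [35] 35)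

definition Conj :: "'p fm \<Rightarrow> 'p fm \<Rightarrow> 'p fm" (infixr "\<^bold>\<and>" 50) where
  "(\<phi> \<^bold>\<and> \<psi>) = \<^bold>\<not> (\<phi> \<^bold>\<longrightarrow> \<^bold>\<not> \<psi>)"

definition Disj :: "'p fm \<Rightarrow> 'p fm \<Rightarrow> 'p fm" (infixr "\<^bold>\<or>" 45) where
  "(\<phi> \<^bold>\<or> \<psi>) = (\<^bold>\<not> \<phi> \<^bold>\<longrightarrow> \<psi>)"

definition Iff :: "'p fm \<Rightarrow> 'p fm \<Rightarrow> 'p fm" (infix "\<^bold>\<longleftrightarrow>" 38) where
  "(\<phi> \<^bold>\<longleftrightarrow> \<psi>) = ((\<phi> \<^bold>\<longrightarrow> \<psi>) \<^bold>\<and> (\<psi> \<^bold>\<longrightarrow> \<phi>))"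

definition Exists :: "'p fm \<Rightarrow> 'p fm" ("\<^bold>\<exists> _" [35] 35) where
  "(\<^bold>\<exists> \<phi>) = (\<^bold>\<not> (\<^bold>\<forall> (\<^bold>\<not> \<phi>)))"

primrec fv_tm :: "'p tm \<Rightarrow> nat set" and fv_fm :: "'p fm \<Rightarrow> nat set" where
  "fv_tm (V n) = {n}"
| "fv_tm (Desc \<phi>) = {n. Suc n \<in> fv_fm \<phi>}"
| "fv_fm (Pred p s t) = fv_tm s \<union> fv_tm t"
| "fv_fm (Eq s t) = fv_tm s \<union> fv_tm t"
| "fv_fm (Neg \<phi>) = fv_fm \<phi>"
| "fv_fm (Imp \<phi> \<psi>) = fv_fm \<phi> \<union> fv_fm \<psi>"
| "fv_fm (Forall \<phi>) = {n. Suc n \<in> fv_fm \<phi>}"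

primrec ren_tm :: "(nat \<Rightarrow> nat) \<Rightarrow> 'p tm \<Rightarrow> 'p tm"
  and ren_fm :: "(nat \<Rightarrow> nat) \<Rightarrow> 'p fm \<Rightarrow> 'p fm" where
  "ren_tm r (V n) = V (r n)"
| "ren_tm r (Desc \<phi>) = Desc (ren_fm (case_nat 0 (\<lambda>n. Suc (r n))) \<phi>)"
| "ren_fm r (Pred p s t) = Pred p (ren_tm r s) (ren_tm r t)"
| "ren_fm r (Eq s t) = Eq (ren_tm r s) (ren_tm r t)"
| "ren_fm r (Neg \<phi>) = Neg (ren_fm r \<phi>)"
| "ren_fm r (Imp \<phi> \<psi>) = Imp (ren_fm r \<phi>) (ren_fm r \<psi>)"
| "ren_fm r (Forall \<phi>) = Forall (ren_fm (case_nat 0 (\<lambda>n. Suc (r n))) \<phi>)"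

text \<open>\<open>t \<up> k\<close> is the term \<open>t\<close> moved below \<open>k\<close> additional binders.\<close>

abbreviation lift_tm :: "'p tm \<Rightarrow> nat \<Rightarrow> 'p tm" (infixl "\<up>" 80) where
  "t \<up> k \<equiv> ren_tm (\<lambda>n. n + k) t"

primrec subst_tm :: "(nat \<Rightarrow> 'p tm) \<Rightarrow> 'p tm \<Rightarrow> 'p tm"
  and subst_fm :: "(nat \<Rightarrow> 'p tm) \<Rightarrow> 'p fm \<Rightarrow> 'p fm" where
  "subst_tm \<sigma> (V n) = \<sigma> n"
| "subst_tm \<sigma> (Desc \<phi>) = Desc (subst_fm (case_nat (V 0) (\<lambda>n. \<sigma> n \<up> 1)) \<phi>)"
| "subst_fm \<sigma> (Pred p s t) = Pred p (subst_tm \<sigma> s) (subst_tm \<sigma> t)"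
| "subst_fm \<sigma> (Eq s t) = Eq (subst_tm \<sigma> s) (subst_tm \<sigma> t)"
| "subst_fm \<sigma> (Neg \<phi>) = Neg (subst_fm \<sigma> \<phi>)"
| "subst_fm \<sigma> (Imp \<phi> \<psi>) = Imp (subst_fm \<sigma> \<phi>) (subst_fm \<sigma> \<psi>)"
| "subst_fm \<sigma> (Forall \<phi>) = Forall (subst_fm (case_nat (V 0) (\<lambda>n. \<sigma> n \<up> 1)) \<phi>)"

text \<open>Substitution of \<open>t\<close> for the variable \<^term>\<open>V 0\<close>, whose binder is removed.\<close>

abbreviation inst :: "'p fm \<Rightarrow> 'p tm \<Rightarrow> 'p fm" where
  "inst \<phi> t \<equiv> subst_fm (case_nat t V) \<phi>"

text \<open>
  \<open>place [t\<^sub>0, \<dots>, t\<^sub>m] d \<phi>\<close> is \<open>\<phi>(t\<^sub>0, \<dots>, t\<^sub>m)\<close>, used at a position below \<open>d\<close> binders; the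
  variables of \<open>\<phi>\<close> beyond the first \<open>m + 1\<close> are parameters bound outside these \<open>d\<close> binders.
\<close>

definition place :: "'p tm list \<Rightarrow> nat \<Rightarrow> 'p fm \<Rightarrow> 'p fm" where
  "place ts d = subst_fm (\<lambda>n. if n < length ts then ts ! n else V (n - length ts + d))"

definition Exists1 :: "'p fm \<Rightarrow> 'p fm" ("\<^bold>\<exists>\<^bold>! _" [35] 35) where
  "(\<^bold>\<exists>\<^bold>! \<phi>) = (\<^bold>\<exists> \<^bold>\<forall> (place [V 0] 2 \<phi> \<^bold>\<longleftrightarrow> V 0 \<^bold>= V 1))"

text \<open>
  Classical natural deduction. Variables always denote, whereas a description may fail to denote
  (value \<open>\<bottom>\<close> outside the domain, making every atomic formula containing it as an argument false).
  Hence ``\<open>t\<close> denotes'' is expressed by \<open>t \<^bold>= t\<close>, universal instantiation is restricted to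
  denoting terms, true atomic formulas have denoting arguments, and
  rule \<open>desc\<close> states \<open>y = (\<iota>x. \<phi>) \<longleftrightarrow> (\<forall>x. \<phi> \<longleftrightarrow> x = y)\<close> for every \<open>y\<close> in the domain.
\<close>

inductive derives :: "'p fm set \<Rightarrow> 'p fm \<Rightarrow> bool" (infix "\<turnstile>" 30) where
  assm: "\<phi> \<in> \<Gamma> \<Longrightarrow> \<Gamma> \<turnstile> \<phi>"
| impI: "insert \<phi> \<Gamma> \<turnstile> \<psi> \<Longrightarrow> \<Gamma> \<turnstile> \<phi> \<^bold>\<longrightarrow> \<psi>"
| impE: "\<Gamma> \<turnstile> \<phi> \<^bold>\<longrightarrow> \<psi> \<Longrightarrow> \<Gamma> \<turnstile> \<phi> \<Longrightarrow> \<Gamma> \<turnstile> \<psi>"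
| negI: "insert \<phi> \<Gamma> \<turnstile> \<psi> \<Longrightarrow> insert \<phi> \<Gamma> \<turnstile> \<^bold>\<not> \<psi> \<Longrightarrow> \<Gamma> \<turnstile> \<^bold>\<not> \<phi>"
| raa: "insert (\<^bold>\<not> \<phi>) \<Gamma> \<turnstile> \<psi> \<Longrightarrow> insert (\<^bold>\<not> \<phi>) \<Gamma> \<turnstile> \<^bold>\<not> \<psi> \<Longrightarrow> \<Gamma> \<turnstile> \<phi>"
| allI: "ren_fm Suc ` \<Gamma> \<turnstile> \<phi> \<Longrightarrow> \<Gamma> \<turnstile> \<^bold>\<forall> \<phi>"
| allE: "\<Gamma> \<turnstile> \<^bold>\<forall> \<phi> \<Longrightarrow> \<Gamma> \<turnstile> t \<^bold>= t \<Longrightarrow> \<Gamma> \<turnstile> inst \<phi> t"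
| var_denotes: "\<Gamma> \<turnstile> V n \<^bold>= V n"
| eq_subst: "\<Gamma> \<turnstile> s \<^bold>= t \<Longrightarrow> \<Gamma> \<turnstile> inst \<phi> s \<Longrightarrow> \<Gamma> \<turnstile> inst \<phi> t"
| eq_strict1: "\<Gamma> \<turnstile> s \<^bold>= t \<Longrightarrow> \<Gamma> \<turnstile> s \<^bold>= s"
| eq_strict2: "\<Gamma> \<turnstile> s \<^bold>= t \<Longrightarrow> \<Gamma> \<turnstile> t \<^bold>= t"
| pred_strict1: "\<Gamma> \<turnstile> Pred p s t \<Longrightarrow> \<Gamma> \<turnstile> s \<^bold>= s"
| pred_strict2: "\<Gamma> \<turnstile> Pred p s t \<Longrightarrow> \<Gamma> \<turnstile> t \<^bold>= t"
| desc: "\<Gamma> \<turnstile> V n \<^bold>= (\<^bold>\<iota> \<phi>) \<^bold>\<longleftrightarrow> (\<^bold>\<forall> (\<phi> \<^bold>\<longleftrightarrow> V 0 \<^bold>= V (Suc n)))"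

definition consistent :: "'p fm set \<Rightarrow> bool" where
  "consistent T \<longleftrightarrow> \<not> (\<exists>\<phi>. (T \<turnstile> \<phi>) \<and> (T \<turnstile> \<^bold>\<not> \<phi>))"

text \<open>The universal closures of a formula.\<close>

definition closures :: "'p fm \<Rightarrow> 'p fm set" where
  "closures \<phi> = {(Forall ^^ n) \<phi> | n. fv_fm ((Forall ^^ n) \<phi>) = {}}"


section \<open>Zermelo--Fraenkel set theory\<close>

datatype zf_sym = Mem

abbreviation mem :: "zf_sym tm \<Rightarrow> zf_sym tm \<Rightarrow> zf_sym fm" (infix "\<^bold>\<in>" 55) where
  "s \<^bold>\<in> t \<equiv> Pred Mem s t"

definition ball :: "zf_sym tm \<Rightarrow> zf_sym fm \<Rightarrow> zf_sym fm" where
  "ball t \<phi> = (\<^bold>\<forall> (V 0 \<^bold>\<in> t \<up> 1 \<^bold>\<longrightarrow> \<phi>))"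

definition bex :: "zf_sym tm \<Rightarrow> zf_sym fm \<Rightarrow> zf_sym fm" where
  "bex t \<phi> = (\<^bold>\<exists> (V 0 \<^bold>\<in> t \<up> 1 \<^bold>\<and> \<phi>))"

definition ZF_extensionality :: "zf_sym fm" where
  "ZF_extensionality =
     (\<^bold>\<forall> \<^bold>\<forall> ((\<^bold>\<forall> (V 0 \<^bold>\<in> V 2 \<^bold>\<longleftrightarrow> V 0 \<^bold>\<in> V 1)) \<^bold>\<longrightarrow> V 1 \<^bold>= V 0))"

definition ZF_foundation :: "zf_sym fm" where
  "ZF_foundation =
     (\<^bold>\<forall> ((\<^bold>\<exists> (V 0 \<^bold>\<in> V 1)) \<^bold>\<longrightarrow> bex (V 0) (\<^bold>\<not> bex (V 1) (V 0 \<^bold>\<in> V 1))))"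

definition ZF_pairing :: "zf_sym fm" where
  "ZF_pairing =
     (\<^bold>\<forall> \<^bold>\<forall> \<^bold>\<exists> \<^bold>\<forall> (V 0 \<^bold>\<in> V 1 \<^bold>\<longleftrightarrow> V 0 \<^bold>= V 3 \<^bold>\<or> V 0 \<^bold>= V 2))"

definition ZF_union :: "zf_sym fm" where
  "ZF_union = (\<^bold>\<forall> \<^bold>\<exists> \<^bold>\<forall> (V 0 \<^bold>\<in> V 1 \<^bold>\<longleftrightarrow> bex (V 2) (V 1 \<^bold>\<in> V 0)))"

definition ZF_power :: "zf_sym fm" where
  "ZF_power = (\<^bold>\<forall> \<^bold>\<exists> \<^bold>\<forall> (V 0 \<^bold>\<in> V 1 \<^bold>\<longleftrightarrow> ball (V 0) (V 0 \<^bold>\<in> V 3)))"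

definition ZF_infinity :: "zf_sym fm" where
  "ZF_infinity =
     (\<^bold>\<exists> (bex (V 0) (\<^bold>\<forall> (\<^bold>\<not> V 0 \<^bold>\<in> V 1)) \<^bold>\<and>
         ball (V 0) (bex (V 1) (\<^bold>\<forall> (V 0 \<^bold>\<in> V 1 \<^bold>\<longleftrightarrow> V 0 \<^bold>\<in> V 2 \<^bold>\<or> V 0 \<^bold>= V 2)))))"

text \<open>The formula \<open>\<phi>(z, \<dots>)\<close>, with \<open>z\<close> as \<^term>\<open>V 0\<close> and further variables as parameters.\<close>

definition ZF_separation :: "zf_sym fm \<Rightarrow> zf_sym fm" where
  "ZF_separation \<phi> =
     (\<^bold>\<forall> \<^bold>\<exists> \<^bold>\<forall> (V 0 \<^bold>\<in> V 1 \<^bold>\<longleftrightarrow> V 0 \<^bold>\<in> V 2 \<^bold>\<and> place [V 0] 3 \<phi>))"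

text \<open>
  The formula \<open>\<phi>(a, b, \<dots>)\<close>, with \<open>a\<close> as \<^term>\<open>V 0\<close>, \<open>b\<close> as \<^term>\<open>V 1\<close> and further
  variables as parameters.
\<close>

definition ZF_replacement :: "zf_sym fm \<Rightarrow> zf_sym fm" where
  "ZF_replacement \<phi> =
     (\<^bold>\<forall> (ball (V 0) (\<^bold>\<forall> \<^bold>\<forall>
            (place [V 2, V 1] 4 \<phi> \<^bold>\<and> place [V 2, V 0] 4 \<phi> \<^bold>\<longrightarrow> V 1 \<^bold>= V 0))
          \<^bold>\<longrightarrow> (\<^bold>\<exists> \<^bold>\<forall> (V 0 \<^bold>\<in> V 1 \<^bold>\<longleftrightarrow> bex (V 2) (place [V 0, V 1] 4 \<phi>)))))"

definition ZF :: "zf_sym fm set" where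
  "ZF = {ZF_extensionality, ZF_foundation, ZF_pairing, ZF_union, ZF_power, ZF_infinity}
        \<union> (\<Union>\<phi>. closures (ZF_separation \<phi>)) \<union> (\<Union>\<phi>. closures (ZF_replacement \<phi>))"


section \<open>The theory ZFP\<close>

datatype zfp_sym = MemP | Pi1 | Pi2

abbreviation memP :: "zfp_sym tm \<Rightarrow> zfp_sym tm \<Rightarrow> zfp_sym fm" (infix "\<^bold>\<in>\<^sub>P" 55) where
  "s \<^bold>\<in>\<^sub>P t \<equiv> Pred MemP s t"

abbreviation pi1 :: "zfp_sym tm \<Rightarrow> zfp_sym tm \<Rightarrow> zfp_sym fm" (infix "\<^bold>\<pi>\<^sub>1" 55) where
  "s \<^bold>\<pi>\<^sub>1 t \<equiv> Pred Pi1 s t"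

abbreviation pi2 :: "zfp_sym tm \<Rightarrow> zfp_sym tm \<Rightarrow> zfp_sym fm" (infix "\<^bold>\<pi>\<^sub>2" 55) where
  "s \<^bold>\<pi>\<^sub>2 t \<equiv> Pred Pi2 s t"

definition ballP :: "zfp_sym tm \<Rightarrow> zfp_sym fm \<Rightarrow> zfp_sym fm" where
  "ballP t \<phi> = (\<^bold>\<forall> (V 0 \<^bold>\<in>\<^sub>P t \<up> 1 \<^bold>\<longrightarrow> \<phi>))"

definition bexP :: "zfp_sym tm \<Rightarrow> zfp_sym fm \<Rightarrow> zfp_sym fm" where
  "bexP t \<phi> = (\<^bold>\<exists> (V 0 \<^bold>\<in>\<^sub>P t \<up> 1 \<^bold>\<and> \<phi>))"

definition isPair :: "zfp_sym tm \<Rightarrow> zfp_sym fm" where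
  "isPair t = (\<^bold>\<exists> (V 0 \<^bold>\<pi>\<^sub>1 t \<up> 1))"

definition isSet :: "zfp_sym tm \<Rightarrow> zfp_sym fm" where
  "isSet t = \<^bold>\<not> isPair t"

definition Forall_Set :: "zfp_sym fm \<Rightarrow> zfp_sym fm" ("\<^bold>\<forall>\<^sub>S _" [35] 35) where
  "(\<^bold>\<forall>\<^sub>S \<phi>) = (\<^bold>\<forall> (isSet (V 0) \<^bold>\<longrightarrow> \<phi>))"

definition Exists_Set :: "zfp_sym fm \<Rightarrow> zfp_sym fm" ("\<^bold>\<exists>\<^sub>S _" [35] 35) where
  "(\<^bold>\<exists>\<^sub>S \<phi>) = (\<^bold>\<exists> (isSet (V 0) \<^bold>\<and> \<phi>))"

definition Forall_Pair :: "zfp_sym fm \<Rightarrow> zfp_sym fm" ("\<^bold>\<forall>\<^sub>P _" [35] 35) where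
  "(\<^bold>\<forall>\<^sub>P \<phi>) = (\<^bold>\<forall> (isPair (V 0) \<^bold>\<longrightarrow> \<phi>))"

definition Desc_Set :: "zfp_sym fm \<Rightarrow> zfp_sym tm" ("\<^bold>\<iota>\<^sub>S _" [35] 35) where
  "(\<^bold>\<iota>\<^sub>S \<phi>) = (\<^bold>\<iota> (isSet (V 0) \<^bold>\<and> \<phi>))"

definition subsetP :: "zfp_sym tm \<Rightarrow> zfp_sym tm \<Rightarrow> zfp_sym fm" (infix "\<^bold>\<subseteq>\<^sub>P" 55) where
  "s \<^bold>\<subseteq>\<^sub>P t = (isSet s \<^bold>\<and> isSet t \<^bold>\<and> ballP s (V 0 \<^bold>\<in>\<^sub>P t \<up> 1))"

definition emptyP :: "zfp_sym tm" where
  "emptyP = (\<^bold>\<iota>\<^sub>S \<^bold>\<forall> (\<^bold>\<not> V 0 \<^bold>\<in>\<^sub>P V 1))"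

definition ZFP_S1 :: "zfp_sym fm" where
  "ZFP_S1 = (\<^bold>\<forall>\<^sub>S \<^bold>\<forall>\<^sub>S ((\<^bold>\<forall> (V 0 \<^bold>\<in>\<^sub>P V 2 \<^bold>\<longleftrightarrow> V 0 \<^bold>\<in>\<^sub>P V 1)) \<^bold>\<longrightarrow> V 1 \<^bold>= V 0))"

definition ZFP_S2 :: "zfp_sym fm" where
  "ZFP_S2 = (\<^bold>\<forall>\<^sub>S \<^bold>\<exists> \<^bold>\<forall> (V 0 \<^bold>\<in>\<^sub>P V 1 \<^bold>\<longleftrightarrow> bexP (V 2) (V 1 \<^bold>\<in>\<^sub>P V 0)))"

definition ZFP_S3 :: "zfp_sym fm" where
  "ZFP_S3 = (\<^bold>\<forall>\<^sub>S \<^bold>\<exists> \<^bold>\<forall> (V 0 \<^bold>\<in>\<^sub>P V 1 \<^bold>\<longleftrightarrow> V 0 \<^bold>\<subseteq>\<^sub>P V 2))"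

definition ZFP_S4 :: "zfp_sym fm" where
  "ZFP_S4 =
     (\<^bold>\<exists> ((\<^bold>\<exists>\<^sub>S (V 0 \<^bold>\<in>\<^sub>P V 1 \<^bold>\<and> (\<^bold>\<forall> (\<^bold>\<not> V 0 \<^bold>\<in>\<^sub>P V 1)))) \<^bold>\<and>
         ballP (V 0) (bexP (V 1) (\<^bold>\<forall> (V 0 \<^bold>\<in>\<^sub>P V 1 \<^bold>\<longleftrightarrow> V 0 \<^bold>\<in>\<^sub>P V 2 \<^bold>\<or> V 0 \<^bold>= V 2)))))"

text \<open>
  In the schema below, the formula \<open>\<phi>(a, b, c\<^sub>1, c\<^sub>2)\<close> has the variables \<open>a\<close>, \<open>b\<close>,
  \<open>c\<^sub>1\<close>, \<open>c\<^sub>2\<close> as \<open>V 0\<close>, \<open>V 1\<close>, \<open>V 2\<close>, \<open>V 3\<close>.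
\<close>

definition ZFP_S5 :: "zfp_sym fm \<Rightarrow> zfp_sym fm" where
  "ZFP_S5 \<phi> =
     (\<^bold>\<forall> \<^bold>\<forall> \<^bold>\<forall>
        (ballP (V 0) (\<^bold>\<exists>\<^bold>! place [V 1, V 0, V 4, V 3] 5 \<phi>)
         \<^bold>\<longrightarrow> (\<^bold>\<exists>\<^sub>S \<^bold>\<forall> (V 0 \<^bold>\<in>\<^sub>P V 1 \<^bold>\<longleftrightarrow> bexP (V 2) (place [V 0, V 1, V 5, V 4] 6 \<phi>)))))"

definition ZFP_S6 :: "zfp_sym fm" where
  "ZFP_S6 =
     (\<^bold>\<forall>\<^sub>S (V 0 \<^bold>= emptyP \<^bold>\<or>
          bexP (V 0) (\<^bold>\<not> bexP (V 1) (V 0 \<^bold>\<pi>\<^sub>1 V 1 \<^bold>\<or> V 0 \<^bold>\<pi>\<^sub>2 V 1 \<^bold>\<or> V 0 \<^bold>\<in>\<^sub>P V 1))))"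

definition ZFP_P1 :: "zfp_sym fm" where
  "ZFP_P1 = (\<^bold>\<forall>\<^sub>P \<^bold>\<forall> (\<^bold>\<not> V 0 \<^bold>\<in>\<^sub>P V 1))"

definition ZFP_P2 :: "zfp_sym fm" where
  "ZFP_P2 = (\<^bold>\<forall> \<^bold>\<forall> \<^bold>\<exists> (V 2 \<^bold>\<pi>\<^sub>1 V 0 \<^bold>\<and> V 1 \<^bold>\<pi>\<^sub>2 V 0))"

definition ZFP_P3 :: "zfp_sym fm" where
  "ZFP_P3 = (\<^bold>\<forall> ((\<^bold>\<exists> (V 0 \<^bold>\<pi>\<^sub>1 V 1)) \<^bold>\<longleftrightarrow> (\<^bold>\<exists> (V 0 \<^bold>\<pi>\<^sub>2 V 1))))"

definition ZFP_P4 :: "zfp_sym fm" where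
  "ZFP_P4 = (\<^bold>\<forall>\<^sub>P ((\<^bold>\<exists>\<^bold>! (V 0 \<^bold>\<pi>\<^sub>1 V 1)) \<^bold>\<and> (\<^bold>\<exists>\<^bold>! (V 0 \<^bold>\<pi>\<^sub>2 V 1))))"

definition ZFP_P5 :: "zfp_sym fm" where
  "ZFP_P5 =
     (\<^bold>\<forall>\<^sub>P \<^bold>\<forall>\<^sub>P
        ((\<^bold>\<forall> ((V 0 \<^bold>\<pi>\<^sub>1 V 2 \<^bold>\<longleftrightarrow> V 0 \<^bold>\<pi>\<^sub>1 V 1) \<^bold>\<and> (V 0 \<^bold>\<pi>\<^sub>2 V 2 \<^bold>\<longleftrightarrow> V 0 \<^bold>\<pi>\<^sub>2 V 1)))
         \<^bold>\<longrightarrow> V 1 \<^bold>= V 0))"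

definition ZFP :: "zfp_sym fm set" where
  "ZFP = {ZFP_S1, ZFP_S2, ZFP_S3, ZFP_S4, ZFP_S6, ZFP_P1, ZFP_P2, ZFP_P3, ZFP_P4, ZFP_P5}
         \<union> {ZFP_S5 \<phi> | \<phi>. fv_fm \<phi> \<subseteq> {0, 1, 2, 3}}"


section \<open>Sets, ordinals and the hierarchy \<open>W\<^sub>\<alpha>\<close> in the language of ZF\<close>

text \<open>
  Set-theoretic operations are ZF terms, given by descriptions that denote by the axioms of ZF
  whenever the arguments denote (for \<open>zapp f x\<close>: when \<open>f\<close> has exactly one value at \<open>x\<close>).
\<close>

definition zempty :: "zf_sym tm" where
  "zempty = (\<^bold>\<iota> \<^bold>\<forall> (\<^bold>\<not> V 0 \<^bold>\<in> V 1))"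

definition zupair :: "zf_sym tm \<Rightarrow> zf_sym tm \<Rightarrow> zf_sym tm" where
  "zupair a b = (\<^bold>\<iota> \<^bold>\<forall> (V 0 \<^bold>\<in> V 1 \<^bold>\<longleftrightarrow> V 0 \<^bold>= a \<up> 2 \<^bold>\<or> V 0 \<^bold>= b \<up> 2))"

definition zsing :: "zf_sym tm \<Rightarrow> zf_sym tm" where
  "zsing a = zupair a a"

definition zpair :: "zf_sym tm \<Rightarrow> zf_sym tm \<Rightarrow> zf_sym tm" where
  "zpair a b = zupair (zsing a) (zupair a b)"

definition zone :: "zf_sym tm" where
  "zone = zsing zempty"

definition zun :: "zf_sym tm \<Rightarrow> zf_sym tm \<Rightarrow> zf_sym tm" where
  "zun a b = (\<^bold>\<iota> \<^bold>\<forall> (V 0 \<^bold>\<in> V 1 \<^bold>\<longleftrightarrow> V 0 \<^bold>\<in> a \<up> 2 \<^bold>\<or> V 0 \<^bold>\<in> b \<up> 2))"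

definition zsucc :: "zf_sym tm \<Rightarrow> zf_sym tm" where
  "zsucc a = zun a (zsing a)"

definition zsubset :: "zf_sym tm \<Rightarrow> zf_sym tm \<Rightarrow> zf_sym fm" (infix "\<^bold>\<subseteq>" 55) where
  "a \<^bold>\<subseteq> b = ball a (V 0 \<^bold>\<in> b \<up> 1)"

definition zpow :: "zf_sym tm \<Rightarrow> zf_sym tm" where
  "zpow a = (\<^bold>\<iota> \<^bold>\<forall> (V 0 \<^bold>\<in> V 1 \<^bold>\<longleftrightarrow> V 0 \<^bold>\<subseteq> a \<up> 2))"

definition ztimes :: "zf_sym tm \<Rightarrow> zf_sym tm \<Rightarrow> zf_sym tm" where
  "ztimes a b =
     (\<^bold>\<iota> \<^bold>\<forall> (V 0 \<^bold>\<in> V 1 \<^bold>\<longleftrightarrow> bex (a \<up> 2) (bex (b \<up> 3) (V 2 \<^bold>= zpair (V 1) (V 0)))))"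

definition zapp :: "zf_sym tm \<Rightarrow> zf_sym tm \<Rightarrow> zf_sym tm" where
  "zapp f x = (\<^bold>\<iota> (zpair (x \<up> 1) (V 0) \<^bold>\<in> f \<up> 1))"

text \<open>\<open>f\<close> is a function with domain \<open>d\<close>.\<close>

definition zfunction :: "zf_sym tm \<Rightarrow> zf_sym tm \<Rightarrow> zf_sym fm" where
  "zfunction f d =
     (ball f (bex (d \<up> 1) (\<^bold>\<exists> (V 2 \<^bold>= zpair (V 1) (V 0)))) \<^bold>\<and>
      ball d (\<^bold>\<exists>\<^bold>! (zpair (V 1) (V 0) \<^bold>\<in> f \<up> 2)))"

text \<open>\<open>a\<close> is a transitive set strictly well-ordered by membership.\<close>

definition zord :: "zf_sym tm \<Rightarrow> zf_sym fm" where
  "zord a =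
     (ball a (V 0 \<^bold>\<subseteq> a \<up> 1) \<^bold>\<and>
      ball a (\<^bold>\<not> V 0 \<^bold>\<in> V 0) \<^bold>\<and>
      ball a (ball (a \<up> 1) (ball (a \<up> 2) (V 2 \<^bold>\<in> V 1 \<^bold>\<and> V 1 \<^bold>\<in> V 0 \<^bold>\<longrightarrow> V 2 \<^bold>\<in> V 0))) \<^bold>\<and>
      ball a (ball (a \<up> 1) (V 1 \<^bold>\<in> V 0 \<^bold>\<or> V 1 \<^bold>= V 0 \<^bold>\<or> V 0 \<^bold>\<in> V 1)) \<^bold>\<and>
      (\<^bold>\<forall> (V 0 \<^bold>\<subseteq> a \<up> 1 \<^bold>\<and> (\<^bold>\<exists> (V 0 \<^bold>\<in> V 1)) \<^bold>\<longrightarrow>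
           bex (V 0) (ball (V 1) (V 1 \<^bold>= V 0 \<^bold>\<or> V 1 \<^bold>\<in> V 0)))))"

definition zlimit :: "zf_sym tm \<Rightarrow> zf_sym fm" where
  "zlimit a = (zord a \<^bold>\<and> \<^bold>\<not> a \<^bold>= zempty \<^bold>\<and> \<^bold>\<not> (\<^bold>\<exists> (a \<up> 1 \<^bold>= zsucc (V 0))))"

text \<open>\<open>({0} \<times> \<P>(w)) \<union> ({1} \<times> (w \<times> w))\<close>\<close>

definition zstep :: "zf_sym tm \<Rightarrow> zf_sym tm" where
  "zstep w = zun (ztimes (zsing zempty) (zpow w)) (ztimes (zsing zone) (ztimes w w))"

text \<open>\<open>\<Union>\<^bsub>\<beta> \<in> a\<^esub> f(\<beta>)\<close>\<close>

definition zUnion_app :: "zf_sym tm \<Rightarrow> zf_sym tm \<Rightarrow> zf_sym tm" where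
  "zUnion_app a f = (\<^bold>\<iota> \<^bold>\<forall> (V 0 \<^bold>\<in> V 1 \<^bold>\<longleftrightarrow> bex (a \<up> 2) (V 1 \<^bold>\<in> zapp (f \<up> 3) (V 0))))"

text \<open>
  \<open>f\<close> is a function on \<open>a + 1\<close> satisfying the recursion equations
  \<open>f(0) = 0\<close>, \<open>f(\<gamma> + 1) = zstep (f(\<gamma>))\<close> and \<open>f(\<beta>) = \<Union>\<^bsub>\<gamma> < \<beta>\<^esub> f(\<gamma>)\<close> for limit \<open>\<beta>\<close>;
  then \<open>W\<^sub>a\<close> is the value at \<open>a\<close> of such a function.
\<close>

definition zrec :: "zf_sym tm \<Rightarrow> zf_sym tm \<Rightarrow> zf_sym fm" where
  "zrec f a =
     (zfunction f (zsucc a) \<^bold>\<and>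
      ball (zsucc a)
        ((V 0 \<^bold>= zempty \<^bold>\<longrightarrow> zapp (f \<up> 1) (V 0) \<^bold>= zempty) \<^bold>\<and>
         (\<^bold>\<forall> (V 1 \<^bold>= zsucc (V 0) \<^bold>\<longrightarrow> zapp (f \<up> 2) (V 1) \<^bold>= zstep (zapp (f \<up> 2) (V 0)))) \<^bold>\<and>
         (zlimit (V 0) \<^bold>\<longrightarrow> zapp (f \<up> 1) (V 0) \<^bold>= zUnion_app (V 0) (f \<up> 1))))"

definition zW :: "zf_sym tm \<Rightarrow> zf_sym tm" where
  "zW a = (\<^bold>\<iota> \<^bold>\<exists> (zrec (V 0) (a \<up> 2) \<^bold>\<and> V 1 \<^bold>= zapp (V 0) (a \<up> 2)))"

definition zH :: "zf_sym tm \<Rightarrow> zf_sym fm" where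
  "zH x = (\<^bold>\<exists> (zord (V 0) \<^bold>\<and> x \<up> 1 \<^bold>\<in> zW (V 0)))"


section \<open>The translation\<close>

definition hat_mem :: "zf_sym tm \<Rightarrow> zf_sym tm \<Rightarrow> zf_sym fm" where
  "hat_mem a x = (\<^bold>\<exists> (x \<up> 1 \<^bold>= zpair zempty (V 0) \<^bold>\<and> a \<up> 1 \<^bold>\<in> V 0))"

definition hat_pi1 :: "zf_sym tm \<Rightarrow> zf_sym tm \<Rightarrow> zf_sym fm" where
  "hat_pi1 a p = (\<^bold>\<exists> \<^bold>\<exists> (p \<up> 2 \<^bold>= zpair zone (zpair (V 1) (V 0)) \<^bold>\<and> a \<up> 2 \<^bold>= V 1))"

definition hat_pi2 :: "zf_sym tm \<Rightarrow> zf_sym tm \<Rightarrow> zf_sym fm" where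
  "hat_pi2 a p = (\<^bold>\<exists> \<^bold>\<exists> (p \<up> 2 \<^bold>= zpair zone (zpair (V 1) (V 0)) \<^bold>\<and> a \<up> 2 \<^bold>= V 0))"

primrec hat :: "zfp_sym \<Rightarrow> zf_sym tm \<Rightarrow> zf_sym tm \<Rightarrow> zf_sym fm" where
  "hat MemP = hat_mem"
| "hat Pi1 = hat_pi1"
| "hat Pi2 = hat_pi2"

primrec trans_tm :: "zfp_sym tm \<Rightarrow> zf_sym tm" and trans_fm :: "zfp_sym fm \<Rightarrow> zf_sym fm" where
  "trans_tm (V n) = V n"
| "trans_tm (Desc \<phi>) = (\<^bold>\<iota> (zH (V 0) \<^bold>\<and> trans_fm \<phi>))"
| "trans_fm (Pred R s t) = hat R (trans_tm s) (trans_tm t)"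
| "trans_fm (Eq s t) = (trans_tm s \<^bold>= trans_tm t)"
| "trans_fm (Neg \<phi>) = \<^bold>\<not> trans_fm \<phi>"
| "trans_fm (Imp \<phi> \<psi>) = (trans_fm \<phi> \<^bold>\<longrightarrow> trans_fm \<psi>)"
| "trans_fm (Forall \<phi>) = (\<^bold>\<forall> (zH (V 0) \<^bold>\<longrightarrow> trans_fm \<phi>))"

end

theory Submission
  imports Defs "HOL-Library.Countable" "HOL-Library.Infinite_Set"
begin

text \<open>
  Derivability in ZF is reduced to truth in all models of ZF by a Henkin completeness theorem for
  the calculus with descriptions. Inside an arbitrary model of ZF the recursion defining
  \<open>W\<^sub>\<alpha>\<close> is solved, and from \<open>x \<in> W\<^sub>\<alpha> \<longleftrightarrow> (\<exists>\<beta> < \<alpha>. x \<in> step W\<^sub>\<beta>)\<close>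
  one reads off the closure properties of the class \<open>H\<close>: \<open>\<langle>0, y\<rangle>\<close> is in \<open>H\<close> iff \<open>y \<subseteq> H\<close>, and
  \<open>\<langle>1, \<langle>u, v\<rangle>\<rangle>\<close> is in \<open>H\<close> iff \<open>u\<close> and \<open>v\<close> are, while every element of \<open>H\<close> has one of these two forms. Hence
  \<open>H\<close> with the hatted relations is a structure satisfying ZFP, and the translation expresses truth
  in it. For the consistency claim, soundness is applied to this structure.
\<close>

section \<open>Renaming and substitution\<close>

text \<open>Writing out derivations in the calculus would be unwieldy; passing to all models turns
  them into ordinary reasoning about a relation \<open>I Mem\<close>. The price is that the model is
  arbitrary: its membership need not be well-founded seen from outside, and its schemes speak only
  of predicates given by formulas. Every induction on ordinals and every use of separation or
  replacement must therefore exhibit a formula and compute its truth value, and for this the ZF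
  terms get rules that yield their values. Descriptions sharpen the obstacle. A term such as
  \<open>zapp f x\<close> or \<open>zW a\<close> has a value only when existence and uniqueness
  hold, and an atomic formula containing a term without value is false. So the recursion must be
  solved at \<open>a\<close> before \<open>zW\<close> can be evaluated there. Among the closure
  properties, the one with real content is that a set of elements of \<open>H\<close> lies in a
  single stage; replacement, applied to least stages, provides it.\<close>

lemma case_nat_comp:
  "(\<lambda>n. case_nat x f (case_nat y g n)) = case_nat (case_nat x f y) (\<lambda>n. case_nat x f (g n))"
  "(\<lambda>n. ren_tm r (case_nat t \<sigma> n)) = case_nat (ren_tm r t) (\<lambda>n. ren_tm r (\<sigma> n))"
  "(\<lambda>n. V (case_nat y g n)) = case_nat (V y) (\<lambda>n. V (g n))"
  "(\<lambda>n. h (case_nat y g n)) = case_nat (h y) (\<lambda>n. h (g n))"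
  by (auto simp: fun_eq_iff split: nat.split)

lemma case_nat_id: "case_nat 0 Suc = (\<lambda>n. n)"
  by (auto simp: fun_eq_iff split: nat.split)

lemma ren_id:
  fixes t :: "'p tm" and \<phi> :: "'p fm"
  shows
    "ren_tm (\<lambda>n. n) t = t" "ren_fm (\<lambda>n. n) \<phi> = \<phi>"
  by (induction t and \<phi>) (simp_all add: case_nat_id)

lemma ren_ren:
  fixes t :: "'p tm" and \<phi> :: "'p fm"
  shows
    "ren_tm r (ren_tm s t) = ren_tm (\<lambda>n. r (s n)) t"
  "ren_fm r (ren_fm s \<phi>) = ren_fm (\<lambda>n. r (s n)) \<phi>"
  by (induction t and \<phi> arbitrary: r s and r s) (simp_all add: case_nat_comp)

lemma subst_ren:
  fixes t :: "'p tm" and \<phi> :: "'p fm"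
  shows
    "subst_tm \<sigma> (ren_tm r t) = subst_tm (\<lambda>n. \<sigma> (r n)) t"
  "subst_fm \<sigma> (ren_fm r \<phi>) = subst_fm (\<lambda>n. \<sigma> (r n)) \<phi>"
  by (induction t and \<phi> arbitrary: \<sigma> r and \<sigma> r) (simp_all add: case_nat_comp)

lemma ren_subst:
  fixes t :: "'p tm" and \<phi> :: "'p fm"
  shows
    "ren_tm r (subst_tm \<sigma> t) = subst_tm (\<lambda>n. ren_tm r (\<sigma> n)) t"
  "ren_fm r (subst_fm \<sigma> \<phi>) = subst_fm (\<lambda>n. ren_tm r (\<sigma> n)) \<phi>"
  by (induction t and \<phi> arbitrary: \<sigma> r and \<sigma> r) (simp_all add: case_nat_comp ren_ren)

lemma subst_V:
  fixes t :: "'p tm" and \<phi> :: "'p fm"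
  shows
    "subst_tm (\<lambda>n. V (r n)) t = ren_tm r t" "subst_fm (\<lambda>n. V (r n)) \<phi> = ren_fm r \<phi>"
proof (induction t and \<phi> arbitrary: r and r)
  case (Desc \<phi>)
  show ?case using Desc[of "case_nat 0 (\<lambda>n. Suc (r n))"] by (simp add: case_nat_comp)
next
  case (Forall \<phi>)
  show ?case using Forall[of "case_nat 0 (\<lambda>n. Suc (r n))"] by (simp add: case_nat_comp)
qed simp_all

lemma inst_V: "inst \<phi> (V k) = ren_fm (case_nat k (\<lambda>n. n)) \<phi>"
  unfolding subst_V[symmetric] by (simp add: case_nat_comp)

lemma inst_ren: "inst (ren_fm (case_nat 0 (\<lambda>n. Suc (r n))) \<phi>) (V k) = ren_fm (case_nat k r) \<phi>"
  by (simp add: inst_V ren_ren case_nat_comp)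

lemma ren_inst:
  "ren_fm r (inst \<phi> t) = inst (ren_fm (case_nat 0 (\<lambda>n. Suc (r n))) \<phi>) (ren_tm r t)"
  by (simp add: ren_subst subst_ren case_nat_comp)

lemma ren_cong:
  fixes t :: "'p tm" and \<phi> :: "'p fm"
  shows
    "(\<And>n. n \<in> fv_tm t \<Longrightarrow> r n = r' n) \<Longrightarrow> ren_tm r t = ren_tm r' t"
    "(\<And>n. n \<in> fv_fm \<phi> \<Longrightarrow> r n = r' n) \<Longrightarrow> ren_fm r \<phi> = ren_fm r' \<phi>"
proof (induction t and \<phi> arbitrary: r r' and r r')
  case (Desc \<phi>)
  have "ren_fm (case_nat 0 (\<lambda>n. Suc (r n))) \<phi> = ren_fm (case_nat 0 (\<lambda>n. Suc (r' n))) \<phi>"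
    by (rule Desc) (use Desc.prems in \<open>auto split: nat.split\<close>)
  then show ?case by simp
next
  case (Forall \<phi>)
  have "ren_fm (case_nat 0 (\<lambda>n. Suc (r n))) \<phi> = ren_fm (case_nat 0 (\<lambda>n. Suc (r' n))) \<phi>"
    by (rule Forall) (use Forall.prems in \<open>auto split: nat.split\<close>)
  then show ?case by simp
next
  case (Pred p s t)
  show ?case using Pred.prems by (auto intro!: Pred.IH)
next
  case (Eq s t)
  show ?case using Eq.prems by (auto intro!: Eq.IH)
next
  case (Neg \<phi>)
  show ?case using Neg.prems by (auto intro!: Neg.IH)
next
  case (Imp \<phi> \<psi>)
  show ?case using Imp.prems by (auto intro!: Imp.IH)
qed simp

lemma fv_ren:
  fixes t :: "'p tm" and \<phi> :: "'p fm"
  shows "fv_tm (ren_tm r t) = r ` fv_tm t" "fv_fm (ren_fm r \<phi>) = r ` fv_fm \<phi>"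
proof (induction t and \<phi> arbitrary: r and r)
  case (Desc \<phi>)
  have "Suc m = case_nat 0 (\<lambda>n. Suc (r n)) k \<longleftrightarrow> (\<exists>n. k = Suc n \<and> m = r n)" for m k
    by (cases k) auto
  then show ?case by (auto simp: image_iff Desc)
next
  case (Forall \<phi>)
  have "Suc m = case_nat 0 (\<lambda>n. Suc (r n)) k \<longleftrightarrow> (\<exists>n. k = Suc n \<and> m = r n)" for m k
    by (cases k) auto
  then show ?case by (auto simp: image_iff Forall)
qed auto

lemma fv_subst:
  fixes t :: "'p tm" and \<phi> :: "'p fm"
  shows
    "fv_tm (subst_tm \<sigma> t) = (\<Union>n\<in>fv_tm t. fv_tm (\<sigma> n))"
  "fv_fm (subst_fm \<sigma> \<phi>) = (\<Union>n\<in>fv_fm \<phi>. fv_tm (\<sigma> n))"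
proof (induction t and \<phi> arbitrary: \<sigma> and \<sigma>)
  case (Desc \<phi>)
  have *: "Suc m \<in> fv_tm (case_nat (V 0) (\<lambda>n. \<sigma> n \<up> 1) k) \<longleftrightarrow> (\<exists>n. k = Suc n \<and> m \<in> fv_tm (\<sigma> n))" for m k
    by (auto simp: fv_ren split: nat.splits)
  show ?case by (auto simp: Desc * simp del: One_nat_def)
next
  case (Forall \<phi>)
  have *: "Suc m \<in> fv_tm (case_nat (V 0) (\<lambda>n. \<sigma> n \<up> 1) k) \<longleftrightarrow> (\<exists>n. k = Suc n \<and> m \<in> fv_tm (\<sigma> n))" for m k
    by (auto simp: fv_ren split: nat.splits)
  show ?case by (auto simp: Forall * simp del: One_nat_def)
qed auto

lemma finite_fv:
  fixes t :: "'p tm" and \<phi> :: "'p fm"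
  shows
    "finite (fv_tm t)" "finite (fv_fm \<phi>)"
  by (induction t and \<phi>) (auto simp: finite_vimageI[of _ Suc, unfolded vimage_def])


section \<open>Admissible rules\<close>

lemma ren_connectives:
  "ren_fm r (\<phi> \<^bold>\<and> \<psi>) = (ren_fm r \<phi> \<^bold>\<and> ren_fm r \<psi>)"
  "ren_fm r (\<phi> \<^bold>\<longleftrightarrow> \<psi>) = (ren_fm r \<phi> \<^bold>\<longleftrightarrow> ren_fm r \<psi>)"
  by (simp_all add: Conj_def Iff_def)

text \<open>The inclusion in \<open>\<Delta>\<close> makes weakening the special case of the
  identity renaming, so one induction serves for both. The renaming need not be injective. In the
  case of \<open>allI\<close>, the lifted renaming commutes with the shift \<open>Suc\<close> of the
  context.\<close>

lemma derives_ren: "\<Gamma> \<turnstile> \<phi> \<Longrightarrow> ren_fm r ` \<Gamma> \<subseteq> \<Delta> \<Longrightarrow> \<Delta> \<turnstile> ren_fm r \<phi>"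
proof (induction arbitrary: r \<Delta> rule: derives.induct)
  case (impI \<phi> \<Gamma> \<psi>)
  have "insert (ren_fm r \<phi>) \<Delta> \<turnstile> ren_fm r \<psi>" using impI.prems by (intro impI.IH) auto
  then show ?case by (auto intro: derives.impI)
next
  case (impE \<Gamma> \<phi> \<psi>)
  then show ?case by (metis derives.impE ren_fm.simps(4))
next
  case (negI \<phi> \<Gamma> \<psi>)
  have "insert (ren_fm r \<phi>) \<Delta> \<turnstile> ren_fm r \<psi>" "insert (ren_fm r \<phi>) \<Delta> \<turnstile> ren_fm r (\<^bold>\<not> \<psi>)"
    using negI.prems by (intro negI.IH; auto)+
  then show ?case by (auto intro: derives.negI)
next
  case (raa \<phi> \<Gamma> \<psi>)
  have "insert (\<^bold>\<not> ren_fm r \<phi>) \<Delta> \<turnstile> ren_fm r \<psi>" "insert (\<^bold>\<not> ren_fm r \<phi>) \<Delta> \<turnstile> ren_fm r (\<^bold>\<not> \<psi>)"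
    using raa.prems by (intro raa.IH; auto)+
  then show ?case by (auto intro: derives.raa)
next
  case (allI \<Gamma> \<phi>)
  have "ren_fm Suc ` \<Delta> \<turnstile> ren_fm (case_nat 0 (\<lambda>n. Suc (r n))) \<phi>"
  proof (rule allI.IH)
    have "ren_fm (case_nat 0 (\<lambda>n. Suc (r n))) ` ren_fm Suc ` \<Gamma> = ren_fm Suc ` ren_fm r ` \<Gamma>"
      by (simp add: image_image ren_ren)
    then show "ren_fm (case_nat 0 (\<lambda>n. Suc (r n))) ` ren_fm Suc ` \<Gamma> \<subseteq> ren_fm Suc ` \<Delta>"
      using allI.prems by auto
  qed
  then show ?case by (auto intro: derives.allI)
next
  case (allE \<Gamma> \<phi> t)
  then have "\<Delta> \<turnstile> \<^bold>\<forall> ren_fm (case_nat 0 (\<lambda>n. Suc (r n))) \<phi>" "\<Delta> \<turnstile> ren_tm r t \<^bold>= ren_tm r t"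
    by auto
  then show ?case unfolding ren_inst by (rule derives.allE)
next
  case (eq_subst \<Gamma> s t \<phi>)
  then have "\<Delta> \<turnstile> ren_tm r s \<^bold>= ren_tm r t" "\<Delta> \<turnstile> ren_fm r (inst \<phi> s)"
    by auto
  then show ?case unfolding ren_inst by (rule derives.eq_subst)
next
  case (desc \<Gamma> n \<phi>)
  show ?case using derives.desc[of \<Delta> "r n" "ren_fm (case_nat 0 (\<lambda>n. Suc (r n))) \<phi>"]
    by (simp add: ren_connectives)
next
  case (pred_strict1 \<Gamma> p s t)
  then show ?case by (metis derives.pred_strict1 ren_fm.simps(1,2))
next
  case (pred_strict2 \<Gamma> p s t)
  then show ?case by (metis derives.pred_strict2 ren_fm.simps(1,2))
qed (auto intro: derives.intros)

lemma weaken: "\<Gamma> \<turnstile> \<phi> \<Longrightarrow> \<Gamma> \<subseteq> \<Delta> \<Longrightarrow> \<Delta> \<turnstile> \<phi>"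
  using derives_ren[of \<Gamma> \<phi> "\<lambda>n. n" \<Delta>] by (simp add: ren_id)

lemma compact: "\<Gamma> \<turnstile> \<phi> \<Longrightarrow> \<exists>\<Delta>. finite \<Delta> \<and> \<Delta> \<subseteq> \<Gamma> \<and> (\<Delta> \<turnstile> \<phi>)"
proof (induction rule: derives.induct)
  case (assm \<phi> \<Gamma>)
  then show ?case by (intro exI[of _ "{\<phi>}"]) (auto intro: derives.assm)
next
  case (impI \<phi> \<Gamma> \<psi>)
  then obtain \<Delta> where "finite \<Delta>" "\<Delta> \<subseteq> insert \<phi> \<Gamma>" "\<Delta> \<turnstile> \<psi>" by auto
  then show ?case
    by (intro exI[of _ "\<Delta> - {\<phi>}"]) (auto intro!: derives.impI elim: weaken)
next
  case (impE \<Gamma> \<phi> \<psi>)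
  then obtain \<Delta> \<Delta>' where "finite \<Delta>" "\<Delta> \<subseteq> \<Gamma>" "\<Delta> \<turnstile> \<phi> \<^bold>\<longrightarrow> \<psi>" "finite \<Delta>'" "\<Delta>' \<subseteq> \<Gamma>" "\<Delta>' \<turnstile> \<phi>" by auto
  then show ?case
    by (intro exI[of _ "\<Delta> \<union> \<Delta>'"]) (auto intro: derives.impE weaken)
next
  case (negI \<phi> \<Gamma> \<psi>)
  then obtain \<Delta> \<Delta>' where *: "finite \<Delta>" "\<Delta> \<subseteq> insert \<phi> \<Gamma>" "\<Delta> \<turnstile> \<psi>"
    "finite \<Delta>'" "\<Delta>' \<subseteq> insert \<phi> \<Gamma>" "\<Delta>' \<turnstile> \<^bold>\<not> \<psi>" by auto
  let ?E = "\<Delta> \<union> \<Delta>' - {\<phi>}"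
  have "?E \<turnstile> \<^bold>\<not> \<phi>"
    by (rule derives.negI[of _ _ \<psi>]) (use * in \<open>auto elim: weaken\<close>)
  with * show ?case by (intro exI[of _ ?E]) auto
next
  case (raa \<phi> \<Gamma> \<psi>)
  then obtain \<Delta> \<Delta>' where *: "finite \<Delta>" "\<Delta> \<subseteq> insert (\<^bold>\<not> \<phi>) \<Gamma>" "\<Delta> \<turnstile> \<psi>"
    "finite \<Delta>'" "\<Delta>' \<subseteq> insert (\<^bold>\<not> \<phi>) \<Gamma>" "\<Delta>' \<turnstile> \<^bold>\<not> \<psi>" by auto
  let ?E = "\<Delta> \<union> \<Delta>' - {\<^bold>\<not> \<phi>}"
  have "?E \<turnstile> \<phi>"
    by (rule derives.raa[of _ _ \<psi>]) (use * in \<open>auto elim: weaken\<close>)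
  with * show ?case by (intro exI[of _ ?E]) auto
next
  case (allI \<Gamma> \<phi>)
  then obtain \<Delta> where *: "finite \<Delta>" "\<Delta> \<subseteq> ren_fm Suc ` \<Gamma>" "\<Delta> \<turnstile> \<phi>" by auto
  then obtain \<Delta>' where "\<Delta>' \<subseteq> \<Gamma>" "finite \<Delta>'" "\<Delta> = ren_fm Suc ` \<Delta>'"
    by (meson finite_subset_image)
  with * show ?case by (intro exI[of _ \<Delta>']) (auto intro: derives.allI)
next
  case (allE \<Gamma> \<phi> t)
  then obtain \<Delta> \<Delta>' where "finite \<Delta>" "\<Delta> \<subseteq> \<Gamma>" "\<Delta> \<turnstile> \<^bold>\<forall> \<phi>" "finite \<Delta>'" "\<Delta>' \<subseteq> \<Gamma>" "\<Delta>' \<turnstile> t \<^bold>= t" by auto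
  then show ?case
    by (intro exI[of _ "\<Delta> \<union> \<Delta>'"]) (auto intro!: derives.allE intro: weaken)
next
  case (eq_subst \<Gamma> s t \<phi>)
  then obtain \<Delta> \<Delta>' where "finite \<Delta>" "\<Delta> \<subseteq> \<Gamma>" "\<Delta> \<turnstile> s \<^bold>= t" "finite \<Delta>'" "\<Delta>' \<subseteq> \<Gamma>" "\<Delta>' \<turnstile> inst \<phi> s" by auto
  then show ?case
    by (intro exI[of _ "\<Delta> \<union> \<Delta>'"]) (auto intro!: derives.eq_subst[of _ s t] intro: weaken)
qed (auto intro: derives.intros)

text \<open>The rule \<open>allI\<close> shifts the whole context, whereas the Henkin argument has a
  fresh variable \<open>k\<close> in hand. The renaming \<open>?r\<close> sends \<open>k\<close> to
  the bound position 0 and shifts all other variables: by freshness it acts on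
  \<open>\<Gamma>\<close> as \<open>Suc\<close>, and it undoes the instantiation of
  \<open>\<phi>\<close>.\<close>

lemma generalize:
  assumes "\<Gamma> \<turnstile> inst \<phi> (V k)" and "\<And>\<psi>. \<psi> \<in> \<Gamma> \<Longrightarrow> k \<notin> fv_fm \<psi>" and "k \<notin> fv_fm (\<^bold>\<forall> \<phi>)"
  shows "\<Gamma> \<turnstile> \<^bold>\<forall> \<phi>"
proof (rule derives.allI)
  let ?r = "\<lambda>n. if n = k then 0 else Suc n"
  have 1: "ren_fm ?r (inst \<phi> (V k)) = \<phi>"
  proof -
    have "ren_fm (\<lambda>n. ?r (case_nat k (\<lambda>n. n) n)) \<phi> = ren_fm (\<lambda>n. n) \<phi>"
      by (rule ren_cong) (use assms(3) in \<open>auto split: nat.splits\<close>)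
    then show ?thesis by (simp add: inst_V ren_ren ren_id)
  qed
  have 2: "ren_fm ?r \<psi> = ren_fm Suc \<psi>" if "\<psi> \<in> \<Gamma>" for \<psi>
    by (rule ren_cong) (use assms(2)[OF that] in auto)
  have "ren_fm ?r ` \<Gamma> \<subseteq> ren_fm Suc ` \<Gamma>" using 2 by auto
  from derives_ren[OF assms(1) this] show "ren_fm Suc ` \<Gamma> \<turnstile> \<phi>" unfolding 1 .
qed

lemma inconsistent_derives: "\<not> consistent \<Gamma> \<Longrightarrow> \<Gamma> \<turnstile> \<phi>"
  unfolding consistent_def by (meson raa weaken subset_insertI)

lemma consistent_subset: "consistent \<Delta> \<Longrightarrow> \<Gamma> \<subseteq> \<Delta> \<Longrightarrow> consistent \<Gamma>"
  unfolding consistent_def by (meson weaken)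

lemma inconsistent_insert: "\<not> consistent (insert \<phi> \<Gamma>) \<Longrightarrow> \<Gamma> \<turnstile> \<^bold>\<not> \<phi>"
  unfolding consistent_def by (meson negI)

lemma inconsistent_insert_Neg: "\<not> consistent (insert (\<^bold>\<not> \<phi>) \<Gamma>) \<Longrightarrow> \<Gamma> \<turnstile> \<phi>"
  unfolding consistent_def by (meson raa)

text \<open>The left inverse \<open>s\<close> carries a contradiction from the renamed set back to
  \<open>\<Gamma>\<close>.\<close>

lemma consistent_ren:
  assumes "consistent \<Gamma>" "\<And>n. s (r n) = n"
  shows "consistent (ren_fm r ` \<Gamma>)"
proof (rule ccontr)
  assume "\<not> ?thesis"
  then obtain \<psi> where *: "ren_fm r ` \<Gamma> \<turnstile> \<psi>" "ren_fm r ` \<Gamma> \<turnstile> \<^bold>\<not> \<psi>"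
    by (auto simp: consistent_def)
  have "ren_fm s ` ren_fm r ` \<Gamma> = \<Gamma>"
    by (simp add: image_image ren_ren assms(2) ren_id)
  with derives_ren[OF *(1), of s \<Gamma>] derives_ren[OF *(2), of s \<Gamma>] assms(1) show False
    by (auto simp: consistent_def)
qed


section \<open>Semantics and soundness\<close>

text \<open>\<open>None\<close> plays the part of the value outside the domain. The carrier is a set
  and not a type, so that the Henkin model and later the class \<open>H\<close> inside a model of ZF
  fall under the same notion.\<close>

primrec eval :: "'a set \<Rightarrow> ('p \<Rightarrow> 'a \<Rightarrow> 'a \<Rightarrow> bool) \<Rightarrow> (nat \<Rightarrow> 'a) \<Rightarrow> 'p tm \<Rightarrow> 'a option"
  and sat :: "'a set \<Rightarrow> ('p \<Rightarrow> 'a \<Rightarrow> 'a \<Rightarrow> bool) \<Rightarrow> (nat \<Rightarrow> 'a) \<Rightarrow> 'p fm \<Rightarrow> bool" where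
  "eval D I e (V n) = Some (e n)"
| "eval D I e (Desc \<phi>) =
    (if \<exists>!x. x \<in> D \<and> sat D I (case_nat x e) \<phi> then Some (THE x. x \<in> D \<and> sat D I (case_nat x e) \<phi>)
     else None)"
| "sat D I e (Pred p s t) \<longleftrightarrow> (\<exists>a b. eval D I e s = Some a \<and> eval D I e t = Some b \<and> I p a b)"
| "sat D I e (Eq s t) \<longleftrightarrow> (\<exists>a. eval D I e s = Some a \<and> eval D I e t = Some a)"
| "sat D I e (Neg \<phi>) \<longleftrightarrow> \<not> sat D I e \<phi>"
| "sat D I e (Imp \<phi> \<psi>) \<longleftrightarrow> (sat D I e \<phi> \<longrightarrow> sat D I e \<psi>)"
| "sat D I e (Forall \<phi>) \<longleftrightarrow> (\<forall>x\<in>D. sat D I (case_nat x e) \<phi>)"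

lemma sat_connectives [simp]:
  "sat D I e (\<phi> \<^bold>\<and> \<psi>) \<longleftrightarrow> sat D I e \<phi> \<and> sat D I e \<psi>"
  "sat D I e (\<phi> \<^bold>\<or> \<psi>) \<longleftrightarrow> sat D I e \<phi> \<or> sat D I e \<psi>"
  "sat D I e (\<phi> \<^bold>\<longleftrightarrow> \<psi>) \<longleftrightarrow> (sat D I e \<phi> \<longleftrightarrow> sat D I e \<psi>)"
  "sat D I e (\<^bold>\<exists> \<phi>) \<longleftrightarrow> (\<exists>x\<in>D. sat D I (case_nat x e) \<phi>)"
  by (auto simp: Conj_def Disj_def Iff_def Exists_def)

lemma eval_Desc_iff:
  "eval D I e (Desc \<phi>) = Some d \<longleftrightarrow> (\<forall>x. x \<in> D \<and> sat D I (case_nat x e) \<phi> \<longleftrightarrow> x = d)"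
proof
  assume "eval D I e (Desc \<phi>) = Some d"
  then have "\<exists>!x. x \<in> D \<and> sat D I (case_nat x e) \<phi>"
    and "d = (THE x. x \<in> D \<and> sat D I (case_nat x e) \<phi>)" by (auto split: if_splits)
  then show "\<forall>x. x \<in> D \<and> sat D I (case_nat x e) \<phi> \<longleftrightarrow> x = d" by (metis (mono_tags, lifting) theI')
next
  assume *: "\<forall>x. x \<in> D \<and> sat D I (case_nat x e) \<phi> \<longleftrightarrow> x = d"
  then show "eval D I e (Desc \<phi>) = Some d" by simp
qed

lemma eval_ren_sat_ren:
  fixes t :: "'p tm" and \<phi> :: "'p fm"
  shows
  "eval D I e (ren_tm r t) = eval D I (\<lambda>n. e (r n)) t"
  "sat D I e (ren_fm r \<phi>) = sat D I (\<lambda>n. e (r n)) \<phi>"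
  by (induction t and \<phi> arbitrary: e r and e r) (simp_all add: case_nat_comp)

text \<open>The substituted terms are required to denote: an assignment gives every variable a
  value, so it can imitate only denoting terms.\<close>

lemma eval_subst_sat_subst:
  fixes t :: "'p tm" and \<phi> :: "'p fm"
  shows
  "(\<And>n. eval D I e (\<sigma> n) = Some (f n)) \<Longrightarrow> eval D I e (subst_tm \<sigma> t) = eval D I f t"
  "(\<And>n. eval D I e (\<sigma> n) = Some (f n)) \<Longrightarrow> sat D I e (subst_fm \<sigma> \<phi>) = sat D I f \<phi>"
proof (induction t and \<phi> arbitrary: e f \<sigma> and e f \<sigma>)
  case (Desc \<phi>)
  have "sat D I (case_nat x e) (subst_fm (case_nat (V 0) (\<lambda>n. \<sigma> n \<up> 1)) \<phi>) = sat D I (case_nat x f) \<phi>" for x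
    by (rule Desc.IH) (use Desc.prems in \<open>auto simp: eval_ren_sat_ren split: nat.splits\<close>)
  then show ?case by simp
next
  case (Forall \<phi>)
  have "sat D I (case_nat x e) (subst_fm (case_nat (V 0) (\<lambda>n. \<sigma> n \<up> 1)) \<phi>) = sat D I (case_nat x f) \<phi>" for x
    by (rule Forall.IH) (use Forall.prems in \<open>auto simp: eval_ren_sat_ren split: nat.splits\<close>)
  then show ?case by simp
next
  case (Pred p s t)
  show ?case using Pred.IH(1)[of e \<sigma> f, OF Pred.prems] Pred.IH(2)[of e \<sigma> f, OF Pred.prems] by simp
next
  case (Eq s t)
  show ?case using Eq.IH(1)[of e \<sigma> f, OF Eq.prems] Eq.IH(2)[of e \<sigma> f, OF Eq.prems] by simp
next
  case (Neg \<phi>)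
  show ?case using Neg.IH[of e \<sigma> f, OF Neg.prems] by simp
next
  case (Imp \<phi> \<psi>)
  show ?case using Imp.IH(1)[of e \<sigma> f, OF Imp.prems] Imp.IH(2)[of e \<sigma> f, OF Imp.prems] by simp
qed simp_all

lemma sat_inst: "eval D I e t = Some a \<Longrightarrow> sat D I e (inst \<phi> t) = sat D I (case_nat a e) \<phi>"
  by (rule eval_subst_sat_subst) (simp split: nat.split)

lemma eval_mem: "(\<And>n. e n \<in> D) \<Longrightarrow> eval D I e t = Some a \<Longrightarrow> a \<in> D"
  by (cases t) (auto simp: eval_Desc_iff simp del: eval.simps(2))

theorem soundness:
  "\<Gamma> \<turnstile> \<phi> \<Longrightarrow> (\<And>n. e n \<in> D) \<Longrightarrow> (\<And>\<psi>. \<psi> \<in> \<Gamma> \<Longrightarrow> sat D I e \<psi>) \<Longrightarrow> sat D I e \<phi>"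
proof (induction arbitrary: e rule: derives.induct)
  case (negI \<phi> \<Gamma> \<psi>)
  then show ?case by (metis insert_iff sat.simps(3))
next
  case (raa \<phi> \<Gamma> \<psi>)
  then show ?case by (metis insert_iff sat.simps(3))
next
  case (allI \<Gamma> \<phi>)
  have "sat D I (case_nat x e) \<phi>" if "x \<in> D" for x
  proof (rule allI.IH)
    show "case_nat x e n \<in> D" for n using that allI.prems(1) by (cases n) auto
    show "sat D I (case_nat x e) \<psi>" if "\<psi> \<in> ren_fm Suc ` \<Gamma>" for \<psi>
      using that allI.prems(2) by (auto simp: eval_ren_sat_ren)
  qed
  then show ?case by simp
next
  case (allE \<Gamma> \<phi> t)
  then have "sat D I e (t \<^bold>= t)" "sat D I e (\<^bold>\<forall> \<phi>)" by auto
  then obtain a where a: "eval D I e t = Some a" and "\<forall>x\<in>D. sat D I (case_nat x e) \<phi>" by auto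
  then show ?case using eval_mem[OF allE.prems(1) a] by (simp add: sat_inst)
next
  case (eq_subst \<Gamma> s t \<phi>)
  then have "sat D I e (s \<^bold>= t)" "sat D I e (inst \<phi> s)" by auto
  then show ?case by (auto simp: sat_inst)
next
  case (eq_strict1 \<Gamma> s t)
  then have "sat D I e (s \<^bold>= t)" by blast
  then show ?case by auto
next
  case (eq_strict2 \<Gamma> s t)
  then have "sat D I e (s \<^bold>= t)" by blast
  then show ?case by auto
next
  case (pred_strict1 \<Gamma> p s t)
  then have "sat D I e (Pred p s t)" by blast
  then show ?case by auto
next
  case (pred_strict2 \<Gamma> p s t)
  then have "sat D I e (Pred p s t)" by blast
  then show ?case by auto
next
  case (desc \<Gamma> n \<phi>)
  have "e n \<in> D" by (rule desc)
  then show ?case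
    by (simp add: eval_Desc_iff del: eval.simps(2)) metis
qed auto


section \<open>Completeness\<close>

lemma infinite_fresh_insert:
  assumes "infinite {k. \<forall>\<psi>\<in>\<Gamma>. k \<notin> fv_fm \<psi>}"
  shows "infinite {k. \<forall>\<psi>\<in>insert \<phi> \<Gamma>. k \<notin> fv_fm \<psi>}"
proof -
  have "{k. \<forall>\<psi>\<in>insert \<phi> \<Gamma>. k \<notin> fv_fm \<psi>} = {k. \<forall>\<psi>\<in>\<Gamma>. k \<notin> fv_fm \<psi>} - fv_fm \<phi>" by auto
  then show ?thesis using assms finite_fv(2)[of \<phi>] by (simp add: Diff_infinite_finite)
qed

definition fresh :: "'p fm set \<Rightarrow> nat" where
  "fresh \<Gamma> = (SOME k. \<forall>\<psi>\<in>\<Gamma>. k \<notin> fv_fm \<psi>)"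

lemma fresh:
  assumes "infinite {k. \<forall>\<psi>\<in>\<Gamma>. k \<notin> fv_fm \<psi>}" and "\<psi> \<in> \<Gamma>"
  shows "fresh \<Gamma> \<notin> fv_fm \<psi>"
proof -
  have "\<exists>k. \<forall>\<psi>\<in>\<Gamma>. k \<notin> fv_fm \<psi>" using assms(1) not_finite_existsD by auto
  then have "\<forall>\<psi>\<in>\<Gamma>. fresh \<Gamma> \<notin> fv_fm \<psi>" unfolding fresh_def by (rule someI_ex)
  then show ?thesis using assms(2) by blast
qed

definition witness :: "nat \<Rightarrow> 'p fm \<Rightarrow> 'p fm set" where
  "witness k \<phi> = (case \<phi> of \<^bold>\<not> (\<^bold>\<forall> \<psi>) \<Rightarrow> {\<^bold>\<not> inst \<psi> (V k)} | _ \<Rightarrow> {})"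

lemma witness_cases:
  obtains "witness k \<phi> = {}" | \<psi> where "\<phi> = \<^bold>\<not> (\<^bold>\<forall> \<psi>)" "witness k \<phi> = {\<^bold>\<not> inst \<psi> (V k)}"
proof (cases "\<exists>\<psi>. \<phi> = \<^bold>\<not> (\<^bold>\<forall> \<psi>)")
  case True
  then show thesis using that(2) by (auto simp: witness_def)
next
  case False
  then have "witness k \<phi> = {}" by (auto simp: witness_def split: fm.splits)
  then show thesis by (rule that(1))
qed

text \<open>The construction below runs through all formulas by their numbers; the first component
  of each code tags the constructor.\<close>

primrec enc_tm :: "('p::countable) tm \<Rightarrow> nat" and enc_fm :: "('p::countable) fm \<Rightarrow> nat" where
  "enc_tm (V n) = prod_encode (0, n)"
| "enc_tm (Desc \<phi>) = prod_encode (1, enc_fm \<phi>)"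
| "enc_fm (Pred p s t) = prod_encode (0, prod_encode (to_nat p, prod_encode (enc_tm s, enc_tm t)))"
| "enc_fm (Eq s t) = prod_encode (1, prod_encode (enc_tm s, enc_tm t))"
| "enc_fm (Neg \<phi>) = prod_encode (2, enc_fm \<phi>)"
| "enc_fm (Imp \<phi> \<psi>) = prod_encode (3, prod_encode (enc_fm \<phi>, enc_fm \<psi>))"
| "enc_fm (Forall \<phi>) = prod_encode (4, enc_fm \<phi>)"

lemma enc_inject:
  fixes t :: "('p::countable) tm" and \<phi> :: "'p fm"
  shows "enc_tm t = enc_tm t' \<longleftrightarrow> t = t'" "enc_fm \<phi> = enc_fm \<phi>' \<longleftrightarrow> \<phi> = \<phi>'"
proof (induction t and \<phi> arbitrary: t' and \<phi>')
  case (V n)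
  show ?case by (cases t') auto
next
  case (Desc \<phi>)
  then show ?case by (cases t') auto
next
  case (Pred p s t)
  then show ?case by (cases \<phi>') auto
next
  case (Eq s t)
  then show ?case by (cases \<phi>') auto
next
  case (Neg \<phi>)
  then show ?case by (cases \<phi>') auto
next
  case (Imp \<phi> \<psi>)
  then show ?case by (cases \<phi>') auto
next
  case (Forall \<phi>)
  then show ?case by (cases \<phi>') auto
qed

instance fm :: (countable) countable
  by (rule countable_classI[of enc_fm]) (simp add: enc_inject)

section \<open>Saturated extensions of consistent sets\<close>

primrec henkin :: "('p::countable) fm set \<Rightarrow> nat \<Rightarrow> 'p fm set" where
  "henkin \<Gamma> 0 = \<Gamma>"
| "henkin \<Gamma> (Suc n) =
    (let \<Delta> = insert (from_nat n) (henkin \<Gamma> n)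
     in if consistent \<Delta> then witness (fresh \<Delta>) (from_nat n) \<union> \<Delta> else henkin \<Gamma> n)"

text \<open>If the negated instance at a fresh variable were inconsistent with
  \<open>\<Gamma>\<close>, the instance would be derivable, and \<open>generalize\<close> would
  derive the universal formula whose negation lies in \<open>\<Gamma>\<close>.\<close>

lemma henkin_step:
  assumes "consistent \<Gamma>" "infinite {k. \<forall>\<psi>\<in>\<Gamma>. k \<notin> fv_fm \<psi>}" "\<phi> \<in> \<Gamma>"
  defines "\<Delta> \<equiv> witness (fresh \<Gamma>) \<phi> \<union> \<Gamma>"
  shows "consistent \<Delta> \<and> infinite {k. \<forall>\<psi>\<in>\<Delta>. k \<notin> fv_fm \<psi>}"
proof (cases rule: witness_cases[of "fresh \<Gamma>" \<phi>])
  case 1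
  then show ?thesis using assms by simp
next
  case (2 \<psi>)
  have "consistent (insert (\<^bold>\<not> inst \<psi> (V (fresh \<Gamma>))) \<Gamma>)"
  proof (rule ccontr)
    assume "\<not> ?thesis"
    then have "\<Gamma> \<turnstile> inst \<psi> (V (fresh \<Gamma>))" by (rule inconsistent_insert_Neg)
    moreover have "fresh \<Gamma> \<notin> fv_fm (\<^bold>\<forall> \<psi>)"
      using fresh[OF assms(2,3)] 2 by simp
    ultimately have "\<Gamma> \<turnstile> \<^bold>\<forall> \<psi>"
      using generalize fresh[OF assms(2)] by blast
    moreover have "\<Gamma> \<turnstile> \<^bold>\<not> (\<^bold>\<forall> \<psi>)" using assms(3) 2 by (auto intro: assm)
    ultimately show False using assms(1) by (auto simp: consistent_def)
  qed
  then show ?thesis using 2 infinite_fresh_insert[OF assms(2)] by (simp add: \<Delta>_def)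
qed

lemma henkin_invariant:
  assumes "consistent \<Gamma>" "infinite {k. \<forall>\<psi>\<in>\<Gamma>. k \<notin> fv_fm \<psi>}"
  shows "consistent (henkin \<Gamma> n) \<and> infinite {k. \<forall>\<psi>\<in>henkin \<Gamma> n. k \<notin> fv_fm \<psi>}"
proof (induction n)
  case 0
  show ?case using assms by simp
next
  case (Suc n)
  let ?\<Delta> = "insert (from_nat n) (henkin \<Gamma> n)"
  show ?case
  proof (cases "consistent ?\<Delta>")
    case True
    have "infinite {k. \<forall>\<psi>\<in>?\<Delta>. k \<notin> fv_fm \<psi>}" using Suc infinite_fresh_insert by blast
    from henkin_step[OF True this, of "from_nat n"] True show ?thesis by (simp add: Let_def)
  next
    case False
    with Suc show ?thesis by (simp add: Let_def)
  qed
qed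

lemma henkin_mono: "m \<le> n \<Longrightarrow> henkin \<Gamma> m \<subseteq> henkin \<Gamma> n"
  by (rule lift_Suc_mono_le[of "henkin \<Gamma>"]) (auto simp: Let_def)

lemma finite_subset_henkin:
  assumes "finite \<Delta>" "\<Delta> \<subseteq> (\<Union>n. henkin \<Gamma> n)"
  shows "\<exists>n. \<Delta> \<subseteq> henkin \<Gamma> n"
  using assms
proof (induction \<Delta>)
  case (insert \<phi> \<Delta>)
  then obtain m n where "\<Delta> \<subseteq> henkin \<Gamma> n" "\<phi> \<in> henkin \<Gamma> m" by auto
  then have "insert \<phi> \<Delta> \<subseteq> henkin \<Gamma> (max m n)"
    using henkin_mono[of m "max m n" \<Gamma>] henkin_mono[of n "max m n" \<Gamma>] by auto
  then show ?case ..
qed simp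

locale saturated =
  fixes S :: "'p fm set"
  assumes consistent: "consistent S"
    and maximal: "consistent (insert \<phi> S) \<Longrightarrow> \<phi> \<in> S"
    and henkin: "\<^bold>\<not> (\<^bold>\<forall> \<psi>) \<in> S \<Longrightarrow> \<exists>k. \<^bold>\<not> inst \<psi> (V k) \<in> S"

lemma saturated_exists:
  fixes \<Gamma> :: "('p::countable) fm set"
  assumes "consistent \<Gamma>" "infinite {k. \<forall>\<psi>\<in>\<Gamma>. k \<notin> fv_fm \<psi>}"
  shows "\<exists>S. saturated S \<and> \<Gamma> \<subseteq> S"
proof (intro exI conjI)
  let ?S = "\<Union>n. henkin \<Gamma> n"
  have con: "consistent (henkin \<Gamma> n)" for n using henkin_invariant[OF assms] by blast
  \<comment> \<open>What is consistent with the union is consistent with the stage at which its own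
    number comes up, and so it is accepted there together with its witness.\<close>
  have added: "consistent (insert \<phi> ?S) \<Longrightarrow>
      henkin \<Gamma> (Suc (to_nat \<phi>)) = witness (fresh (insert \<phi> (henkin \<Gamma> (to_nat \<phi>)))) \<phi> \<union> insert \<phi> (henkin \<Gamma> (to_nat \<phi>))" for \<phi>
    using consistent_subset[of "insert \<phi> ?S" "insert \<phi> (henkin \<Gamma> (to_nat \<phi>))"]
    by (auto simp: Let_def)
  have cS: "consistent ?S"
  proof (rule ccontr)
    assume "\<not> ?thesis"
    then obtain \<psi> where "?S \<turnstile> \<psi>" "?S \<turnstile> \<^bold>\<not> \<psi>" by (auto simp: consistent_def)
    then obtain \<Delta> \<Delta>' where *: "finite \<Delta>" "\<Delta> \<subseteq> ?S" "\<Delta> \<turnstile> \<psi>" "finite \<Delta>'" "\<Delta>' \<subseteq> ?S" "\<Delta>' \<turnstile> \<^bold>\<not> \<psi>"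
      using compact by meson
    then obtain n where n: "\<Delta> \<union> \<Delta>' \<subseteq> henkin \<Gamma> n"
      using finite_subset_henkin[of "\<Delta> \<union> \<Delta>'" \<Gamma>] by (meson finite_UnI Un_least)
    have "\<Delta> \<subseteq> henkin \<Gamma> n" "\<Delta>' \<subseteq> henkin \<Gamma> n" using n by auto
    then show False using con[of n] * unfolding consistent_def by (meson weaken)
  qed
  show "saturated ?S"
  proof
    show "consistent ?S" by (rule cS)
    show "\<phi> \<in> ?S" if "consistent (insert \<phi> ?S)" for \<phi> using added[OF that] by blast
    show "\<exists>k. \<^bold>\<not> inst \<psi> (V k) \<in> ?S" if "\<^bold>\<not> (\<^bold>\<forall> \<psi>) \<in> ?S" for \<psi>
    proof -
      \<comment> \<open>The formula is already a member, so adding it once more is harmless;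
        \<open>added\<close> then shows that its own stage supplied a witness.\<close>
      have "consistent (insert (\<^bold>\<not> (\<^bold>\<forall> \<psi>)) ?S)" using cS that by (simp add: insert_absorb)
      from added[OF this] show ?thesis by (auto simp: witness_def simp del: henkin.simps)
    qed
  qed
  have "henkin \<Gamma> 0 \<subseteq> ?S" by blast
  then show "\<Gamma> \<subseteq> ?S" by simp
qed

section \<open>The model of variables modulo provable equality\<close>

context saturated
begin

lemma derives_iff: "(S \<turnstile> \<phi>) \<longleftrightarrow> \<phi> \<in> S"
  using consistent inconsistent_insert maximal assm unfolding consistent_def by blast

lemma Neg_iff: "\<^bold>\<not> \<phi> \<in> S \<longleftrightarrow> \<phi> \<notin> S"
  using consistent inconsistent_insert maximal assm derives_iff unfolding consistent_def by meson

lemma Imp_iff: "(\<phi> \<^bold>\<longrightarrow> \<psi>) \<in> S \<longleftrightarrow> (\<phi> \<in> S \<longrightarrow> \<psi> \<in> S)"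
proof (intro iffI impI)
  assume *: "\<phi> \<in> S \<longrightarrow> \<psi> \<in> S"
  have "insert \<phi> S \<turnstile> \<psi>"
  proof (cases "\<phi> \<in> S")
    case True
    then show ?thesis using * by (auto intro: assm)
  next
    case False
    then show ?thesis using maximal inconsistent_derives by blast
  qed
  then show "(\<phi> \<^bold>\<longrightarrow> \<psi>) \<in> S" using derives_iff impI by blast
qed (use derives_iff impE in blast)

lemma Conj_iff: "(\<phi> \<^bold>\<and> \<psi>) \<in> S \<longleftrightarrow> \<phi> \<in> S \<and> \<psi> \<in> S"
  by (simp add: Conj_def Neg_iff Imp_iff)

lemma Iff_iff: "(\<phi> \<^bold>\<longleftrightarrow> \<psi>) \<in> S \<longleftrightarrow> (\<phi> \<in> S \<longleftrightarrow> \<psi> \<in> S)"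
  by (auto simp: Iff_def Conj_iff Imp_iff)

lemma Forall_iff: "(\<^bold>\<forall> \<phi>) \<in> S \<longleftrightarrow> (\<forall>k. inst \<phi> (V k) \<in> S)"
  using allE var_denotes derives_iff henkin Neg_iff by metis

lemma eq_replace: "s \<^bold>= t \<in> S \<Longrightarrow> inst \<phi> s \<in> S \<Longrightarrow> inst \<phi> t \<in> S"
  using derives_iff eq_subst by metis

lemma inst_lift:
  "subst_tm (case_nat s V) (ren_tm Suc t) = t"
  using subst_V(1)[of "\<lambda>n. n" t] by (simp add: subst_ren ren_id)

lemma eq_sym: "s \<^bold>= t \<in> S \<Longrightarrow> t \<^bold>= s \<in> S"
  using eq_replace[of s t "V 0 \<^bold>= s \<up> 1"] eq_strict1[of S s t] by (auto simp: inst_lift derives_iff)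

lemma eq_trans: "s \<^bold>= t \<in> S \<Longrightarrow> t \<^bold>= u \<in> S \<Longrightarrow> s \<^bold>= u \<in> S"
  using eq_replace[of t u "s \<up> 1 \<^bold>= V 0"] by (auto simp: inst_lift)

lemma pred_replace:
  "s \<^bold>= s' \<in> S \<Longrightarrow> t \<^bold>= t' \<in> S \<Longrightarrow> Pred p s t \<in> S \<Longrightarrow> Pred p s' t' \<in> S"
  using eq_replace[of s s' "Pred p (V 0) (t \<up> 1)"] eq_replace[of t t' "Pred p (s' \<up> 1) (V 0)"]
  by (auto simp: inst_lift)

text \<open>If \<open>t\<close> differed from every variable, the Henkin property would put the
  universal statement of this into \<open>S\<close>, and instantiating it with \<open>t\<close>
  itself would contradict \<open>t\<close> being equal to \<open>t\<close>. Hence the variables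
  suffice as elements of the model.\<close>

lemma denotes_iff: "t \<^bold>= t \<in> S \<longleftrightarrow> (\<exists>k. V k \<^bold>= t \<in> S)"
proof
  assume t: "t \<^bold>= t \<in> S"
  have "(\<^bold>\<forall> (\<^bold>\<not> V 0 \<^bold>= t \<up> 1)) \<notin> S"
  proof
    assume "(\<^bold>\<forall> (\<^bold>\<not> V 0 \<^bold>= t \<up> 1)) \<in> S"
    then have "inst (\<^bold>\<not> V 0 \<^bold>= t \<up> 1) t \<in> S"
      using t derives_iff allE by metis
    then show False using t by (simp add: inst_lift Neg_iff)
  qed
  then show "\<exists>k. V k \<^bold>= t \<in> S" by (auto simp: Forall_iff inst_lift Neg_iff)
next
  assume "\<exists>k. V k \<^bold>= t \<in> S"
  then show "t \<^bold>= t \<in> S" using eq_sym eq_trans by blast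
qed

text \<open>The least variable of each class replaces a quotient and keeps the carrier a set of
  naturals.\<close>

definition rep :: "nat \<Rightarrow> nat" where
  "rep k = (LEAST l. V l \<^bold>= V k \<in> S)"

lemma V_eq_refl: "V k \<^bold>= V k \<in> S"
  using derives_iff var_denotes by metis

lemma rep_eq: "V (rep k) \<^bold>= V k \<in> S"
  unfolding rep_def by (rule LeastI[of _ k]) (rule V_eq_refl)

lemma rep_iff: "rep k = rep l \<longleftrightarrow> V k \<^bold>= V l \<in> S"
proof
  assume "rep k = rep l"
  then show "V k \<^bold>= V l \<in> S" using rep_eq eq_sym eq_trans by metis
next
  assume "V k \<^bold>= V l \<in> S"
  then have "V m \<^bold>= V k \<in> S \<longleftrightarrow> V m \<^bold>= V l \<in> S" for m using eq_sym eq_trans by blast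
  then show "rep k = rep l" by (simp add: rep_def)
qed

lemma rep_rep: "rep (rep k) = rep k"
  using rep_iff rep_eq by blast

definition interp :: "'p \<Rightarrow> nat \<Rightarrow> nat \<Rightarrow> bool" where
  "interp p a b \<longleftrightarrow> Pred p (V a) (V b) \<in> S"

text \<open>The renaming \<open>\<sigma>\<close> acts as the assignment: below a binder the
  induction hypothesis is used for \<open>case_nat k \<sigma>\<close>, and \<open>inst_ren\<close>
  recognizes the result as an instance. For descriptions, the rule \<open>desc\<close> gives in
  \<open>S\<close> the same condition that \<open>eval_Desc_iff\<close> gives in the model. For
  atomic formulas, strictness supplies denoting arguments, hence variables equal to them.\<close>

lemma truth:
  "eval (range rep) interp (\<lambda>n. rep (\<sigma> n)) t = Some (rep d) \<longleftrightarrow> V d \<^bold>= ren_tm \<sigma> t \<in> S"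
  "sat (range rep) interp (\<lambda>n. rep (\<sigma> n)) \<phi> \<longleftrightarrow> ren_fm \<sigma> \<phi> \<in> S"
proof (induction t and \<phi> arbitrary: \<sigma> d and \<sigma>)
  case (V n)
  then show ?case by (auto simp: rep_iff intro: eq_sym)
next
  case (Desc \<phi>)
  have sat: "sat (range rep) interp (case_nat (rep k) (\<lambda>n. rep (\<sigma> n))) \<phi> \<longleftrightarrow> ren_fm (case_nat k \<sigma>) \<phi> \<in> S" for k
    using Desc[of "case_nat k \<sigma>"] by (simp add: case_nat_comp)
  have "V d \<^bold>= ren_tm \<sigma> (Desc \<phi>) \<in> S \<longleftrightarrow>
      (\<^bold>\<forall> (ren_fm (case_nat 0 (\<lambda>n. Suc (\<sigma> n))) \<phi> \<^bold>\<longleftrightarrow> V 0 \<^bold>= V (Suc d))) \<in> S"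
    using desc[of S d "ren_fm (case_nat 0 (\<lambda>n. Suc (\<sigma> n))) \<phi>"] by (simp add: derives_iff Iff_iff)
  also have "\<dots> \<longleftrightarrow> (\<forall>k. ren_fm (case_nat k \<sigma>) \<phi> \<in> S \<longleftrightarrow> V k \<^bold>= V d \<in> S)"
    by (simp add: Forall_iff Iff_def Conj_def inst_ren Neg_iff Imp_iff) blast
  also have "\<dots> \<longleftrightarrow> (\<forall>x. x \<in> range rep \<and> sat (range rep) interp (case_nat x (\<lambda>n. rep (\<sigma> n))) \<phi> \<longleftrightarrow> x = rep d)"
    unfolding sat[symmetric] rep_iff[symmetric] by blast
  finally show ?case by (simp only: eval_Desc_iff)
next
  case (Pred p s t)
  let ?e = "\<lambda>n. rep (\<sigma> n)"
  have mem: "a \<in> range rep" if "eval (range rep) interp ?e u = Some a" for u a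
    by (rule eval_mem[OF _ that]) simp
  show ?case
  proof
    assume "sat (range rep) interp ?e (Pred p s t)"
    then obtain a b where *: "eval (range rep) interp ?e s = Some a" "eval (range rep) interp ?e t = Some b"
      "interp p a b" by auto
    then have "a = rep a" "b = rep b" using mem rep_rep by fastforce+
    with * Pred[of \<sigma>] have "V a \<^bold>= ren_tm \<sigma> s \<in> S" "V b \<^bold>= ren_tm \<sigma> t \<in> S" by metis+
    with *(3) show "ren_fm \<sigma> (Pred p s t) \<in> S" by (auto simp: interp_def intro: pred_replace)
  next
    assume *: "ren_fm \<sigma> (Pred p s t) \<in> S"
    then have "ren_tm \<sigma> s \<^bold>= ren_tm \<sigma> s \<in> S" "ren_tm \<sigma> t \<^bold>= ren_tm \<sigma> t \<in> S"
      using pred_strict1 pred_strict2 derives_iff by fastforce+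
    then obtain a b where ab: "V a \<^bold>= ren_tm \<sigma> s \<in> S" "V b \<^bold>= ren_tm \<sigma> t \<in> S"
      unfolding denotes_iff by blast
    then have "V (rep a) \<^bold>= ren_tm \<sigma> s \<in> S" "V (rep b) \<^bold>= ren_tm \<sigma> t \<in> S" using rep_eq eq_trans by blast+
    then have "interp p (rep a) (rep b)" using * unfolding interp_def by (auto intro: pred_replace eq_sym)
    then show "sat (range rep) interp ?e (Pred p s t)" using ab Pred[of \<sigma>] by auto
  qed
next
  case (Eq s t)
  let ?e = "\<lambda>n. rep (\<sigma> n)"
  have mem: "a \<in> range rep" if "eval (range rep) interp ?e u = Some a" for u a
    by (rule eval_mem[OF _ that]) simp
  have "sat (range rep) interp ?e (s \<^bold>= t) \<longleftrightarrow> (\<exists>k. V k \<^bold>= ren_tm \<sigma> s \<in> S \<and> V k \<^bold>= ren_tm \<sigma> t \<in> S)"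
    unfolding Eq[symmetric] sat.simps using mem[of s] by blast
  also have "\<dots> \<longleftrightarrow> ren_fm \<sigma> (s \<^bold>= t) \<in> S"
    using eq_sym eq_trans denotes_iff by (metis ren_fm.simps(2))
  finally show ?case .
next
  case (Forall \<phi>)
  have "sat (range rep) interp (case_nat (rep k) (\<lambda>n. rep (\<sigma> n))) \<phi> \<longleftrightarrow> ren_fm (case_nat k \<sigma>) \<phi> \<in> S" for k
    using Forall[of "case_nat k \<sigma>"] by (simp add: case_nat_comp)
  then show ?case by (simp add: Forall_iff inst_ren)
qed (auto simp: Neg_iff Imp_iff)

end

text \<open>Renaming by \<open>n \<mapsto> 2 n\<close> frees the odd variables for use as Henkin witnesses.\<close>

theorem model_existence:
  fixes \<Gamma> :: "('p::countable) fm set"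
  assumes "consistent \<Gamma>"
  shows "\<exists>(D::nat set) I e. (\<forall>n. e n \<in> D) \<and> (\<forall>\<phi>\<in>\<Gamma>. sat D I e \<phi>)"
proof -
  let ?r = "\<lambda>n::nat. 2 * n"
  have "consistent (ren_fm ?r ` \<Gamma>)"
    by (rule consistent_ren[OF assms, of "\<lambda>n. n div 2"]) simp
  moreover have "infinite {k. \<forall>\<psi>\<in>ren_fm ?r ` \<Gamma>. k \<notin> fv_fm \<psi>}"
  proof (rule infinite_super)
    show "range (\<lambda>n. Suc (2 * n)) \<subseteq> {k. \<forall>\<psi>\<in>ren_fm ?r ` \<Gamma>. k \<notin> fv_fm \<psi>}"
      by (auto simp: fv_ren) presburger
    show "infinite (range (\<lambda>n::nat. Suc (2 * n)))"
      by (simp add: finite_image_iff inj_on_def)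
  qed
  ultimately obtain S where "saturated S" and sub: "ren_fm ?r ` \<Gamma> \<subseteq> S"
    using saturated_exists by blast
  then interpret saturated S by simp
  show ?thesis
    by (intro exI[of _ "range rep"] exI[of _ interp] exI[of _ "\<lambda>n. rep (?r n)"])
      (use sub truth(2)[of ?r] in auto)
qed


section \<open>Models of ZF\<close>

lemma sat_cong:
  fixes t :: "'p tm" and \<phi> :: "'p fm"
  shows
    "(\<And>n. n \<in> fv_tm t \<Longrightarrow> e n = e' n) \<Longrightarrow> eval D I e t = eval D I e' t"
    "(\<And>n. n \<in> fv_fm \<phi> \<Longrightarrow> e n = e' n) \<Longrightarrow> sat D I e \<phi> = sat D I e' \<phi>"
proof (induction t and \<phi> arbitrary: e e' and e e')
  case (Desc \<phi>)
  have "sat D I (case_nat x e) \<phi> = sat D I (case_nat x e') \<phi>" for x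
    by (rule Desc) (use Desc.prems in \<open>auto split: nat.split\<close>)
  then show ?case by simp
next
  case (Forall \<phi>)
  have "sat D I (case_nat x e) \<phi> = sat D I (case_nat x e') \<phi>" for x
    by (rule Forall) (use Forall.prems in \<open>auto split: nat.split\<close>)
  then show ?case by simp
next
  case (Pred p s t)
  show ?case using Pred.IH(1)[of e e'] Pred.IH(2)[of e e'] Pred.prems by simp
next
  case (Eq s t)
  show ?case using Eq.IH(1)[of e e'] Eq.IH(2)[of e e'] Eq.prems by simp
next
  case (Neg \<phi>)
  show ?case using Neg.IH[of e e'] Neg.prems by simp
next
  case (Imp \<phi> \<psi>)
  show ?case using Imp.IH(1)[of e e'] Imp.IH(2)[of e e'] Imp.prems by simp
qed simp

text \<open>A bijection preserves unique existence, so a description has a value on one side exactly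
  when it has one on the other.\<close>

lemma sat_iso:
  fixes t :: "'p tm" and \<phi> :: "'p fm" and I :: "'p \<Rightarrow> 'a \<Rightarrow> 'a \<Rightarrow> bool"
  assumes f: "bij_betw f UNIV D"
  defines "J \<equiv> \<lambda>p a b. I p (f a) (f b)"
  shows
    "eval D I (\<lambda>n. f (e n)) t = map_option f (eval UNIV J e t)"
    "sat D I (\<lambda>n. f (e n)) \<phi> = sat UNIV J e \<phi>"
proof (induction t and \<phi> arbitrary: e and e)
  case (Desc \<phi>)
  have step: "sat D I (case_nat (f x) (\<lambda>n. f (e n))) \<phi> = sat UNIV J (case_nat x e) \<phi>" for x
  proof -
    have "(\<lambda>n. f (case_nat x e n)) = case_nat (f x) (\<lambda>n. f (e n))"
      by (auto simp: fun_eq_iff split: nat.split)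
    then show ?thesis using Desc[of "case_nat x e"] by simp
  qed
  have D: "D = range f" using f by (simp add: bij_betw_def)
  have inj: "f x = f y \<longleftrightarrow> x = y" for x y using f by (auto simp: bij_betw_def inj_def)
  have "eval D I (\<lambda>n. f (e n)) (Desc \<phi>) = Some (f d) \<longleftrightarrow> eval UNIV J e (Desc \<phi>) = Some d" for d
  proof -
    have "(\<forall>x. x \<in> range f \<and> Q x \<longleftrightarrow> x = f d) \<longleftrightarrow> (\<forall>x. Q (f x) \<longleftrightarrow> x = d)" for Q
      using inj by blast
    then show ?thesis unfolding eval_Desc_iff D step[unfolded D, symmetric] by simp
  qed
  moreover have "d \<in> range f" if "eval D I (\<lambda>n. f (e n)) (Desc \<phi>) = Some d" for d
    using that eval_mem[of "\<lambda>n. f (e n)" D I] D by blast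
  ultimately show ?case
    by (cases "eval D I (\<lambda>n. f (e n)) (Desc \<phi>)"; cases "eval UNIV J e (Desc \<phi>)")
      (simp_all del: eval.simps, (metis imageE option.distinct(1) option.inject)+)
next
  case (Pred p s t)
  then show ?case by (auto simp: J_def)
next
  case (Eq s t)
  have inj: "f x = f y \<longleftrightarrow> x = y" for x y using f by (auto simp: bij_betw_def inj_def)
  show ?case by (auto simp: Eq inj)
next
  case (Forall \<phi>)
  have "sat D I (case_nat (f x) (\<lambda>n. f (e n))) \<phi> = sat UNIV J (case_nat x e) \<phi>" for x
  proof -
    have "(\<lambda>n. f (case_nat x e n)) = case_nat (f x) (\<lambda>n. f (e n))"
      by (auto simp: fun_eq_iff split: nat.split)
    then show ?thesis using Forall[of "case_nat x e"] by simp
  qed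
  moreover have "D = range f" using f by (simp add: bij_betw_def)
  ultimately show ?case by simp
qed simp_all

lemma sat_Forall_funpow:
  assumes "\<And>e. sat UNIV I e ((Forall ^^ n) \<phi>)"
  shows "sat UNIV I e \<phi>"
  using assms
proof (induction n arbitrary: e)
  case (Suc n)
  have "sat UNIV I e ((Forall ^^ n) \<phi>)" for e
  proof -
    have "sat UNIV I (case_nat (e 0) (\<lambda>n. e (Suc n))) ((Forall ^^ n) \<phi>)" using Suc.prems by simp
    moreover have "case_nat (e 0) (\<lambda>n. e (Suc n)) = e" by (auto split: nat.split)
    ultimately show ?thesis by simp
  qed
  then show ?case by (rule Suc.IH)
qed simp

lemma fv_Forall_funpow: "fv_fm ((Forall ^^ n) \<phi>) = {k. k + n \<in> fv_fm \<phi>}"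
  by (induction n) auto

lemma closures_nonempty: "\<exists>n. (Forall ^^ n) \<phi> \<in> closures \<phi>"
proof -
  obtain n where "\<forall>k\<in>fv_fm \<phi>. k < n" using finite_fv(2)[of \<phi>] finite_nat_set_iff_bounded by blast
  then have "fv_fm ((Forall ^^ n) \<phi>) = {}" by (auto simp: fv_Forall_funpow)
  then show ?thesis unfolding closures_def by blast
qed

lemma ZF_closed: "\<phi> \<in> ZF \<Longrightarrow> fv_fm \<phi> = {}"
  by (auto simp: ZF_def closures_def ZF_extensionality_def ZF_foundation_def ZF_pairing_def
      ZF_union_def ZF_power_def ZF_infinity_def Iff_def Conj_def Disj_def Exists_def ball_def bex_def
      split: if_splits)

text \<open>Pairing and union collect any finitely many elements into one set. In a finite model
  this would be a universal set \<open>u\<close>; then \<open>u\<close> is a member of itself and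
  its singleton \<open>s\<close> violates foundation.\<close>

lemma ZF_model_infinite:
  assumes D: "\<And>n. e n \<in> D" and ZF: "\<And>\<phi>. \<phi> \<in> ZF \<Longrightarrow> sat D I e \<phi>"
  shows "infinite D"
proof
  let ?E = "I Mem"
  have pairing: "\<forall>a\<in>D. \<forall>b\<in>D. \<exists>y\<in>D. \<forall>z\<in>D. ?E z y \<longleftrightarrow> a = z \<or> b = z"
    using ZF[of ZF_pairing] by (simp add: ZF_def ZF_pairing_def)
  have union: "\<forall>x\<in>D. \<exists>y\<in>D. \<forall>z\<in>D. ?E z y \<longleftrightarrow> (\<exists>w\<in>D. ?E w x \<and> ?E z w)"
    using ZF[of ZF_union] by (simp add: ZF_def ZF_union_def bex_def)
  have foundation: "\<forall>x\<in>D. (\<exists>y\<in>D. ?E y x) \<longrightarrow> (\<exists>y\<in>D. ?E y x \<and> \<not> (\<exists>z\<in>D. ?E z y \<and> ?E z x))"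
    using ZF[of ZF_foundation] by (simp add: ZF_def ZF_foundation_def bex_def) blast
  assume "finite D"
  have "\<exists>u\<in>D. \<forall>x\<in>F. ?E x u" if "finite F" "F \<subseteq> D" for F
    using that
  proof (induction F)
    case empty
    then show ?case using D by blast
  next
    case (insert x F)
    then obtain u where u: "u \<in> D" "\<forall>x\<in>F. ?E x u" by blast
    have "x \<in> D" using insert.prems by blast
    with pairing obtain p where p: "p \<in> D" "\<forall>z\<in>D. ?E z p \<longleftrightarrow> x = z \<or> x = z" by blast
    with pairing u obtain q where q: "q \<in> D" "\<forall>z\<in>D. ?E z q \<longleftrightarrow> u = z \<or> p = z" by blast
    with union obtain w where "w \<in> D" "\<forall>z\<in>D. ?E z w \<longleftrightarrow> (\<exists>v\<in>D. ?E v q \<and> ?E z v)" by blast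
    with u p q insert.prems have "\<forall>y\<in>insert x F. ?E y w" by blast
    with \<open>w \<in> D\<close> show ?case by blast
  qed
  with \<open>finite D\<close> obtain u where u: "u \<in> D" "\<forall>x\<in>D. ?E x u" by blast
  obtain s where s: "s \<in> D" "\<forall>z\<in>D. ?E z s \<longleftrightarrow> u = z \<or> u = z" using pairing u by blast
  then have "(\<exists>y\<in>D. ?E y s \<and> \<not> (\<exists>z\<in>D. ?E z y \<and> ?E z s))" using bspec[OF foundation, of s] u by simp
  then show False using s u by auto
qed

locale ZF_model =
  fixes I :: "zf_sym \<Rightarrow> 'a \<Rightarrow> 'a \<Rightarrow> bool"
  assumes ZF: "\<phi> \<in> ZF \<Longrightarrow> sat UNIV I e \<phi>"

instance zf_sym :: countable by countable_datatype

text \<open>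
  The Henkin model lives on a subset of \<open>nat\<close>. Models of ZF being infinite, it can be transported
  along a bijection, so that the carrier is the whole type from here on.
\<close>

lemma ZF_model_existence:
  assumes "ZF \<subseteq> \<Gamma>" "consistent \<Gamma>"
  shows "\<exists>(I :: zf_sym \<Rightarrow> nat \<Rightarrow> nat \<Rightarrow> bool) e. ZF_model I \<and> (\<forall>\<phi>\<in>\<Gamma>. sat UNIV I e \<phi>)"
proof -
  obtain D :: "nat set" and I e where D: "\<And>n. e n \<in> D" and sat: "\<And>\<phi>. \<phi> \<in> \<Gamma> \<Longrightarrow> sat D I e \<phi>"
    using model_existence[OF assms(2)] by blast
  have "infinite D" using ZF_model_infinite[of e D I] D sat assms(1) by blast
  then have f: "bij_betw (enumerate D) UNIV D" by (rule bij_enumerate)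
  let ?J = "\<lambda>p a b. I p (enumerate D a) (enumerate D b)"
  let ?e = "\<lambda>n. inv_into UNIV (enumerate D) (e n)"
  have "enumerate D (?e n) = e n" for n
    using f D by (simp add: bij_betw_def f_inv_into_f)
  then have *: "sat UNIV ?J ?e \<phi>" if "\<phi> \<in> \<Gamma>" for \<phi>
    using sat_iso(2)[OF f, of I ?e \<phi>] sat[OF that] by simp
  have "ZF_model ?J"
  proof
    show "sat UNIV ?J e' \<phi>" if "\<phi> \<in> ZF" for \<phi> e'
      using *[of \<phi>] sat_cong(2)[of \<phi> e' ?e UNIV ?J] ZF_closed[OF that] that assms(1) by auto
  qed
  then show ?thesis using * by blast
qed


lemma case_nat_shift [simp]:
  "(\<lambda>n. case_nat x e (n + numeral k)) = (\<lambda>n. e (n + pred_numeral k))"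
  "(\<lambda>n. case_nat x e (n + 0)) = case_nat x e"
  by (simp_all add: numeral_eq_Suc)

lemma sat_place [simp]:
  "sat D I e (place [V i] d \<phi>) = sat D I (case_nat (e i) (\<lambda>n. e (n + d))) \<phi>"
  "sat D I e (place [V i, V j] d \<phi>) = sat D I (case_nat (e i) (case_nat (e j) (\<lambda>n. e (n + d)))) \<phi>"
  "sat D I e (place [V i, V j, V k, V l] d \<phi>) =
    sat D I (case_nat (e i) (case_nat (e j) (case_nat (e k) (case_nat (e l) (\<lambda>n. e (n + d)))))) \<phi>"
  unfolding place_def
  by (rule eval_subst_sat_subst; simp add: nth_Cons split: nat.split)+

text \<open>Equations are to be decided by computing the values of both sides. The declarations that
  follow keep the simplifier from unfolding descriptions, whose values are supplied by separate
  rules.\<close>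

lemma sat_Eq:
  "eval D I e s = Some a \<Longrightarrow> eval D I e t = Some b \<Longrightarrow> sat D I e (s \<^bold>= t) \<longleftrightarrow> a = b"
  by auto

declare eval_ren_sat_ren [simp] eval.simps(2) [simp del] sat.simps(2) [simp del] sat_Eq [simp]

lemma sat_Exists1 [simp]:
  "sat D I e (\<^bold>\<exists>\<^bold>! \<phi>) \<longleftrightarrow> (\<exists>!x. x \<in> D \<and> sat D I (case_nat x e) \<phi>)"
  unfolding Exists1_def by simp metis

section \<open>The axioms of ZF read in a model\<close>

context ZF_model
begin

abbreviation mem (infix "\<lhd>" 50) where "a \<lhd> b \<equiv> I Mem a b"
abbreviation ev where "ev \<equiv> eval UNIV I"
abbreviation st where "st \<equiv> sat UNIV I"

lemma st_ball [simp]: "ev e t = Some a \<Longrightarrow> st e (ball t \<phi>) \<longleftrightarrow> (\<forall>x. x \<lhd> a \<longrightarrow> st (case_nat x e) \<phi>)"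
  by (simp add: ball_def)

lemma st_bex [simp]: "ev e t = Some a \<Longrightarrow> st e (bex t \<phi>) \<longleftrightarrow> (\<exists>x. x \<lhd> a \<and> st (case_nat x e) \<phi>)"
  by (simp add: bex_def)

lemma ext: "(\<And>z. z \<lhd> x \<longleftrightarrow> z \<lhd> y) \<Longrightarrow> x = y"
  using ZF[of ZF_extensionality undefined] by (simp add: ZF_def ZF_extensionality_def)

lemma foundation: "y \<lhd> x \<Longrightarrow> \<exists>y. y \<lhd> x \<and> (\<forall>z. z \<lhd> y \<longrightarrow> \<not> z \<lhd> x)"
  using ZF[of ZF_foundation undefined] by (simp add: ZF_def ZF_foundation_def) blast

lemma pairing: "\<exists>y. \<forall>z. z \<lhd> y \<longleftrightarrow> z = a \<or> z = b"
  using ZF[of ZF_pairing undefined] by (simp add: ZF_def ZF_pairing_def)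

lemma union: "\<exists>y. \<forall>z. z \<lhd> y \<longleftrightarrow> (\<exists>w. w \<lhd> x \<and> z \<lhd> w)"
  using ZF[of ZF_union undefined] by (simp add: ZF_def ZF_union_def)

lemma power: "\<exists>y. \<forall>z. z \<lhd> y \<longleftrightarrow> (\<forall>w. w \<lhd> z \<longrightarrow> w \<lhd> x)"
  using ZF[of ZF_power undefined] by (simp add: ZF_def ZF_power_def)

lemma infinity:
  "\<exists>y. (\<exists>z. z \<lhd> y \<and> (\<forall>w. \<not> w \<lhd> z)) \<and>
       (\<forall>z. z \<lhd> y \<longrightarrow> (\<exists>s. s \<lhd> y \<and> (\<forall>w. w \<lhd> s \<longleftrightarrow> w \<lhd> z \<or> w = z)))"
  using ZF[of ZF_infinity undefined] by (simp add: ZF_def ZF_infinity_def)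

lemma st_closures: "closures \<phi> \<subseteq> ZF \<Longrightarrow> st e \<phi>"
proof -
  assume *: "closures \<phi> \<subseteq> ZF"
  obtain n where "(Forall ^^ n) \<phi> \<in> closures \<phi>" using closures_nonempty by blast
  with * have "(Forall ^^ n) \<phi> \<in> ZF" by blast
  then show ?thesis using ZF by (blast intro: sat_Forall_funpow)
qed

text \<open>The assignment \<open>e\<close> carries the parameters. Predicates to be separated must
  have this form, so each use writes its predicate as a formula \<open>\<phi>\<close> and stores the
  sets it mentions in \<open>e\<close>.\<close>

lemma separation: "\<exists>y. \<forall>z. z \<lhd> y \<longleftrightarrow> z \<lhd> x \<and> st (case_nat z e) \<phi>"
proof -
  have "closures (ZF_separation \<phi>) \<subseteq> ZF" by (auto simp: ZF_def)
  then have "st e (ZF_separation \<phi>)" by (rule st_closures)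
  then show ?thesis by (simp add: ZF_separation_def)
qed

lemma replacement:
  assumes "\<And>a b c. a \<lhd> x \<Longrightarrow> st (case_nat a (case_nat b e)) \<phi> \<Longrightarrow> st (case_nat a (case_nat c e)) \<phi> \<Longrightarrow> b = c"
  shows "\<exists>y. \<forall>b. b \<lhd> y \<longleftrightarrow> (\<exists>a. a \<lhd> x \<and> st (case_nat a (case_nat b e)) \<phi>)"
proof -
  have "closures (ZF_replacement \<phi>) \<subseteq> ZF" by (auto simp: ZF_def)
  then have "st e (ZF_replacement \<phi>)" by (rule st_closures)
  with assms show ?thesis by (simp add: ZF_replacement_def)
qed

definition the_set :: "('a \<Rightarrow> bool) \<Rightarrow> 'a" where
  "the_set P = (THE y. \<forall>z. z \<lhd> y \<longleftrightarrow> P z)"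

lemma the_set_eq: "(\<And>z. z \<lhd> y \<longleftrightarrow> P z) \<Longrightarrow> the_set P = y"
  unfolding the_set_def by (rule the_equality) (auto intro: ext)

lemma mem_the_set: "\<exists>y. \<forall>z. z \<lhd> y \<longleftrightarrow> P z \<Longrightarrow> z \<lhd> the_set P \<longleftrightarrow> P z"
  using the_set_eq by blast

lemma ev_Desc_set:
  assumes "\<And>x z. st (case_nat z (case_nat x e)) \<phi> \<longleftrightarrow> z \<lhd> y"
  shows "ev e (Desc (\<^bold>\<forall> (V 0 \<^bold>\<in> V 1 \<^bold>\<longleftrightarrow> \<phi>))) = Some y"
  unfolding eval_Desc_iff using assms by (auto intro: ext)


subsection \<open>Basic sets\<close>

definition zero :: 'a where "zero = the_set (\<lambda>z. False)"
definition upair :: "'a \<Rightarrow> 'a \<Rightarrow> 'a" where "upair a b = the_set (\<lambda>z. z = a \<or> z = b)"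
definition sing :: "'a \<Rightarrow> 'a" where "sing a = upair a a"
definition pair :: "'a \<Rightarrow> 'a \<Rightarrow> 'a" where "pair a b = upair (sing a) (upair a b)"
definition one :: 'a where "one = sing zero"
definition bigun :: "'a \<Rightarrow> 'a" where "bigun x = the_set (\<lambda>z. \<exists>w. w \<lhd> x \<and> z \<lhd> w)"
definition un :: "'a \<Rightarrow> 'a \<Rightarrow> 'a" where "un a b = the_set (\<lambda>z. z \<lhd> a \<or> z \<lhd> b)"
definition succ :: "'a \<Rightarrow> 'a" where "succ a = un a (sing a)"
definition sub :: "'a \<Rightarrow> 'a \<Rightarrow> bool" where "sub a b \<longleftrightarrow> (\<forall>z. z \<lhd> a \<longrightarrow> z \<lhd> b)"
definition pow :: "'a \<Rightarrow> 'a" where "pow a = the_set (\<lambda>z. sub z a)"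
definition times :: "'a \<Rightarrow> 'a \<Rightarrow> 'a" where
  "times a b = the_set (\<lambda>z. \<exists>x y. x \<lhd> a \<and> y \<lhd> b \<and> z = pair x y)"

lemma mem_upair [simp]: "z \<lhd> upair a b \<longleftrightarrow> z = a \<or> z = b"
  unfolding upair_def by (rule mem_the_set) (rule pairing)

lemma mem_sing [simp]: "z \<lhd> sing a \<longleftrightarrow> z = a"
  by (simp add: sing_def)

lemma mem_bigun [simp]: "z \<lhd> bigun x \<longleftrightarrow> (\<exists>w. w \<lhd> x \<and> z \<lhd> w)"
  unfolding bigun_def by (subst mem_the_set) (simp_all add: union)

lemma mem_un [simp]: "z \<lhd> un a b \<longleftrightarrow> z \<lhd> a \<or> z \<lhd> b"
  unfolding un_def by (rule mem_the_set, rule exI[of _ "bigun (upair a b)"]) auto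

lemma mem_succ [simp]: "z \<lhd> succ a \<longleftrightarrow> z \<lhd> a \<or> z = a"
  by (simp add: succ_def)

lemma mem_pow [simp]: "z \<lhd> pow a \<longleftrightarrow> sub z a"
  unfolding pow_def sub_def by (rule mem_the_set) (rule power)

lemma mem_zero [simp]: "\<not> z \<lhd> zero"
proof -
  have "\<exists>y. \<forall>z. z \<lhd> y \<longleftrightarrow> False"
    using separation[of undefined undefined "\<^bold>\<not> V 0 \<^bold>= V 0"] by simp
  from mem_the_set[OF this] show ?thesis by (simp add: zero_def)
qed

lemma zero_iff: "x = zero \<longleftrightarrow> (\<forall>z. \<not> z \<lhd> x)"
  using ext[of x zero] by auto

lemma pair_inject [simp]: "pair a b = pair c d \<longleftrightarrow> a = c \<and> b = d"
  by (metis pair_def mem_upair mem_sing)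

lemma one_not_zero [simp]: "one \<noteq> zero" "zero \<noteq> one"
  by (metis mem_sing mem_zero one_def)+

lemma ev_zero [simp]: "ev e zempty = Some zero"
  unfolding zempty_def eval_Desc_iff by (auto simp: zero_iff)

lemma ev_upair [simp]:
  "ev e s = Some a \<Longrightarrow> ev e t = Some b \<Longrightarrow> ev e (zupair s t) = Some (upair a b)"
  unfolding zupair_def by (rule ev_Desc_set) simp

lemma ev_sing [simp]: "ev e s = Some a \<Longrightarrow> ev e (zsing s) = Some (sing a)"
  by (simp add: zsing_def sing_def)

lemma ev_pair [simp]:
  "ev e s = Some a \<Longrightarrow> ev e t = Some b \<Longrightarrow> ev e (zpair s t) = Some (pair a b)"
  by (simp add: zpair_def pair_def)

lemma ev_one [simp]: "ev e zone = Some one"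
  by (simp add: zone_def one_def)

lemma ev_un [simp]:
  "ev e s = Some a \<Longrightarrow> ev e t = Some b \<Longrightarrow> ev e (zun s t) = Some (un a b)"
  unfolding zun_def by (rule ev_Desc_set) simp

lemma ev_succ [simp]: "ev e s = Some a \<Longrightarrow> ev e (zsucc s) = Some (succ a)"
  by (simp add: zsucc_def succ_def)

lemma st_subset [simp]: "ev e s = Some a \<Longrightarrow> ev e t = Some b \<Longrightarrow> st e (s \<^bold>\<subseteq> t) \<longleftrightarrow> sub a b"
  by (simp add: zsubset_def sub_def)

lemma ev_pow [simp]: "ev e s = Some a \<Longrightarrow> ev e (zpow s) = Some (pow a)"
  unfolding zpow_def by (rule ev_Desc_set) simp

lemma mem_times [simp]: "z \<lhd> times a b \<longleftrightarrow> (\<exists>x y. x \<lhd> a \<and> y \<lhd> b \<and> z = pair x y)"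
  unfolding times_def
proof (rule mem_the_set)
  \<comment> \<open>The bound \<open>pow (pow (un a b))\<close> holds all the Kuratowski pairs in
    question, since \<open>sing u\<close> and \<open>upair u v\<close> are subsets of
    \<open>un a b\<close>.\<close>
  obtain y where y: "\<And>z. z \<lhd> y \<longleftrightarrow> z \<lhd> pow (pow (un a b)) \<and> (\<exists>u v. u \<lhd> a \<and> v \<lhd> b \<and> z = pair u v)"
    using separation[of "pow (pow (un a b))" "case_nat a (\<lambda>_. b)" "bex (V 1) (bex (V 3) (V 2 \<^bold>= zpair (V 1) (V 0)))"]
    by (auto simp del: mem_pow)
  have "pair u v \<lhd> pow (pow (un a b))" if "u \<lhd> a" "v \<lhd> b" for u v
    using that by (auto simp: sub_def pair_def)
  then show "\<exists>y. \<forall>z. z \<lhd> y \<longleftrightarrow> (\<exists>u v. u \<lhd> a \<and> v \<lhd> b \<and> z = pair u v)"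
    using y by blast
qed

lemma ev_times [simp]:
  "ev e s = Some a \<Longrightarrow> ev e t = Some b \<Longrightarrow> ev e (ztimes s t) = Some (times a b)"
  unfolding ztimes_def by (rule ev_Desc_set) auto

definition step :: "'a \<Rightarrow> 'a" where
  "step w = un (times (sing zero) (pow w)) (times (sing one) (times w w))"

lemma mem_step:
  "x \<lhd> step w \<longleftrightarrow> (\<exists>y. sub y w \<and> x = pair zero y) \<or> (\<exists>u v. u \<lhd> w \<and> v \<lhd> w \<and> x = pair one (pair u v))"
  by (auto simp: step_def)

lemma ev_step [simp]: "ev e s = Some a \<Longrightarrow> ev e (zstep s) = Some (step a)"
  by (simp add: zstep_def step_def)


subsection \<open>Ordinals\<close>

lemma mem_irrefl [simp]: "\<not> x \<lhd> x"
  using foundation[of x "sing x"] by auto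

lemma mem_asym: "x \<lhd> y \<Longrightarrow> \<not> y \<lhd> x"
  using foundation[of x "upair x y"] by auto

lemma mem_no_3_cycle: "x \<lhd> y \<Longrightarrow> y \<lhd> z \<Longrightarrow> \<not> z \<lhd> x"
  using foundation[of x "un (upair x y) (sing z)"] by auto

definition ord :: "'a \<Rightarrow> bool" where
  "ord a \<longleftrightarrow> (\<forall>x. x \<lhd> a \<longrightarrow> sub x a) \<and> (\<forall>x y. x \<lhd> a \<longrightarrow> y \<lhd> a \<longrightarrow> x \<lhd> y \<or> x = y \<or> y \<lhd> x)"

text \<open>Foundation bridges the two notions: excluding membership cycles of length one, two and
  three gives irreflexivity and transitivity, and a minimal element of a subset is its least one
  because elements are comparable.\<close>

lemma st_ord [simp]:
  assumes "ev e t = Some a"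
  shows "st e (zord t) \<longleftrightarrow> ord a"
proof -
  have "st e (zord t) \<longleftrightarrow>
    (\<forall>x. x \<lhd> a \<longrightarrow> sub x a) \<and> (\<forall>x. x \<lhd> a \<longrightarrow> \<not> x \<lhd> x) \<and>
    (\<forall>x. x \<lhd> a \<longrightarrow> (\<forall>y. y \<lhd> a \<longrightarrow> (\<forall>z. z \<lhd> a \<longrightarrow> x \<lhd> y \<and> y \<lhd> z \<longrightarrow> x \<lhd> z))) \<and>
    (\<forall>x. x \<lhd> a \<longrightarrow> (\<forall>y. y \<lhd> a \<longrightarrow> x \<lhd> y \<or> x = y \<or> y \<lhd> x)) \<and>
    (\<forall>s. sub s a \<and> (\<exists>x. x \<lhd> s) \<longrightarrow> (\<exists>m. m \<lhd> s \<and> (\<forall>x. x \<lhd> s \<longrightarrow> m = x \<or> m \<lhd> x)))"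
    using assms by (simp add: zord_def)
  also have "\<dots> \<longleftrightarrow> ord a" (is "?R \<longleftrightarrow> _")
  proof
    assume a: "ord a"
    have "x \<lhd> z" if "x \<lhd> a" "y \<lhd> a" "z \<lhd> a" "x \<lhd> y" "y \<lhd> z" for x y z
      using a that mem_asym mem_no_3_cycle unfolding ord_def by blast
    then have r: "\<forall>x. x \<lhd> a \<longrightarrow> (\<forall>y. y \<lhd> a \<longrightarrow> (\<forall>z. z \<lhd> a \<longrightarrow> x \<lhd> y \<and> y \<lhd> z \<longrightarrow> x \<lhd> z))"
      by blast
    have "\<exists>m. m \<lhd> s \<and> (\<forall>x. x \<lhd> s \<longrightarrow> m = x \<or> m \<lhd> x)" if s: "sub s a" and y: "y \<lhd> s" for s y
    proof -
      obtain m where m: "m \<lhd> s" "\<forall>w. w \<lhd> m \<longrightarrow> \<not> w \<lhd> s" using foundation[OF y] by blast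
      then show ?thesis using a s unfolding ord_def sub_def by metis
    qed
    then have r': "\<forall>s. sub s a \<and> (\<exists>x. x \<lhd> s) \<longrightarrow> (\<exists>m. m \<lhd> s \<and> (\<forall>x. x \<lhd> s \<longrightarrow> m = x \<or> m \<lhd> x))"
      by blast
    have "\<forall>x. x \<lhd> a \<longrightarrow> sub x a"
      "\<forall>x. x \<lhd> a \<longrightarrow> (\<forall>y. y \<lhd> a \<longrightarrow> x \<lhd> y \<or> x = y \<or> y \<lhd> x)"
      using a by (simp_all add: ord_def)
    then show ?R using mem_irrefl by (intro conjI r r') simp_all
  qed (unfold ord_def, blast)
  finally show ?thesis .
qed

lemma ord_trans: "ord a \<Longrightarrow> b \<lhd> a \<Longrightarrow> c \<lhd> b \<Longrightarrow> c \<lhd> a"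
  by (auto simp: ord_def sub_def)

lemma ord_mem:
  assumes "ord a" "b \<lhd> a"
  shows "ord b"
proof -
  have *: "c \<lhd> a" if "c \<lhd> b" for c using ord_trans[OF assms that] .
  have "sub c b" if c: "c \<lhd> b" for c
    unfolding sub_def
  proof (intro HOL.allI HOL.impI)
    fix d assume d: "d \<lhd> c"
    then have "d \<lhd> a" using ord_trans[OF assms(1)] * c by blast
    then have "d \<lhd> b \<or> d = b \<or> b \<lhd> d" using assms by (simp add: ord_def)
    then show "d \<lhd> b" using mem_asym[OF c] mem_no_3_cycle[OF d c] d by blast
  qed
  then show ?thesis using * assms(1) by (simp add: ord_def)
qed

lemma ord_zero [simp]: "ord zero"
  by (simp add: ord_def)

lemma ord_succ: "ord a \<Longrightarrow> ord (succ a)"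
  by (auto simp: ord_def sub_def)

text \<open>If \<open>c\<close> is not \<open>a\<close>, a minimal element \<open>m\<close> of the
  difference equals \<open>c\<close>. Its elements lie in \<open>c\<close> by minimality; an element
  \<open>z\<close> of \<open>c\<close> is comparable with \<open>m\<close>, and \<open>z = m\<close>
  or \<open>m\<close> in \<open>z\<close> would put \<open>m\<close> into the transitive set
  \<open>c\<close>.\<close>

lemma transitive_subset_ord:
  assumes "ord a" "sub c a" "\<And>x y. x \<lhd> c \<Longrightarrow> y \<lhd> x \<Longrightarrow> y \<lhd> c"
  shows "c = a \<or> c \<lhd> a"
proof (rule ccontr)
  assume *: "\<not> ?thesis"
  obtain d where d: "\<And>z. z \<lhd> d \<longleftrightarrow> z \<lhd> a \<and> \<not> z \<lhd> c"
    using separation[of a "\<lambda>_. c" "\<^bold>\<not> V 0 \<^bold>\<in> V 1"] by auto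
  have "\<exists>z. z \<lhd> d" using * assms(2) d ext[of c a] by (auto simp: sub_def)
  then obtain m where m: "m \<lhd> d" "\<forall>w. w \<lhd> m \<longrightarrow> \<not> w \<lhd> d" using foundation by blast
  have "m = c"
  proof (rule ext)
    fix z
    have ma: "m \<lhd> a" "\<not> m \<lhd> c" using m(1) d by auto
    show "z \<lhd> m \<longleftrightarrow> z \<lhd> c"
    proof
      assume "z \<lhd> m"
      then have "z \<lhd> a" "\<not> z \<lhd> d" using ma(1) m(2) assms(1) unfolding ord_def sub_def by blast+
      then show "z \<lhd> c" using d by blast
    next
      assume z: "z \<lhd> c"
      then have "z \<lhd> a" using assms(2) by (simp add: sub_def)
      then have "z \<lhd> m \<or> z = m \<or> m \<lhd> z" using ma(1) assms(1) by (simp add: ord_def)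
      then show "z \<lhd> m" using z ma(2) assms(3) by blast
    qed
  qed
  then show False using * m d by blast
qed

lemma ord_linear:
  assumes "ord a" "ord b"
  shows "a \<lhd> b \<or> a = b \<or> b \<lhd> a"
proof -
  \<comment> \<open>The intersection is a transitive subset of both ordinals. Were it a member of
    both, it would be a member of itself.\<close>
  obtain c where c: "\<And>z. z \<lhd> c \<longleftrightarrow> z \<lhd> a \<and> z \<lhd> b"
    using separation[of a "\<lambda>_. b" "V 0 \<^bold>\<in> V 1"] by auto
  have "c = a \<or> c \<lhd> a" "c = b \<or> c \<lhd> b"
    by (rule transitive_subset_ord; use assms c in \<open>auto simp: sub_def dest: ord_trans\<close>)+
  then show ?thesis using c[of c] c[of a] c[of b] by auto
qed

lemma ord_bigun:
  assumes "\<And>x. x \<lhd> s \<Longrightarrow> ord x"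
  shows "ord (bigun s)"
  unfolding ord_def[of "bigun s"]
proof (intro conjI HOL.allI HOL.impI)
  fix x assume "x \<lhd> bigun s"
  then obtain a where "a \<lhd> s" "x \<lhd> a" by auto
  then show "sub x (bigun s)" using ord_trans[OF assms] unfolding sub_def mem_bigun by blast
next
  fix x y assume "x \<lhd> bigun s" "y \<lhd> bigun s"
  then have "ord x" "ord y" using ord_mem assms by auto
  then show "x \<lhd> y \<or> x = y \<or> y \<lhd> x" by (rule ord_linear)
qed

lemma ord_sub: "ord a \<Longrightarrow> ord b \<Longrightarrow> sub b a \<Longrightarrow> b = a \<or> b \<lhd> a"
  using transitive_subset_ord ord_trans by blast

lemma ord_succ_mem:
  assumes "ord a" "b \<lhd> a"
  shows "succ b = a \<or> succ b \<lhd> a"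
proof (rule ord_sub)
  show "sub (succ b) a" using assms ord_trans[OF assms(1)] by (auto simp: sub_def)
qed (use assms ord_succ ord_mem in blast)+

lemma succ_inject [simp]: "succ a = succ b \<longleftrightarrow> a = b"
  by (metis mem_asym mem_succ)

text \<open>The ordinals of the model may be ill-founded from outside, so induction is available for
  predicates given by a formula: these can be separated, and foundation yields a least
  counterexample.\<close>

lemma ord_induct [consumes 1]:
  assumes "ord a" and step: "\<And>a. ord a \<Longrightarrow> (\<And>b. b \<lhd> a \<Longrightarrow> st (case_nat b e) \<phi>) \<Longrightarrow> st (case_nat a e) \<phi>"
  shows "st (case_nat a e) \<phi>"
proof (rule ccontr)
  assume *: "\<not> ?thesis"
  \<comment> \<open>Counterexamples are sought in \<open>succ a\<close>, so that \<open>a\<close>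
    itself is among them.\<close>
  obtain d where d: "\<And>z. z \<lhd> d \<longleftrightarrow> z \<lhd> succ a \<and> \<not> st (case_nat z e) \<phi>"
    using separation[of "succ a" e "\<^bold>\<not> \<phi>"] by auto
  with * have "a \<lhd> d" by simp
  then obtain m where m: "m \<lhd> d" "\<forall>w. w \<lhd> m \<longrightarrow> \<not> w \<lhd> d" using foundation by blast
  have "ord m" using m d assms(1) ord_mem by auto
  moreover have "st (case_nat b e) \<phi>" if "b \<lhd> m" for b
  proof -
    have "b \<lhd> succ a" using m(1) d that ord_trans[OF ord_succ[OF assms(1)]] by blast
    then show ?thesis using m(2) d that by blast
  qed
  ultimately have "st (case_nat m e) \<phi>" by (rule step)
  then show False using m d by blast
qed

lemma ord_least:
  assumes "ord a" "st (case_nat a e) \<phi>"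
  shows "\<exists>m. ord m \<and> st (case_nat m e) \<phi> \<and> (\<forall>b. b \<lhd> m \<longrightarrow> \<not> st (case_nat b e) \<phi>)"
  using ord_induct[OF assms(1), of e "\<^bold>\<not> \<phi>"] assms(2) by (metis sat.simps(3))

definition limit :: "'a \<Rightarrow> bool" where
  "limit a \<longleftrightarrow> ord a \<and> a \<noteq> zero \<and> (\<nexists>c. a = succ c)"

lemma st_limit [simp]: "ev e t = Some a \<Longrightarrow> st e (zlimit t) \<longleftrightarrow> limit a"
  by (simp add: zlimit_def limit_def)


subsection \<open>The recursion defining the hierarchy\<close>

text \<open>Existence of the set is not presupposed. This fits \<open>zUnion_app\<close> in the
  limit clause, where the equation itself asserts that the union is the value of
  \<open>f\<close>.\<close>

lemma ev_Desc_set_iff: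
  assumes "\<And>x z. st (case_nat z (case_nat x e)) \<phi> \<longleftrightarrow> P z"
  shows "ev e (Desc (\<^bold>\<forall> (V 0 \<^bold>\<in> V 1 \<^bold>\<longleftrightarrow> \<phi>))) = Some y \<longleftrightarrow> (\<forall>z. z \<lhd> y \<longleftrightarrow> P z)"
proof
  assume "ev e (Desc (\<^bold>\<forall> (V 0 \<^bold>\<in> V 1 \<^bold>\<longleftrightarrow> \<phi>))) = Some y"
  then have "st (case_nat y e) (\<^bold>\<forall> (V 0 \<^bold>\<in> V 1 \<^bold>\<longleftrightarrow> \<phi>))" unfolding eval_Desc_iff by blast
  then show "\<forall>z. z \<lhd> y \<longleftrightarrow> P z" using assms by simp
next
  assume "\<forall>z. z \<lhd> y \<longleftrightarrow> P z"
  then show "ev e (Desc (\<^bold>\<forall> (V 0 \<^bold>\<in> V 1 \<^bold>\<longleftrightarrow> \<phi>))) = Some y"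
    using assms by (intro ev_Desc_set) simp
qed

definition fn :: "'a \<Rightarrow> 'a \<Rightarrow> bool" where
  "fn f d \<longleftrightarrow> (\<forall>z. z \<lhd> f \<longrightarrow> (\<exists>x. x \<lhd> d \<and> (\<exists>y. z = pair x y))) \<and>
     (\<forall>x. x \<lhd> d \<longrightarrow> (\<exists>!y. pair x y \<lhd> f))"

definition app :: "'a \<Rightarrow> 'a \<Rightarrow> 'a" where "app f x = (THE y. pair x y \<lhd> f)"

lemma app_eq: "\<exists>!y. pair x y \<lhd> f \<Longrightarrow> pair x y \<lhd> f \<Longrightarrow> app f x = y"
  unfolding app_def by (rule the1_equality)

lemma ev_app:
  assumes "ev e s = Some f" "ev e t = Some x" "\<exists>!y. pair x y \<lhd> f"
  shows "ev e (zapp s t) = Some (app f x)"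
proof -
  have "st (case_nat y e) (zpair (t \<up> 1) (V 0) \<^bold>\<in> s \<up> 1) \<longleftrightarrow> pair x y \<lhd> f" for y
    using assms(1,2) by simp
  moreover have "pair x y \<lhd> f \<longleftrightarrow> y = app f x" for y
    using assms(3) app_eq[OF assms(3)] by blast
  ultimately show ?thesis unfolding zapp_def eval_Desc_iff by simp
qed

lemma st_fn [simp]: "ev e s = Some f \<Longrightarrow> ev e t = Some d \<Longrightarrow> st e (zfunction s t) \<longleftrightarrow> fn f d"
  by (simp add: zfunction_def fn_def)

text \<open>The limit clause speaks of members, so no union has to be formed in order to state
  it.\<close>

definition rec_at :: "'a \<Rightarrow> 'a \<Rightarrow> bool" where
  "rec_at f b \<longleftrightarrow> (b = zero \<longrightarrow> app f b = zero) \<and> (\<forall>c. b = succ c \<longrightarrow> app f b = step (app f c)) \<and>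
     (limit b \<longrightarrow> (\<forall>z. z \<lhd> app f b \<longleftrightarrow> (\<exists>c. c \<lhd> b \<and> z \<lhd> app f c)))"

definition recur :: "'a \<Rightarrow> 'a \<Rightarrow> bool" where
  "recur f a \<longleftrightarrow> fn f (succ a) \<and> (\<forall>b. b \<lhd> succ a \<longrightarrow> rec_at f b)"

text \<open>If \<open>f\<close> is not a function on \<open>succ a\<close>, both sides fail at their
  first conjunct. Otherwise all applications at elements of \<open>succ a\<close> denote and the
  clauses can be evaluated one by one; that \<open>a\<close> is an ordinal keeps the smaller
  arguments inside the domain.\<close>

lemma st_rec [simp]:
  assumes s: "ev e s = Some f" and t: "ev e t = Some a" and a: "ord a"
  shows "st e (zrec s t) \<longleftrightarrow> recur f a"
proof (cases "fn f (succ a)")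
  case True
  have app: "ev e' (zapp s' t') = Some (app f b)"
    if "ev e' s' = Some f" "ev e' t' = Some b" "b \<lhd> succ a" for e' s' t' b
    using that(1,2) True that(3) unfolding fn_def by (intro ev_app) blast+
  have mem: "c \<lhd> succ a" if "b \<lhd> succ a" "c \<lhd> b" for b c
    using ord_trans[OF ord_succ[OF a] that] .
  have "st (case_nat b e) ((V 0 \<^bold>= zempty \<^bold>\<longrightarrow> zapp (s \<up> 1) (V 0) \<^bold>= zempty) \<^bold>\<and>
         (\<^bold>\<forall> (V 1 \<^bold>= zsucc (V 0) \<^bold>\<longrightarrow> zapp (s \<up> 2) (V 1) \<^bold>= zstep (zapp (s \<up> 2) (V 0)))) \<^bold>\<and>
         (zlimit (V 0) \<^bold>\<longrightarrow> zapp (s \<up> 1) (V 0) \<^bold>= zUnion_app (V 0) (s \<up> 1))) \<longleftrightarrow> rec_at f b"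
    if b: "b \<lhd> succ a" for b
  proof -
    have *: "st (case_nat z (case_nat y (case_nat b e))) (bex (V 0 \<up> 2) (V 1 \<^bold>\<in> zapp (s \<up> 1 \<up> 3) (V 0))) \<longleftrightarrow>
        (\<exists>c. c \<lhd> b \<and> z \<lhd> app f c)" for y z
    proof -
      have "st (case_nat c (case_nat z (case_nat y (case_nat b e)))) (V 1 \<^bold>\<in> zapp (s \<up> 1 \<up> 3) (V 0)) \<longleftrightarrow>
          z \<lhd> app f c" if "c \<lhd> b" for c
        using app[of "case_nat c (case_nat z (case_nat y (case_nat b e)))" "s \<up> 1 \<up> 3" "V 0" c] mem[OF b that]
        by (simp add: s del: mem_succ)
      moreover have "ev (case_nat z (case_nat y (case_nat b e))) (V 0 \<up> 2) = Some b" by simp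
      ultimately show ?thesis unfolding st_bex[OF \<open>ev _ (V 0 \<up> 2) = Some b\<close>] by blast
    qed
    have "st (case_nat b e) (zapp (s \<up> 1) (V 0) \<^bold>= zUnion_app (V 0) (s \<up> 1)) \<longleftrightarrow>
        ev (case_nat b e) (zUnion_app (V 0) (s \<up> 1)) = Some (app f b)"
      using app[of "case_nat b e" "s \<up> 1" "V 0" b] b by (simp add: s sat.simps(2))
    also have "\<dots> \<longleftrightarrow> (\<forall>z. z \<lhd> app f b \<longleftrightarrow> (\<exists>c. c \<lhd> b \<and> z \<lhd> app f c))"
      unfolding zUnion_app_def by (rule ev_Desc_set_iff) (rule *)
    finally have 1: "st (case_nat b e) (zapp (s \<up> 1) (V 0) \<^bold>= zUnion_app (V 0) (s \<up> 1)) \<longleftrightarrow>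
      (\<forall>z. z \<lhd> app f b \<longleftrightarrow> (\<exists>c. c \<lhd> b \<and> z \<lhd> app f c))" .
    have 2: "st (case_nat c (case_nat b e)) (V 1 \<^bold>= zsucc (V 0) \<^bold>\<longrightarrow>
      zapp (s \<up> 2) (V 1) \<^bold>= zstep (zapp (s \<up> 2) (V 0))) \<longleftrightarrow> (b = succ c \<longrightarrow> app f b = step (app f c))" for c
    \<comment> \<open>When \<open>b\<close> is not \<open>succ c\<close>, the element
      \<open>c\<close> is arbitrary and \<open>zapp\<close> need not denote there; the implication
      then holds by its false premise.\<close>
    proof (cases "b = succ c")
      case True
      then have "c \<lhd> succ a" using mem[OF b] by simp
      then have "ev (case_nat c (case_nat b e)) (zapp (s \<up> 2) (V 0)) = Some (app f c)"
        "ev (case_nat c (case_nat b e)) (zapp (s \<up> 2) (V 1)) = Some (app f b)"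
        using b by (simp_all add: app s del: mem_succ)
      then have "st (case_nat c (case_nat b e)) (zapp (s \<up> 2) (V 1) \<^bold>= zstep (zapp (s \<up> 2) (V 0))) \<longleftrightarrow>
          app f b = step (app f c)" by (intro sat_Eq ev_step)
      moreover have "st (case_nat c (case_nat b e)) (V 1 \<^bold>= zsucc (V 0)) \<longleftrightarrow> b = succ c" by simp
      ultimately show ?thesis unfolding sat.simps(4) by blast
    qed simp
    have 3: "st (case_nat b e) (V 0 \<^bold>= zempty \<^bold>\<longrightarrow> zapp (s \<up> 1) (V 0) \<^bold>= zempty) \<longleftrightarrow>
      (b = zero \<longrightarrow> app f b = zero)"
    proof -
      have "ev (case_nat b e) (zapp (s \<up> 1) (V 0)) = Some (app f b)"
        using b by (simp add: s app del: mem_succ)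
      then have "st (case_nat b e) (zapp (s \<up> 1) (V 0) \<^bold>= zempty) \<longleftrightarrow> app f b = zero" by simp
      moreover have "st (case_nat b e) (V 0 \<^bold>= zempty) \<longleftrightarrow> b = zero" by simp
      ultimately show ?thesis unfolding sat.simps(4) by blast
    qed
    have 4: "st (case_nat b e) (zlimit (V 0)) \<longleftrightarrow> limit b" by simp
    have "st (case_nat b e) (\<^bold>\<forall> (V 1 \<^bold>= zsucc (V 0) \<^bold>\<longrightarrow>
      zapp (s \<up> 2) (V 1) \<^bold>= zstep (zapp (s \<up> 2) (V 0)))) \<longleftrightarrow> (\<forall>c. b = succ c \<longrightarrow> app f b = step (app f c))"
      unfolding sat.simps(5)[of _ _ _ "_ \<^bold>\<longrightarrow> _"] 2 by blast
    then show ?thesis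
      unfolding rec_at_def sat_connectives(1) 3 sat.simps(4)[of _ _ _ "zlimit _"] 1 4 by blast
  qed
  then show ?thesis
    unfolding zrec_def recur_def sat_connectives(1)[of _ _ _ "zfunction _ _"] st_fn[OF s ev_succ[OF t]] st_ball[OF ev_succ[OF t]]
    by blast
next
  case False
  then show ?thesis
    unfolding zrec_def recur_def sat_connectives(1)[of _ _ _ "zfunction _ _"] st_fn[OF s ev_succ[OF t]]
    by blast
qed

lemma ord_cases:
  assumes "ord a" obtains "a = zero" | c where "a = succ c" "ord c" | "limit a"
  using assms ord_mem[of a] by (auto simp: limit_def)

lemma succ_neq_zero [simp]: "succ a \<noteq> zero" "zero \<noteq> succ a"
  by (metis mem_succ mem_zero)+

lemma fn_app: "fn f d \<Longrightarrow> x \<lhd> d \<Longrightarrow> \<exists>!y. pair x y \<lhd> f"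
  unfolding fn_def by blast

lemma ev_app_fn:
  "ev e s = Some f \<Longrightarrow> ev e t = Some x \<Longrightarrow> fn f d \<Longrightarrow> x \<lhd> d \<Longrightarrow> ev e (zapp s t) = Some (app f x)"
  by (rule ev_app) (assumption | rule fn_app)+

lemma rec_at_cong:
  assumes "rec_at f b" "\<And>c. c \<lhd> succ b \<Longrightarrow> app f c = app g c"
  shows "rec_at g b"
proof -
  have "app g c = app f c" if "c \<lhd> b \<or> c = b" for c using assms(2)[of c] that by auto
  then show ?thesis using assms(1) unfolding rec_at_def by auto
qed

lemma rec_at_unique:
  assumes "ord b" "rec_at f b" "rec_at g b" "\<And>c. c \<lhd> b \<Longrightarrow> app f c = app g c"
  shows "app f b = app g b"
  using assms(1)
proof (cases rule: ord_cases)
  case 1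
  then show ?thesis using assms(2,3) by (simp add: rec_at_def)
next
  case (2 c)
  then have "app f c = app g c" using assms(4) by simp
  with 2 show ?thesis using assms(2,3) by (simp add: rec_at_def)
next
  case 3
  then have "z \<lhd> app f b \<longleftrightarrow> (\<exists>c. c \<lhd> b \<and> z \<lhd> app f c)" "z \<lhd> app g b \<longleftrightarrow> (\<exists>c. c \<lhd> b \<and> z \<lhd> app g c)" for z
    using assms(2,3) unfolding rec_at_def by blast+
  then have "z \<lhd> app f b \<longleftrightarrow> z \<lhd> app g b" for z
    using assms(4) by (simp cong: conj_cong)
  then show ?thesis by (rule ext)
qed

text \<open>The lengths \<open>a\<close> and \<open>a'\<close> may differ: \<open>W b\<close> comes
  from a solution of length \<open>b\<close>, and it has to agree with the value at \<open>b\<close>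
  of every longer solution.\<close>

lemma recur_unique:
  assumes f: "recur f a" "ord a" "b \<lhd> succ a" and g: "recur g a'" "ord a'" "b \<lhd> succ a'"
  shows "app f b = app g b"
proof -
  \<comment> \<open>The claim as a formula, in the form required by \<open>ord_induct\<close>;
    \<open>V 1\<close> to \<open>V 4\<close> stand for \<open>f\<close>, \<open>a\<close>,
    \<open>g\<close> and \<open>a'\<close>.\<close>
  let ?\<phi> = "V 0 \<^bold>\<in> zsucc (V 2) \<^bold>\<longrightarrow> V 0 \<^bold>\<in> zsucc (V 4) \<^bold>\<longrightarrow> zapp (V 1) (V 0) \<^bold>= zapp (V 3) (V 0)"
  let ?e = "case_nat f (case_nat a (case_nat g (\<lambda>_. a')))"
  have st: "st (case_nat b ?e) ?\<phi> \<longleftrightarrow> (b \<lhd> succ a \<longrightarrow> b \<lhd> succ a' \<longrightarrow> app f b = app g b)" for b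
  proof (cases "b \<lhd> succ a \<and> b \<lhd> succ a'")
    case True
    then have "ev (case_nat b ?e) (zapp (V 1) (V 0)) = Some (app f b)"
      "ev (case_nat b ?e) (zapp (V 3) (V 0)) = Some (app g b)"
      using f(1) g(1) by (auto simp: recur_def intro!: ev_app_fn simp del: mem_succ)
    then have "st (case_nat b ?e) (zapp (V 1) (V 0) \<^bold>= zapp (V 3) (V 0)) \<longleftrightarrow> app f b = app g b"
      by (rule sat_Eq)
    then show ?thesis using True by (simp only: sat.simps(4)) simp
  next
    case False
    then show ?thesis by auto
  qed
  have "st (case_nat b ?e) ?\<phi>"
  proof (rule ord_induct)
    show "ord b" using f(2,3) ord_mem ord_succ by blast
    show "st (case_nat b ?e) ?\<phi>" if b: "ord b" and IH: "\<And>c. c \<lhd> b \<Longrightarrow> st (case_nat c ?e) ?\<phi>" for b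
      unfolding st
    proof (intro HOL.impI)
      assume *: "b \<lhd> succ a" "b \<lhd> succ a'"
      show "app f b = app g b"
      proof (rule rec_at_unique[OF b])
        show "rec_at f b" "rec_at g b" using * f(1) g(1) unfolding recur_def by blast+
        show "app f c = app g c" if "c \<lhd> b" for c
          using IH[OF that] ord_trans[OF ord_succ[OF f(2)] *(1) that] ord_trans[OF ord_succ[OF g(2)] *(2) that]
          unfolding st by blast
      qed
    qed
  qed
  then show ?thesis using f g unfolding st by blast
qed

definition W :: "'a \<Rightarrow> 'a" where "W a = (THE y. \<exists>f. recur f a \<and> y = app f a)"

lemma recur_app_self: "recur f a \<Longrightarrow> ord a \<Longrightarrow> app f a = W a"
  unfolding W_def by (rule the_equality[symmetric]) (auto intro: recur_unique)

lemma recur_app: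
  assumes "recur f a" "ord a" "b \<lhd> succ a" "recur g b"
  shows "app f b = W b"
proof -
  have "ord b" using assms ord_mem ord_succ by blast
  then show ?thesis using recur_unique[OF assms(1-4)] recur_app_self[OF assms(4)] by simp
qed

text \<open>The proof that solutions exist evaluates \<open>zW\<close> at smaller ordinals, so
  existence of a solution at \<open>a\<close> enters here as a hypothesis.\<close>

lemma ev_W_recur:
  assumes t: "ev e t = Some a" and a: "ord a" and f: "recur f a"
  shows "ev e (zW t) = Some (W a)"
proof -
  have "st (case_nat g (case_nat y e)) (V 1 \<^bold>= zapp (V 0) (t \<up> 2)) \<longleftrightarrow> y = app g a" if "recur g a" for g y
  proof (rule sat_Eq)
    show "ev (case_nat g (case_nat y e)) (zapp (V 0) (t \<up> 2)) = Some (app g a)"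
      using that t by (intro ev_app_fn[where d = "succ a"]) (auto simp: recur_def)
  qed simp
  moreover have "st (case_nat g (case_nat y e)) (zrec (V 0) (t \<up> 2)) \<longleftrightarrow> recur g a" for g y
    using t a by simp
  ultimately have "st (case_nat y e) (\<^bold>\<exists> (zrec (V 0) (t \<up> 2) \<^bold>\<and> V 1 \<^bold>= zapp (V 0) (t \<up> 2))) \<longleftrightarrow>
      (\<exists>g. recur g a \<and> y = app g a)" for y
    unfolding sat_connectives by blast
  moreover have "(\<exists>g. recur g a \<and> y = app g a) \<longleftrightarrow> y = W a" for y
    using f recur_app_self[OF _ a] by metis
  ultimately show ?thesis unfolding zW_def eval_Desc_iff by simp
qed

text \<open>By uniqueness the shorter solutions agree with the values \<open>W b\<close>, and
  \<open>zW\<close> expresses these by a formula. Replacement therefore yields the graph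
  \<open>F\<close> and the range \<open>R\<close> of \<open>W\<close> below \<open>a\<close>. A
  value \<open>v\<close> at \<open>a\<close> is read off from the clause that applies, the union of
  \<open>R\<close> at a limit, and one further pair extends \<open>F\<close> to a solution.\<close>

lemma recur_step:
  assumes a: "ord a" and IH: "\<And>b. b \<lhd> a \<Longrightarrow> \<exists>f. recur f b"
  shows "\<exists>f. recur f a"
proof -
  have W: "ev e (zW t) = Some (W b)" if "ev e t = Some b" "b \<lhd> a" for e t b
    using ev_W_recur[OF that(1) ord_mem[OF a that(2)]] IH[OF that(2)] by blast
  have "\<exists>F. \<forall>z. z \<lhd> F \<longleftrightarrow> (\<exists>b. b \<lhd> a \<and> st (case_nat b (case_nat z (\<lambda>_. a))) (V 1 \<^bold>= zpair (V 0) (zW (V 0))))"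
    by (rule replacement) (simp add: W)
  then obtain F where F: "\<And>z. z \<lhd> F \<longleftrightarrow> (\<exists>b. b \<lhd> a \<and> z = pair b (W b))"
    by (auto simp: W cong: conj_cong)
  have "\<exists>R. \<forall>z. z \<lhd> R \<longleftrightarrow> (\<exists>b. b \<lhd> a \<and> st (case_nat b (case_nat z (\<lambda>_. a))) (V 1 \<^bold>= zW (V 0)))"
    by (rule replacement) (simp add: W)
  then obtain R where R: "\<And>z. z \<lhd> R \<longleftrightarrow> (\<exists>b. b \<lhd> a \<and> z = W b)"
    by (auto simp: W cong: conj_cong)
  obtain v where v: "a = zero \<longrightarrow> v = zero" "\<forall>c. a = succ c \<longrightarrow> v = step (W c)"
    "limit a \<longrightarrow> (\<forall>z. z \<lhd> v \<longleftrightarrow> (\<exists>c. c \<lhd> a \<and> z \<lhd> W c))"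
    using a
  proof (cases rule: ord_cases)
    case 1
    then show ?thesis by (intro that[of zero]) (auto simp: limit_def)
  next
    case (2 c)
    then show ?thesis by (intro that[of "step (W c)"]) (auto simp: limit_def)
  next
    case 3
    then show ?thesis by (intro that[of "bigun R"]) (auto simp: limit_def R)
  qed
  define G where "G = un F (sing (pair a v))"
  have G: "pair b y \<lhd> G \<longleftrightarrow> (b \<lhd> a \<and> y = W b) \<or> (b = a \<and> y = v)" for b y
    by (auto simp: G_def F)
  have fn: "fn G (succ a)"
    unfolding fn_def
  proof (intro conjI HOL.allI HOL.impI)
    show "\<exists>x. x \<lhd> succ a \<and> (\<exists>y. z = pair x y)" if "z \<lhd> G" for z
      using that by (auto simp: G_def F)
    show "\<exists>!y. pair x y \<lhd> G" if "x \<lhd> succ a" for x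
      using that unfolding G by (cases "x = a") auto
  qed
  have appW: "app G b = W b" if "b \<lhd> a" for b
    by (rule app_eq[OF fn_app[OF fn]]) (use that in \<open>auto simp: G\<close>)
  have appv: "app G a = v"
    by (rule app_eq[OF fn_app[OF fn]]) (auto simp: G)
  have "rec_at G b" if "b \<lhd> succ a" for b
  proof (cases "b = a")
    case True
    have "app G c = W c" if "a = succ c" for c using that by (intro appW) simp
    then show ?thesis unfolding rec_at_def True appv using v appW by (auto cong: conj_cong)
  next
    case False
    then have b: "b \<lhd> a" using that by simp
    then have ob: "ord b" using a ord_mem by blast
    obtain f where f: "recur f b" using IH[OF b] by blast
    have "rec_at f b" using f by (simp add: recur_def)
    moreover have "app f c = app G c" if "c \<lhd> succ b" for c
    proof -
      have c: "c \<lhd> a" using b that ord_trans[OF a b] by auto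
      then obtain g where "recur g c" using IH by blast
      then show ?thesis using recur_app[OF f ob that] appW[OF c] by simp
    qed
    ultimately show ?thesis by (rule rec_at_cong)
  qed
  then show ?thesis using fn unfolding recur_def by blast
qed

lemma recur_exists:
  assumes "ord a"
  shows "\<exists>f. recur f a"
proof -
  have st: "ord b \<Longrightarrow> st (case_nat b (\<lambda>_. a)) (\<^bold>\<exists> zrec (V 0) (V 1)) \<longleftrightarrow> (\<exists>f. recur f b)" for b by simp
  have "st (case_nat a (\<lambda>_. a)) (\<^bold>\<exists> zrec (V 0) (V 1))"
    using assms
  proof (rule ord_induct)
    fix b assume b: "ord b" "\<And>c. c \<lhd> b \<Longrightarrow> st (case_nat c (\<lambda>_. a)) (\<^bold>\<exists> zrec (V 0) (V 1))"
    have "\<exists>f. recur f c" if "c \<lhd> b" for c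
      using b(2)[OF that] st[OF ord_mem[OF b(1) that]] by blast
    then show "st (case_nat b (\<lambda>_. a)) (\<^bold>\<exists> zrec (V 0) (V 1))"
      using st[OF b(1)] recur_step[OF b(1)] by blast
  qed
  then show ?thesis using st[OF assms] by blast
qed

lemma ev_W [simp]: "ev e t = Some a \<Longrightarrow> ord a \<Longrightarrow> ev e (zW t) = Some (W a)"
  using ev_W_recur recur_exists by blast

lemma rec_at_W:
  assumes "ord a"
  shows "(a = zero \<longrightarrow> W a = zero) \<and> (\<forall>c. a = succ c \<longrightarrow> W a = step (W c)) \<and>
     (limit a \<longrightarrow> (\<forall>z. z \<lhd> W a \<longleftrightarrow> (\<exists>c. c \<lhd> a \<and> z \<lhd> W c)))"
proof -
  obtain f where f: "recur f a" using recur_exists[OF assms] by blast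
  have app: "app f c = W c" if "c \<lhd> a \<or> c = a" for c
  proof -
    have "ord c" using that assms ord_mem by blast
    then obtain g where "recur g c" using recur_exists by blast
    with that show ?thesis by (intro recur_app[OF f assms]) auto
  qed
  have "rec_at f a" using f by (simp add: recur_def)
  then show ?thesis unfolding rec_at_def using app by (auto cong: conj_cong)
qed

text \<open>The three recursion clauses merge into one. At a successor \<open>succ c\<close> this
  needs monotonicity: for \<open>b\<close> below \<open>c\<close>, the induction hypothesis at
  \<open>b\<close> and \<open>c\<close> gives \<open>sub (W b) (W c)\<close>, and
  \<open>step\<close> preserves inclusion.\<close>

lemma mem_W:
  assumes "ord a"
  shows "x \<lhd> W a \<longleftrightarrow> (\<exists>b. b \<lhd> a \<and> x \<lhd> step (W b))"
proof -
  \<comment> \<open>The member is quantified inside the formula, so the induction hypothesis holds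
    for all members; the tail of the assignment is arbitrary.\<close>
  let ?\<phi> = "\<^bold>\<forall> (V 0 \<^bold>\<in> zW (V 1) \<^bold>\<longleftrightarrow> bex (V 1) (V 1 \<^bold>\<in> zstep (zW (V 0))))"
  have st: "st (case_nat a (\<lambda>_. x)) ?\<phi> \<longleftrightarrow> (\<forall>x. x \<lhd> W a \<longleftrightarrow> (\<exists>b. b \<lhd> a \<and> x \<lhd> step (W b)))" if "ord a" for a
    using that ord_mem[OF that] by (simp cong: conj_cong)
  have "st (case_nat a (\<lambda>_. x)) ?\<phi>"
    using assms
  proof (rule ord_induct)
    fix a assume a: "ord a" and "\<And>b. b \<lhd> a \<Longrightarrow> st (case_nat b (\<lambda>_. x)) ?\<phi>"
    then have IH: "x \<lhd> W b \<longleftrightarrow> (\<exists>c. c \<lhd> b \<and> x \<lhd> step (W c))" if "b \<lhd> a" for b x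
      using that st[OF ord_mem[OF a that]] by blast
    show "st (case_nat a (\<lambda>_. x)) ?\<phi>"
      unfolding st[OF a]
    proof (intro HOL.allI iffI)
      fix x assume x: "x \<lhd> W a"
      from a show "\<exists>b. b \<lhd> a \<and> x \<lhd> step (W b)"
      proof (cases rule: ord_cases)
        case 1
        then show ?thesis using x rec_at_W[OF a] by simp
      next
        case (2 c)
        then show ?thesis using x rec_at_W[OF a] by auto
      next
        case 3
        then obtain c where c: "c \<lhd> a" "x \<lhd> W c" using x rec_at_W[OF a] by blast
        then show ?thesis using IH[OF c(1)] ord_trans[OF a c(1)] by blast
      qed
    next
      fix x assume "\<exists>b. b \<lhd> a \<and> x \<lhd> step (W b)"
      then obtain b where b: "b \<lhd> a" "x \<lhd> step (W b)" by blast
      from a show "x \<lhd> W a"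
      proof (cases rule: ord_cases)
        case 1
        then show ?thesis using b by simp
      next
        case (2 c)
        have "sub (W b) (W c)"
        proof (cases "b = c")
          case False
          then have "b \<lhd> c" using b 2 by simp
          moreover have "c \<lhd> a" using 2 by simp
          ultimately show ?thesis unfolding sub_def using IH b(1) ord_trans[OF \<open>ord c\<close>] by blast
        qed (simp add: sub_def)
        then have "x \<lhd> step (W c)" using b(2) unfolding mem_step sub_def by blast
        then show ?thesis using 2 rec_at_W[OF a] by simp
      next
        case 3
        \<comment> \<open>A limit is closed under successors, so by the induction hypothesis
          \<open>x\<close> appears already at stage \<open>succ b\<close>.\<close>
        have "succ b \<lhd> a" using ord_succ_mem[OF a b(1)] 3 by (auto simp: limit_def)
        then show ?thesis using IH b 3 rec_at_W[OF a] mem_succ by blast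
      qed
    qed
  qed
  then show ?thesis unfolding st[OF assms] by blast
qed

lemma W_mono: "ord a \<Longrightarrow> b \<lhd> a \<Longrightarrow> sub (W b) (W a)"
  unfolding sub_def using mem_W ord_mem ord_trans by blast


subsection \<open>The class of hereditary objects\<close>

definition H :: "'a \<Rightarrow> bool" where "H x \<longleftrightarrow> (\<exists>a. ord a \<and> x \<lhd> W a)"

lemma st_H [simp]: "ev e t = Some x \<Longrightarrow> st e (zH t) \<longleftrightarrow> H x"
  by (simp add: zH_def H_def cong: conj_cong)

lemma H_iff_step: "H x \<longleftrightarrow> (\<exists>a. ord a \<and> x \<lhd> step (W a))"
proof
  assume "H x"
  then show "\<exists>a. ord a \<and> x \<lhd> step (W a)" unfolding H_def using mem_W ord_mem by blast
next
  assume "\<exists>a. ord a \<and> x \<lhd> step (W a)"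
  then obtain a where "ord a" "x \<lhd> step (W a)" by blast
  then have "x \<lhd> W (succ a)" using rec_at_W[OF ord_succ] by simp
  then show "H x" unfolding H_def using \<open>ord a\<close> ord_succ by blast
qed

text \<open>Assigning to each member of \<open>y\<close> its least stage is functional, so
  replacement collects these stages in a set \<open>s\<close>, and their supremum bounds them
  all.\<close>

lemma H_bound:
  assumes "\<And>z. z \<lhd> y \<Longrightarrow> H z"
  shows "\<exists>a. ord a \<and> sub y (W a)"
proof -
  let ?least = "\<lambda>z a. ord a \<and> z \<lhd> W a \<and> (\<forall>b. b \<lhd> a \<longrightarrow> \<not> z \<lhd> W b)"
  let ?\<phi> = "zord (V 1) \<^bold>\<and> V 0 \<^bold>\<in> zW (V 1) \<^bold>\<and> ball (V 1) (\<^bold>\<not> V 1 \<^bold>\<in> zW (V 0))"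
  have st: "st (case_nat z (case_nat a (\<lambda>_. y))) ?\<phi> \<longleftrightarrow> ?least z a" for z a
    using ord_mem[of a] by (auto cong: conj_cong)
  have "\<exists>s. \<forall>a. a \<lhd> s \<longleftrightarrow> (\<exists>z. z \<lhd> y \<and> st (case_nat z (case_nat a (\<lambda>_. y))) ?\<phi>)"
    by (rule replacement) (unfold st, use ord_linear in blast)
  then obtain s where s: "\<And>a. a \<lhd> s \<longleftrightarrow> (\<exists>z. z \<lhd> y \<and> ?least z a)" unfolding st by blast
  \<comment> \<open>The successor is taken because the supremum may itself be one of the stages in
    \<open>s\<close>.\<close>
  have ord: "ord (succ (bigun s))" by (rule ord_succ, rule ord_bigun) (use s in blast)
  have "z \<lhd> W (succ (bigun s))" if z: "z \<lhd> y" for z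
  proof -
    obtain a where "ord a" "z \<lhd> W a" using assms[OF z] unfolding H_def by blast
    then obtain m where m: "?least z m"
      using ord_least[of a "\<lambda>_. z" "zord (V 0) \<^bold>\<and> V 1 \<^bold>\<in> zW (V 0)"] ord_mem by (auto cong: conj_cong)
    then have "m \<lhd> s" using s z by blast
    then have "sub m (bigun s)" by (auto simp: sub_def)
    then have "m = bigun s \<or> m \<lhd> bigun s" using ord ord_mem[OF ord] m by (intro ord_sub) auto
    then have "m \<lhd> succ (bigun s)" by auto
    then show ?thesis using W_mono[OF ord] m unfolding sub_def by blast
  qed
  then show ?thesis using ord unfolding sub_def by blast
qed

lemma H_set [simp]: "H (pair zero y) \<longleftrightarrow> (\<forall>z. z \<lhd> y \<longrightarrow> H z)"
proof
  assume "H (pair zero y)"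
  then obtain a where "ord a" "sub y (W a)" unfolding H_iff_step mem_step by auto
  then show "\<forall>z. z \<lhd> y \<longrightarrow> H z" unfolding H_def sub_def by blast
next
  assume "\<forall>z. z \<lhd> y \<longrightarrow> H z"
  then obtain a where "ord a" "sub y (W a)" using H_bound by blast
  then show "H (pair zero y)" unfolding H_iff_step mem_step by blast
qed

lemma H_pair [simp]: "H (pair one (pair u v)) \<longleftrightarrow> H u \<and> H v"
proof
  assume "H (pair one (pair u v))"
  then obtain a where "ord a" "u \<lhd> W a" "v \<lhd> W a" unfolding H_iff_step mem_step by auto
  then show "H u \<and> H v" unfolding H_def by blast
next
  assume "H u \<and> H v"
  then obtain a where "ord a" "sub (upair u v) (W a)" using H_bound[of "upair u v"] by auto
  then show "H (pair one (pair u v))" unfolding H_iff_step mem_step sub_def by auto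
qed

lemma H_cases:
  assumes "H x" obtains y where "x = pair zero y" | u v where "x = pair one (pair u v)"
  using assms unfolding H_iff_step mem_step by blast

definition pred :: "'a \<Rightarrow> 'a \<Rightarrow> bool" where
  "pred w m \<longleftrightarrow> (\<exists>y. m = pair zero y \<and> w \<lhd> y) \<or> (\<exists>u v. m = pair one (pair u v) \<and> (w = u \<or> w = v))"

text \<open>Let \<open>a\<close> be the least stage that meets \<open>y\<close>, and
  \<open>m\<close> a common element. It lies in \<open>step (W b)\<close> for some \<open>b\<close>
  below \<open>a\<close>, so everything related to it by \<open>pred\<close> lies in
  \<open>W b\<close>, which misses \<open>y\<close>. Plain foundation on \<open>y\<close> would not
  do, since \<open>pred\<close> reaches through several memberships.\<close>

lemma H_minimal:
  assumes "\<And>z. z \<lhd> y \<Longrightarrow> H z" "z \<lhd> y"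
  shows "\<exists>m. m \<lhd> y \<and> (\<forall>w. w \<lhd> y \<longrightarrow> \<not> pred w m)"
proof -
  obtain a where "ord a" "z \<lhd> W a" using assms unfolding H_def by blast
  then obtain a where a: "ord a" "\<exists>m. m \<lhd> y \<and> m \<lhd> W a" "\<And>b. b \<lhd> a \<Longrightarrow> \<not> (\<exists>m. m \<lhd> y \<and> m \<lhd> W b)"
    using ord_least[of a "\<lambda>_. y" "zord (V 0) \<^bold>\<and> bex (V 1) (V 0 \<^bold>\<in> zW (V 1))"] ord_mem assms(2)
    by (auto cong: conj_cong)
  then obtain m b where m: "m \<lhd> y" "b \<lhd> a" "m \<lhd> step (W b)" using mem_W by blast
  have "w \<lhd> W b" if "pred w m" for w
    using that m(3) unfolding pred_def mem_step sub_def by auto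
  then show ?thesis using m a(3) by blast
qed

text \<open>The set \<open>Y\<close> from the axiom of infinity may contain other things than
  ordinals. Its ordinals still include zero and are closed under successor, and their union is a
  limit.\<close>

lemma limit_exists: "\<exists>a. limit a"
proof -
  obtain Y where Y: "\<exists>z. z \<lhd> Y \<and> (\<forall>w. \<not> w \<lhd> z)"
    "\<And>z. z \<lhd> Y \<Longrightarrow> \<exists>s. s \<lhd> Y \<and> (\<forall>w. w \<lhd> s \<longleftrightarrow> w \<lhd> z \<or> w = z)" using infinity by blast
  have zero: "zero \<lhd> Y" using Y(1) zero_iff by metis
  have succ: "succ z \<lhd> Y" if z: "z \<lhd> Y" for z
  proof -
    obtain s where "s \<lhd> Y" "\<And>w. w \<lhd> s \<longleftrightarrow> w \<lhd> z \<or> w = z" using Y(2)[OF z] by blast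
    moreover from this(2) have "s = succ z" by (intro ext) simp
    ultimately show ?thesis by simp
  qed
  obtain Q where Q: "\<And>z. z \<lhd> Q \<longleftrightarrow> z \<lhd> Y \<and> ord z"
    using separation[of Y "\<lambda>_. Y" "zord (V 0)"] by auto
  \<comment> \<open>One successor step is taken so that the union has an element, namely
    \<open>zero\<close>.\<close>
  have "succ zero \<lhd> Q" unfolding Q using succ[OF zero] ord_succ[OF ord_zero] by blast
  then have 1: "zero \<lhd> bigun Q" by auto
  have 2: "ord (bigun Q)" by (rule ord_bigun) (simp add: Q)
  have 3: "bigun Q \<noteq> succ c" for c
  proof
    assume eq: "bigun Q = succ c"
    then have "c \<lhd> bigun Q" by simp
    then obtain z where z: "z \<lhd> Q" "c \<lhd> z" by auto
    then have "succ c \<lhd> succ z" using ord_succ_mem[of z c] by (auto simp: Q)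
    moreover have "succ z \<lhd> Q" using z(1) succ ord_succ unfolding Q by blast
    ultimately have "succ c \<lhd> bigun Q" unfolding mem_bigun by blast
    then show False using eq by (metis mem_irrefl)
  qed
  from 1 have "bigun Q \<noteq> zero" by (metis mem_zero)
  with 2 3 have "limit (bigun Q)" by (simp add: limit_def)
  then show ?thesis ..
qed

end


section \<open>The interpretation of ZFP\<close>

lemma fv_abbreviations [simp]:
  "fv_fm (\<phi> \<^bold>\<and> \<psi>) = fv_fm \<phi> \<union> fv_fm \<psi>"
  "fv_fm (\<phi> \<^bold>\<or> \<psi>) = fv_fm \<phi> \<union> fv_fm \<psi>"
  "fv_fm (\<phi> \<^bold>\<longleftrightarrow> \<psi>) = fv_fm \<phi> \<union> fv_fm \<psi>"
  "fv_fm (\<^bold>\<exists> \<phi>) = {n. Suc n \<in> fv_fm \<phi>}"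
  by (auto simp: Conj_def Disj_def Iff_def Exists_def)

lemma fv_place:
  "fv_fm \<phi> \<subseteq> {0, 1, 2, 3} \<Longrightarrow> fv_fm (place [V i, V j, V k, V l] d \<phi>) \<subseteq> {i, j, k, l}"
  unfolding place_def fv_subst by (auto simp: nth_Cons split: nat.splits)

lemma fv_place_V: "fv_fm (place [V i] d \<phi>) = case_nat i (\<lambda>m. m + d) ` fv_fm \<phi>"
proof -
  have "fv_tm (if n < length [V i] then [V i] ! n else V (n - length [V i] + d)) = {case_nat i (\<lambda>m. m + d) n}" for n
    by (cases n) simp_all
  then show ?thesis unfolding place_def fv_subst by blast
qed

lemma ZFP_S5_closed:
  assumes "fv_fm \<phi> \<subseteq> {0, 1, 2, 3}"
  shows "fv_fm (ZFP_S5 \<phi>) = {}"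
proof -
  have 1: "fv_fm (place [V 1, V 0, V 4, V 3] 5 \<phi>) \<subseteq> {1, 0, 4, 3}"
    and 2: "fv_fm (place [V 0, V 1, V 5, V 4] 6 \<phi>) \<subseteq> {0, 1, 5, 4}"
    using fv_place[OF assms] by blast+
  have 3: "n \<notin> fv_fm (place [V 1, V 0, V 4, V 3] 5 \<phi>)" if "n \<notin> {1, 0, 4, 3}" for n using 1 that by blast
  have 4: "n \<notin> fv_fm (place [V 0, V 1, V 5, V 4] 6 \<phi>)" if "n \<notin> {0, 1, 5, 4}" for n using 2 that by blast
  show ?thesis
    by (auto simp: ZFP_S5_def ballP_def bexP_def Exists1_def Exists_Set_def isSet_def isPair_def
        fv_place_V 3[unfolded One_nat_def] 4[unfolded One_nat_def] split: nat.splits)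
qed

lemma ZFP_closed: "\<phi> \<in> ZFP \<Longrightarrow> fv_fm \<phi> = {}"
  using ZFP_S5_closed
  by (auto simp: ZFP_def ZFP_S1_def ZFP_S2_def ZFP_S3_def ZFP_S4_def ZFP_S6_def ZFP_P1_def ZFP_P2_def
      ZFP_P3_def ZFP_P4_def ZFP_P5_def ballP_def bexP_def Exists1_def Exists_Set_def Forall_Set_def
      Forall_Pair_def isSet_def isPair_def subsetP_def emptyP_def Desc_Set_def fv_place_V split: nat.splits)

context ZF_model
begin

primrec hatI :: "zfp_sym \<Rightarrow> 'a \<Rightarrow> 'a \<Rightarrow> bool" where
  "hatI MemP a x \<longleftrightarrow> (\<exists>y. x = pair zero y \<and> a \<lhd> y)"
| "hatI Pi1 a x \<longleftrightarrow> (\<exists>v. x = pair one (pair a v))"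
| "hatI Pi2 a x \<longleftrightarrow> (\<exists>u. x = pair one (pair u a))"

lemma st_hat: "st e (hat R s t) \<longleftrightarrow> (\<exists>a b. ev e s = Some a \<and> ev e t = Some b \<and> hatI R a b)"
  by (cases R; cases "ev e s"; cases "ev e t") (auto simp: hat_mem_def hat_pi1_def hat_pi2_def sat.simps(2))

abbreviation M where "M \<equiv> Collect H"

text \<open>Relativization to \<open>zH\<close> makes quantifiers and descriptions range over
  \<open>M\<close>. Since values in \<open>H\<close> are demanded of free variables only, a closed
  formula may be evaluated under any assignment.\<close>

lemma translation:
  fixes t :: "zfp_sym tm" and \<phi> :: "zfp_sym fm"
  shows
    "(\<And>n. n \<in> fv_tm t \<Longrightarrow> H (e n)) \<Longrightarrow> ev e (trans_tm t) = eval M hatI e t"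
    "(\<And>n. n \<in> fv_fm \<phi> \<Longrightarrow> H (e n)) \<Longrightarrow> st e (trans_fm \<phi>) = sat M hatI e \<phi>"
proof (induction t and \<phi> arbitrary: e and e)
  case (Desc \<phi>)
  have "st (case_nat x e) (trans_fm \<phi>) = sat M hatI (case_nat x e) \<phi>" if "H x" for x
    by (rule Desc) (use Desc.prems that in \<open>auto split: nat.split\<close>)
  then have "x \<in> UNIV \<and> st (case_nat x e) (zH (V 0) \<^bold>\<and> trans_fm \<phi>) \<longleftrightarrow> x \<in> M \<and> sat M hatI (case_nat x e) \<phi>" for x
    by auto
  then show ?case unfolding trans_tm.simps eval.simps by presburger
next
  case (Forall \<phi>)
  have "st (case_nat x e) (trans_fm \<phi>) = sat M hatI (case_nat x e) \<phi>" if "H x" for x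
    by (rule Forall) (use Forall.prems that in \<open>auto split: nat.split\<close>)
  then show ?case by auto
next
  case (Pred R s t)
  show ?case using Pred.IH(1)[of e] Pred.IH(2)[of e] Pred.prems by (simp add: st_hat)
next
  case (Eq s t)
  show ?case using Eq.IH(1)[of e] Eq.IH(2)[of e] Eq.prems by (simp add: sat.simps(2))
next
  case (Neg \<phi>)
  show ?case using Neg.IH[of e] Neg.prems by simp
next
  case (Imp \<phi> \<psi>)
  show ?case using Imp.IH(1)[of e] Imp.IH(2)[of e] Imp.prems by simp
qed simp

abbreviation sH where "sH \<equiv> sat M hatI"

definition is_pair :: "'a \<Rightarrow> bool" where "is_pair x \<longleftrightarrow> (\<exists>u v. x = pair one (pair u v))"

lemma is_pair_simps [simp]: "\<not> is_pair (pair zero y)" "is_pair (pair one (pair u v))"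
  by (auto simp: is_pair_def)

lemma sH_isPair [simp]: "eval M hatI e t = Some x \<Longrightarrow> H x \<Longrightarrow> sH e (isPair t) \<longleftrightarrow> is_pair x"
  by (auto simp: isPair_def is_pair_def)

lemma H_set_cases:
  assumes "H x" "\<not> is_pair x" obtains y where "x = pair zero y" "\<And>z. z \<lhd> y \<Longrightarrow> H z"
  using assms(1)
proof (cases rule: H_cases)
  case (1 y)
  then show ?thesis using assms(1) by (intro that) auto
next
  case 2
  then show ?thesis using assms(2) by simp
qed

section \<open>Truth of the axioms of ZFP in the structure \<open>M\<close>\<close>

lemmas sH_unfold = ballP_def bexP_def Exists_Set_def Forall_Set_def Forall_Pair_def isSet_def subsetP_def

text \<open>All members of a set object in \<open>H\<close> lie in \<open>H\<close> themselves, so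
  comparing members within \<open>H\<close> already determines the underlying set.\<close>

lemma sH_S1: "sH e ZFP_S1"
proof -
  have "x = y" if x: "H x" "\<not> is_pair x" and y: "H y" "\<not> is_pair y" and eq: "\<And>a. H a \<Longrightarrow> hatI MemP a x \<longleftrightarrow> hatI MemP a y" for x y
  proof -
    obtain u where u: "x = pair zero u" "\<And>z. z \<lhd> u \<Longrightarrow> H z" using H_set_cases[OF x] by blast
    obtain v where v: "y = pair zero v" "\<And>z. z \<lhd> v \<Longrightarrow> H z" using H_set_cases[OF y] by blast
    have "z \<lhd> u \<longleftrightarrow> z \<lhd> v" for z using eq[of z] u v by auto
    then have "u = v" by (rule ext)
    then show ?thesis using u v by simp
  qed
  then show ?thesis by (simp add: ZFP_S1_def sH_unfold del: hatI.simps)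
qed

text \<open>By \<open>H_set\<close>, tagging with \<open>zero\<close> turns any set of elements of
  \<open>H\<close> into an element of \<open>H\<close>; set existence in the structure is thus
  reduced to set existence in ZF.\<close>

lemma comprehension:
  assumes "\<exists>y. \<forall>z. z \<lhd> y \<longleftrightarrow> P z" "\<And>z. P z \<Longrightarrow> H z"
  shows "\<exists>y. H y \<and> \<not> is_pair y \<and> (\<forall>a. H a \<longrightarrow> (hatI MemP a y \<longleftrightarrow> P a))"
proof -
  obtain y where "\<And>z. z \<lhd> y \<longleftrightarrow> P z" using assms(1) by blast
  then show ?thesis using assms(2) by (intro exI[of _ "pair zero y"]) simp
qed

lemma sH_S2: "sH e ZFP_S2"
proof -
  have "\<exists>y. H y \<and> (\<forall>a. H a \<longrightarrow> (hatI MemP a y \<longleftrightarrow> (\<exists>z. H z \<and> hatI MemP z x \<and> hatI MemP a z)))"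
    if x: "H x" "\<not> is_pair x" for x
  proof -
    obtain u where u: "x = pair zero u" "\<And>z. z \<lhd> u \<Longrightarrow> H z" using H_set_cases[OF x] by blast
    let ?P = "\<lambda>a. \<exists>z. H z \<and> hatI MemP z x \<and> hatI MemP a z"
    \<comment> \<open>Three unions are needed as a bound: \<open>z\<close> lies in \<open>v\<close>,
      \<open>v\<close> in \<open>upair zero v\<close>, this in the pair \<open>w\<close>, and
      \<open>w\<close> in \<open>u\<close>.\<close>
    obtain y where y: "\<And>z. z \<lhd> y \<longleftrightarrow> z \<lhd> bigun (bigun (bigun u)) \<and> (\<exists>w. w \<lhd> u \<and> hatI MemP z w)"
      using separation[of "bigun (bigun (bigun u))" "\<lambda>_. u" "bex (V 1) (hat MemP (V 1) (V 0))"]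
      by (auto simp: st_hat simp del: hat.simps mem_bigun hatI.simps)
    have "z \<lhd> bigun (bigun (bigun u))" if "w \<lhd> u" "hatI MemP z w" for z w
    proof -
      obtain v where v: "w = pair zero v" "z \<lhd> v" using \<open>hatI MemP z w\<close> by auto
      then have "upair zero v \<lhd> w" "v \<lhd> upair zero v" by (simp_all add: pair_def)
      then show ?thesis using v \<open>w \<lhd> u\<close> unfolding mem_bigun by blast
    qed
    then have "z \<lhd> y \<longleftrightarrow> (\<exists>w. w \<lhd> u \<and> hatI MemP z w)" for z using y by blast
    moreover have "hatI MemP z x \<longleftrightarrow> z \<lhd> u" for z using u by simp
    ultimately have "\<forall>z. z \<lhd> y \<longleftrightarrow> ?P z" using u(2) by blast
    moreover have "H z" if "?P z" for z using that by auto
    ultimately show ?thesis using comprehension[of ?P] by blast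
  qed
  then show ?thesis by (simp add: ZFP_S2_def sH_unfold del: hatI.simps)
qed

lemma sH_S3: "sH e ZFP_S3"
proof -
  have "\<exists>y. H y \<and> (\<forall>a. H a \<longrightarrow> (hatI MemP a y \<longleftrightarrow>
      \<not> is_pair a \<and> \<not> is_pair x \<and> (\<forall>z. H z \<longrightarrow> hatI MemP z a \<longrightarrow> hatI MemP z x)))"
    if x: "H x" "\<not> is_pair x" for x
  proof -
    obtain u where u: "x = pair zero u" "\<And>z. z \<lhd> u \<Longrightarrow> H z" using H_set_cases[OF x] by blast
    have "H z" if "\<exists>s. sub s u \<and> z = pair zero s" for z using u that by (auto simp: sub_def)
    moreover have "\<forall>z. z \<lhd> times (sing zero) (pow u) \<longleftrightarrow> (\<exists>s. sub s u \<and> z = pair zero s)" by auto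
    ultimately obtain y where y: "H y" "\<And>a. H a \<Longrightarrow> hatI MemP a y \<longleftrightarrow> (\<exists>s. sub s u \<and> a = pair zero s)"
      using comprehension[of "\<lambda>a. \<exists>s. sub s u \<and> a = pair zero s"] by blast
    have "(\<exists>s. sub s u \<and> a = pair zero s) \<longleftrightarrow>
        \<not> is_pair a \<and> \<not> is_pair x \<and> (\<forall>z. H z \<longrightarrow> hatI MemP z a \<longrightarrow> hatI MemP z x)" if "H a" for a
      using that
    proof (cases rule: H_cases)
      case (1 v)
      then show ?thesis using that u by (auto simp: sub_def)
    qed simp
    then show ?thesis using y by blast
  qed
  then show ?thesis by (simp add: ZFP_S3_def sH_unfold del: hatI.simps)
qed

text \<open>The witness is the tagged stage \<open>W l\<close> at a limit \<open>l\<close>. An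
  element \<open>x\<close> of it lies in some \<open>W b\<close> with \<open>b\<close> below
  \<open>l\<close>; the members of \<open>x\<close> together with \<open>x\<close> form a subset of
  \<open>W b\<close>, and tagging this gives an element of \<open>step (W b)\<close>, hence again of
  \<open>W l\<close>.\<close>

lemma sH_S4: "sH e ZFP_S4"
proof -
  obtain l where l: "limit l" using limit_exists by blast
  then have ol: "ord l" by (simp add: limit_def)
  have mem_l: "x \<lhd> W l \<longleftrightarrow> (\<exists>b. b \<lhd> l \<and> x \<lhd> W b)" for x using rec_at_W[OF ol] l by blast
  have WH: "H z" if "z \<lhd> W b" "b \<lhd> l" for z b using that ol ord_mem unfolding H_def by blast
  have succ: "x \<lhd> W l" if "b \<lhd> l" "x \<lhd> step (W b)" for b x using mem_W[OF ol] that by blast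
  let ?y = "pair zero (W l)"
  have "H ?y" unfolding H_set using ol unfolding H_def by blast
  moreover have "\<exists>z. H z \<and> \<not> is_pair z \<and> hatI MemP z ?y \<and> (\<forall>a. H a \<longrightarrow> \<not> hatI MemP a z)"
  proof -
    obtain b where "b \<lhd> l" using l by (auto simp: limit_def zero_iff)
    then have "pair zero zero \<lhd> W l" by (rule succ) (auto simp: mem_step sub_def)
    then show ?thesis by (intro exI[of _ "pair zero zero"]) simp
  qed
  moreover have "\<exists>s. H s \<and> hatI MemP s ?y \<and> (\<forall>c. H c \<longrightarrow> (hatI MemP c s \<longleftrightarrow> hatI MemP c x \<or> c = x))"
    if "H x" "hatI MemP x ?y" for x
  proof -
    have "x \<lhd> W l" using that by simp
    then obtain b where b: "b \<lhd> l" "x \<lhd> W b" using mem_l by blast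
    have "\<exists>s. sub s (W b) \<and> (\<forall>c. c \<lhd> s \<longleftrightarrow> hatI MemP c x \<or> c = x)"
      using \<open>H x\<close>
    proof (cases rule: H_cases)
      case (1 y)
      have "sub y (W b)"
      proof -
        \<comment> \<open>The object \<open>x\<close> was formed at an earlier stage
          \<open>d\<close>, so its members lie in \<open>W d\<close> and hence in
          \<open>W b\<close>.\<close>
        obtain d where d: "d \<lhd> b" "x \<lhd> step (W d)" using b mem_W ord_mem[OF ol] by blast
        then have "sub y (W d)" using 1 by (auto simp: mem_step)
        then show ?thesis using W_mono[OF ord_mem[OF ol b(1)] d(1)] by (auto simp: sub_def)
      qed
      then show ?thesis using 1 b by (intro exI[of _ "un y (sing x)"]) (auto simp: sub_def)
    next
      case 2
      then show ?thesis using b by (intro exI[of _ "sing x"]) (auto simp: sub_def)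
    qed
    then obtain s where s: "sub s (W b)" "\<And>c. c \<lhd> s \<longleftrightarrow> hatI MemP c x \<or> c = x" by blast
    have "pair zero s \<lhd> W l" using b(1) by (rule succ) (use s in \<open>auto simp: mem_step\<close>)
    then show ?thesis using s WH[OF _ b(1)] by (intro exI[of _ "pair zero s"]) (auto simp: sub_def)
  qed
  ultimately have "H ?y \<and> (\<exists>z. H z \<and> \<not> is_pair z \<and> hatI MemP z ?y \<and> (\<forall>a. H a \<longrightarrow> \<not> hatI MemP a z)) \<and>
      (\<forall>x. H x \<longrightarrow> hatI MemP x ?y \<longrightarrow>
        (\<exists>s. H s \<and> hatI MemP s ?y \<and> (\<forall>c. H c \<longrightarrow> (hatI MemP c s \<longleftrightarrow> hatI MemP c x \<or> c = x))))"
    by (intro conjI HOL.allI HOL.impI)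
  then have "\<exists>y. H y \<and> (\<exists>z. H z \<and> \<not> is_pair z \<and> hatI MemP z y \<and> (\<forall>a. H a \<longrightarrow> \<not> hatI MemP a z)) \<and>
      (\<forall>x. H x \<longrightarrow> hatI MemP x y \<longrightarrow>
        (\<exists>s. H s \<and> hatI MemP s y \<and> (\<forall>c. H c \<longrightarrow> (hatI MemP c s \<longleftrightarrow> hatI MemP c x \<or> c = x))))"
    by - (rule exI[of _ ?y])
  then show ?thesis by (simp add: ZFP_S4_def sH_unfold del: hatI.simps)
qed

text \<open>Replacement is applied to the translated formula. The hypothesis gives uniqueness among
  elements of \<open>H\<close> only, so the conjunct \<open>zH (V 1)\<close> is added to make the
  formula functional. If \<open>x\<close> is a pair it has no members, and the empty set
  serves.\<close>

lemma sH_S5: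
  assumes fv: "fv_fm \<phi> \<subseteq> {0, 1, 2, 3}"
  shows "sH e (ZFP_S5 \<phi>)"
proof -
  let ?e = "\<lambda>a b c1 c2. case_nat a (case_nat b (case_nat c1 (case_nat c2 e)))"
  have "\<exists>y. H y \<and> \<not> is_pair y \<and>
      (\<forall>b. H b \<longrightarrow> (hatI MemP b y \<longleftrightarrow> (\<exists>a. H a \<and> hatI MemP a x \<and> sH (?e a b c1 c2) \<phi>)))"
    if H: "H c1" "H c2" "H x"
      and ex1: "\<And>a. H a \<Longrightarrow> hatI MemP a x \<Longrightarrow> \<exists>!b. H b \<and> sH (?e a b c1 c2) \<phi>" for c1 c2 x
  proof -
    have tr: "st (?e a b c1 c2) (zH (V 1) \<^bold>\<and> trans_fm \<phi>) \<longleftrightarrow> H b \<and> sH (?e a b c1 c2) \<phi>" if "H a" for a b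
    proof (cases "H b")
      case True
      have "st (?e a b c1 c2) (trans_fm \<phi>) \<longleftrightarrow> sH (?e a b c1 c2) \<phi>"
        by (rule translation(2)) (use fv H that True in \<open>auto simp: numeral_eq_Suc\<close>)
      with True show ?thesis by simp
    qed simp
    let ?P = "\<lambda>b. \<exists>a. H a \<and> hatI MemP a x \<and> H b \<and> sH (?e a b c1 c2) \<phi>"
    have "\<exists>y. \<forall>b. b \<lhd> y \<longleftrightarrow> ?P b"
      using \<open>H x\<close>
    proof (cases rule: H_cases)
      case (1 u)
      then have u: "hatI MemP a x \<longleftrightarrow> a \<lhd> u" "a \<lhd> u \<Longrightarrow> H a" for a using \<open>H x\<close> by auto
      have "\<exists>y. \<forall>b. b \<lhd> y \<longleftrightarrow> (\<exists>a. a \<lhd> u \<and> st (case_nat a (case_nat b (case_nat c1 (case_nat c2 e)))) (zH (V 1) \<^bold>\<and> trans_fm \<phi>))"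
      proof (rule replacement)
        fix a b c assume a: "a \<lhd> u"
          and "st (?e a b c1 c2) (zH (V 1) \<^bold>\<and> trans_fm \<phi>)" "st (?e a c c1 c2) (zH (V 1) \<^bold>\<and> trans_fm \<phi>)"
        then show "b = c" using ex1[of a] u tr[OF u(2)[OF a]] by blast
      qed
      then show ?thesis using u tr by metis
    next
      case 2
      then show ?thesis by (intro exI[of _ zero]) auto
    qed
    from comprehension[OF this] show ?thesis by (auto simp del: hatI.simps)
  qed
  then show ?thesis by (simp add: ZFP_S5_def sH_unfold del: hatI.simps)
qed

lemma eval_emptyP [simp]: "eval M hatI e emptyP = Some (pair zero zero)"
proof -
  have "H x \<and> \<not> is_pair x \<and> (\<forall>a. H a \<longrightarrow> \<not> hatI MemP a x) \<longleftrightarrow> x = pair zero zero" for x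
  proof
    assume *: "H x \<and> \<not> is_pair x \<and> (\<forall>a. H a \<longrightarrow> \<not> hatI MemP a x)"
    then obtain y where y: "x = pair zero y" "\<And>z. z \<lhd> y \<Longrightarrow> H z" using H_set_cases by blast
    then have "y = zero" using * by (auto simp: zero_iff)
    then show "x = pair zero zero" using y by simp
  qed simp
  moreover have "x \<in> M \<and> sH (case_nat x e) (isSet (V 0) \<^bold>\<and> (\<^bold>\<forall> (\<^bold>\<not> V 0 \<^bold>\<in>\<^sub>P V 1))) \<longleftrightarrow>
      H x \<and> \<not> is_pair x \<and> (\<forall>a. H a \<longrightarrow> \<not> hatI MemP a x)" for x
    by (simp add: sH_unfold del: hatI.simps cong: conj_cong)
  ultimately show ?thesis unfolding emptyP_def Desc_Set_def eval_Desc_iff by blast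
qed

text \<open>The three disjuncts together amount to \<open>pred b a\<close>, so a member provided by
  \<open>H_minimal\<close> is as required.\<close>

lemma sH_S6: "sH e ZFP_S6"
proof -
  have "x = pair zero zero \<or> (\<exists>a. H a \<and> hatI MemP a x \<and>
      \<not> (\<exists>b. H b \<and> hatI MemP b x \<and> (hatI Pi1 b a \<or> hatI Pi2 b a \<or> hatI MemP b a)))"
    if x: "H x" "\<not> is_pair x" for x
  proof -
    obtain u where u: "x = pair zero u" "\<And>z. z \<lhd> u \<Longrightarrow> H z" using H_set_cases[OF x] by blast
    show ?thesis
    proof (cases "u = zero")
      case True
      then show ?thesis using u by simp
    next
      case False
      then obtain z where "z \<lhd> u" by (auto simp: zero_iff)
      then obtain m where m: "m \<lhd> u" "\<And>w. w \<lhd> u \<Longrightarrow> \<not> pred w m" using H_minimal[OF u(2)] by blast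
      have "pred b m" if "hatI Pi1 b m \<or> hatI Pi2 b m \<or> hatI MemP b m" for b
        using that by (auto simp: pred_def)
      moreover have "hatI MemP b x \<longleftrightarrow> b \<lhd> u" for b using u by simp
      ultimately show ?thesis using m u(2) by blast
    qed
  qed
  then show ?thesis by (simp add: ZFP_S6_def sH_unfold del: hatI.simps)
qed

lemma sH_P1: "sH e ZFP_P1"
proof -
  have "\<not> hatI MemP a p" if "is_pair p" for a p using that by (auto simp: is_pair_def)
  then show ?thesis by (simp add: ZFP_P1_def sH_unfold del: hatI.simps)
qed

lemma sH_P2: "sH e ZFP_P2"
proof -
  have "\<exists>p. H p \<and> hatI Pi1 a p \<and> hatI Pi2 b p" if "H a" "H b" for a b
    using that by (intro exI[of _ "pair one (pair a b)"]) simp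
  then show ?thesis by (simp add: ZFP_P2_def sH_unfold del: hatI.simps)
qed

lemma sH_P3: "sH e ZFP_P3"
proof -
  have "(\<exists>a. H a \<and> hatI Pi1 a p) \<longleftrightarrow> (\<exists>b. H b \<and> hatI Pi2 b p)" if "H p" for p
    using that by auto
  then show ?thesis by (simp add: ZFP_P3_def sH_unfold del: hatI.simps)
qed

lemma sH_P4: "sH e ZFP_P4"
proof -
  have "(\<exists>!a. H a \<and> hatI Pi1 a p) \<and> (\<exists>!b. H b \<and> hatI Pi2 b p)" if "H p" "is_pair p" for p
    using that by (auto simp: is_pair_def)
  then show ?thesis by (simp add: ZFP_P4_def sH_unfold del: hatI.simps)
qed

lemma sH_P5: "sH e ZFP_P5"
proof -
  have "p = q" if p: "H p" "is_pair p" and q: "is_pair q"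
    and eq: "\<And>a. H a \<Longrightarrow> (hatI Pi1 a p \<longleftrightarrow> hatI Pi1 a q) \<and> (hatI Pi2 a p \<longleftrightarrow> hatI Pi2 a q)" for p q
  proof -
    obtain u v where "p = pair one (pair u v)" "H u" "H v" using p by (auto simp: is_pair_def)
    then show ?thesis using q eq[of u] eq[of v] by (auto simp: is_pair_def)
  qed
  then show ?thesis by (simp add: ZFP_P5_def sH_unfold del: hatI.simps)
qed

theorem ZFP_sound: "\<phi> \<in> ZFP \<Longrightarrow> sH e \<phi>"
  using sH_S1 sH_S2 sH_S3 sH_S4 sH_S5 sH_S6 sH_P1 sH_P2 sH_P3 sH_P4 sH_P5 by (auto simp: ZFP_def)

end

section \<open>From truth in models back to derivability and consistency\<close>

theorem theorem1:
  shows "(\<forall>\<phi> \<in> ZFP. ZF \<turnstile> trans_fm \<phi>) \<and> (consistent ZF \<longrightarrow> consistent ZFP)"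
proof (intro conjI ballI HOL.impI)
  fix \<phi> assume \<phi>: "\<phi> \<in> ZFP"
  show "ZF \<turnstile> trans_fm \<phi>"
  proof (rule ccontr)
    assume "\<not> ?thesis"
    \<comment> \<open>Completeness in contrapositive form: an underivable translation would fail in
      some model of ZF.\<close>
    then have "consistent (insert (\<^bold>\<not> trans_fm \<phi>) ZF)" using inconsistent_insert_Neg by blast
    then obtain I :: "zf_sym \<Rightarrow> nat \<Rightarrow> nat \<Rightarrow> bool" and e where "ZF_model I"
      and *: "\<not> sat UNIV I e (trans_fm \<phi>)"
      using ZF_model_existence[OF subset_insertI] by force
    then interpret ZF_model I by simp
    \<comment> \<open>The values of \<open>e\<close> may lie outside \<open>H\<close>; closedness of
      \<open>\<phi>\<close> makes this harmless.\<close>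
    have "st e (trans_fm \<phi>) \<longleftrightarrow> sH e \<phi>" by (rule translation(2)) (simp add: ZFP_closed[OF \<phi>])
    with * ZFP_sound[OF \<phi>] show False by simp
  qed
next
  assume "consistent ZF"
  then obtain I :: "zf_sym \<Rightarrow> nat \<Rightarrow> nat \<Rightarrow> bool" where "ZF_model I"
    using ZF_model_existence[OF subset_refl] by blast
  then interpret ZF_model I .
  show "consistent ZFP"
    unfolding consistent_def
  proof
    \<comment> \<open>\<open>soundness\<close> asks for an assignment into \<open>M\<close>; the
      empty set of the structure is taken as the value of every variable.\<close>
    let ?e = "\<lambda>_. pair zero zero"
    assume "\<exists>\<phi>. (ZFP \<turnstile> \<phi>) \<and> (ZFP \<turnstile> \<^bold>\<not> \<phi>)"
    then obtain \<phi> where "ZFP \<turnstile> \<phi>" "ZFP \<turnstile> \<^bold>\<not> \<phi>" by blast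
    then have "sH ?e \<phi>" "sH ?e (\<^bold>\<not> \<phi>)"
      by (auto intro: soundness ZFP_sound simp del: sat.simps)
    then show False by simp
  qed
qed

end
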